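(* Let $\omega\in\mathbb{C}$ be a root of unity of odd order $N>1$ and let $W$ be a local representation, with classical shadow $[\rho^{ab}]$ and central charge $h_C$, of the balanced Chekhov-Fock algebra $\mathcal{Z}_{\omega}(\mathbf{\Sigma},\Delta)$ of an arbitrary punctured surface $\mathbf{\Sigma}=(\Sigma,\mathcal{P})$ equipped with a topological triangulation $\Delta$. The set of isomorphism classes of simple submodules of $W$ is the set of isomorphism classes of irreducible representations of $\mathcal{Z}_{\omega}(\mathbf{\Sigma},\Delta)$ with classical shadow $[\rho^{ab}]$ and for which the product of all boundary and inner puncture invariants is equal to $h_C$. Moreover, each simple summand arises with multiplicity $N^{g}$, where $g$ denotes the genus of $\Sigma$.
   Context: **Punctured surfaces, triangulations.** A punctured surface $\mathbf{\Sigma}=(\Sigma,\mathcal{P})$ is a compact oriented surface $\Sigma$ (possibly with boundary) with a finite set $\mathcal{P}\subset\Sigma$ of punctures meeting every boundary component; $\Sigma_{\mathcal{P}}=\Sigma\setminus\mathcal{P}$; boundary arcs are the connected components of $\partial\Sigma_{\mathcal{P}}$; inner punctures are those in the interior of $\Sigma$. It admits a triangulation if every connected component has at least one puncture and none is a sphere with one or two punctures or a disc with one or two punctures on its boundary. A topological triangulation $\Delta$ is a maximal collection $\mathcal{E}(\Delta)$ of embedded arcs (edges) with endpoints in $\mathcal{P}$, with pairwise disjoint interiors not meeting $\mathcal{P}$, non contractible and pairwise non isotopic in $\Sigma_{\mathcal{P}}$ relatively to endpoints, containing all boundary arcs. It presents $\Sigma$ as a gluing of triangles, the faces of $\Delta$,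 whose set is $F(\Delta)$. **Balanced Chekhov-Fock algebra.** For edges $e,e'$ let $a_{e,e'}$ be the number of faces $\mathbb{T}$ of $\Delta$ for which $e$ and $e'$ are edges of $\mathbb{T}$ such that one passes from $e$ to $e'$ in the counter-clockwise direction in $\mathbb{T}$; $\langle e,e'\rangle=a_{e,e'}-a_{e',e}$. $\mathcal{T}_{\omega}(\mathbf{\Sigma},\Delta)$ is the $\mathbb{C}$-algebra generated by invertible $Z_e^{\pm1}$, $e\in\mathcal{E}(\Delta)$, with $Z_eZ_{e'}=\omega^{2\langle e,e'\rangle}Z_{e'}Z_e$. Weyl-ordered monomials: $[Z_{e_1}^{k_1}\cdots Z_{e_n}^{k_n}]=\omega^{-\sum_{i<j}k_ik_j\langle e_i,e_j\rangle}Z_{e_1}^{k_1}\cdots Z_{e_n}^{k_n}$. A monomial is balanced if for each face with sides $e_a,e_b,e_c$, $k_a+k_b+k_c$ is even; $K_{\Delta}$ is the group of balanced exponents. $\mathcal{Z}_{\omega}(\mathbf{\Sigma},\Delta)$ is the subalgebra generated by balanced monomials. For a single triangle $\mathbb{T}$ (a disc with three punctures on its boundary) write $\mathcal{Z}_{\omega}(\mathbb{T})$. There is an injective algebra morphism $i^{\Delta}:\mathcal{Z}_{\omega}(\mathbf{\Sigma},\Delta)\to\bigotimes_{\mathbb{T}\in F(\Delta)}\mathcal{Z}_{\omega}(\mathbb{T})$ sending a Weyl-ordered balanced monomial with exponents $k_e$ to the Weyl-ordered monomial in which every side of a triangle that is a lift of $e$ has exponent $k_e$. **Classical shadow and invariants.**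 The elements $[\prod_eZ_e^{Nk_e}]$, $k\in K_{\Delta}$, are central. The abelian classical shadow of a representation on which they act by scalars is the group morphism $\rho^{ab}:K_{\Delta}\to\mathbb{C}^*$ given by these scalars; via an isomorphism $K_{\Delta}\cong\mathrm{H}_1^{\sigma}(\hat{\Sigma}_{\hat{\mathcal{P}}\cup\hat{B}},\partial\hat{\Sigma}_{\hat{\mathcal{P}}\cup\hat{B}};\mathbb{Z})$ with the $\sigma$-anti-invariant relative homology of a double branched covering $\hat{\Sigma}$ of $\Sigma$ with covering involution $\sigma$ (punctures and branch points removed), it is regarded as a point $[\rho^{ab}]$ of the variety $\mathcal{X}^{\sigma}_{\mathbb{C}^*}(\hat{\mathbf{\Sigma}})$ of group morphisms from this homology group to $\mathbb{C}^*$. For an inner puncture $p$, $H_p=[\prod_eZ_e^{k_p(e)}]$, where $k_p(e)$ is the number of endpoints of $e$ equal to $p$; for a boundary component $\partial$, $H_{\partial}=[\prod_eZ_e^{k_{\partial}(e)}]$, where $k_{\partial}(e)$ is the number of endpoints of $e$ in $\partial$. These are central, and the inner puncture and boundary invariants of an irreducible representation are the scalars by which the $H_p$ and $H_{\partial}$ act. **Local representations.** A local representation is a representation of the form $\left(\bigotimes_{\mathbb{T}}r_{\mathbb{T}}\right)\circ i^{\Delta}:\mathcal{Z}_{\omega}(\mathbf{\Sigma},\Delta)\to\mathrm{End}\left(\bigotimes_{\mathbb{T}\in F(\Delta)}W_{\mathbb{T}}\right)$ where each $r_{\mathbb{T}}:\mathcal{Z}_{\omega}(\mathbb{T})\to\mathrm{End}(W_{\mathbb{T}})$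 is an irreducible representation. On a local representation all $[\prod_eZ_e^{Nk_e}]$ act by scalars (defining its classical shadow), and $H_c=[\prod_{e\in\mathcal{E}(\Delta)}Z_e^2]$ acts by a scalar $h_C$, its central charge.
   Formalization: The surface Σ is assumed connected; for several components the claim fails (for two disjoint triangles W is simple, while N irreducible representations share its classical shadow and the product h_C). *)

theory Defs
  imports "HOL-Analysis.Analysis" "HOL-Library.Poly_Mapping"
begin

section \<open>Triangulated punctured surfaces\<close>

text \<open>The model triangle has its vertices in counter-clockwise order; its \<open>i\<close>-th side runs
  from vertex \<open>i\<close> to vertex \<open>i + 1\<close>, indices being read modulo 3.\<close>

definition tri_vertex :: "nat \<Rightarrow> complex" where
  "tri_vertex i = (if i mod 3 = 0 then 0 else if i mod 3 = 1 then 1 else \<i>)"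

definition model_triangle :: "complex set" where
  "model_triangle = convex hull {tri_vertex 0, tri_vertex 1, tri_vertex 2}"

definition side_point :: "nat \<Rightarrow> real \<Rightarrow> complex" where
  "side_point i = linepath (tri_vertex i) (tri_vertex (i + 1))"

definition sides :: "'f set \<Rightarrow> ('f \<times> nat) set" where
  "sides F = F \<times> {..<3}"

text \<open>A gluing pattern is an involution \<open>g\<close> of the set of sides whose fixed points are the sides
  left unglued. The parameter is reversed along a pair of glued sides, so that the orientations of
  the triangles match and the quotient is oriented; every compact oriented punctured surface with a
  topological triangulation is of this form.\<close>

definition gluing_relation ::
    "'f set \<Rightarrow> ('f \<times> nat \<Rightarrow> 'f \<times> nat) \<Rightarrow> (('f \<times> complex) \<times> ('f \<times> complex)) set" where
  "gluing_relation F g =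
     {((T, side_point i t), (T', side_point j (1 - t))) | T i T' j t.
        (T, i) \<in> sides F \<and> g (T, i) = (T', j) \<and> (T', j) \<noteq> (T, i) \<and> t \<in> {0..1}}"

text \<open>\<open>triangulated_surface X P F q\<close>: the oriented surface \<open>X\<close> with set of punctures \<open>P\<close> is presented, by
  means of the quotient map \<open>q\<close>, as a gluing of the triangles indexed by \<open>F\<close>; the map
  \<open>\<lambda>x. q (T, x)\<close> is the orientation-preserving characteristic map of the face \<open>T\<close>.
  \<open>F\<close>, \<open>q\<close> encode the topological triangulation: its edges are the images of the sides.\<close>

definition triangulated_surface ::
    "'a topology \<Rightarrow> 'a set \<Rightarrow> 'f set \<Rightarrow> ('f \<times> complex \<Rightarrow> 'a) \<Rightarrow> bool" where
  "triangulated_surface X P F q \<longleftrightarrow>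
     finite F \<and> F \<noteq> {} \<and>
     quotient_map (prod_topology (discrete_topology F) (top_of_set model_triangle)) X q \<and>
     (\<exists>g. (\<forall>s\<in>sides F. g s \<in> sides F \<and> g (g s) = s) \<and>
          (\<forall>x\<in>F \<times> model_triangle. \<forall>y\<in>F \<times> model_triangle.
             q x = q y \<longleftrightarrow> (x, y) \<in> (gluing_relation F g)\<^sup>*)) \<and>
     P = q ` (F \<times> {tri_vertex 0, tri_vertex 1, tri_vertex 2})"

text \<open>The part of a triangulation on which the algebras depend: the faces, and the edge carried by
  each side of each face, the sides being numbered counter-clockwise.\<close>

record ('f, 'e) pattern =
  faces :: "'f set"
  edge_at :: "'f \<times> nat \<Rightarrow> 'e"

definition edges :: "('f, 'e) pattern \<Rightarrow> 'e set" where
  "edges D = edge_at D ` sides (faces D)"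

definition pattern_of :: "'f set \<Rightarrow> ('f \<times> complex \<Rightarrow> 'a) \<Rightarrow> ('f, 'a set) pattern" where
  "pattern_of F q =
     \<lparr>faces = F, edge_at = (\<lambda>(T, i). q ` ({T} \<times> (side_point i ` {0..1})))\<rparr>"

text \<open>A boundary arc is an edge that is a side of the faces only once.\<close>

definition boundary_arcs :: "'f set \<Rightarrow> ('f \<times> complex \<Rightarrow> 'a) \<Rightarrow> 'a set set" where
  "boundary_arcs F q = {e \<in> edges (pattern_of F q).
      card {s \<in> sides F. edge_at (pattern_of F q) s = e} = 1}"

definition surface_boundary :: "'f set \<Rightarrow> ('f \<times> complex \<Rightarrow> 'a) \<Rightarrow> 'a set" where
  "surface_boundary F q = \<Union>(boundary_arcs F q)"

definition boundary_components ::
    "'a topology \<Rightarrow> 'f set \<Rightarrow> ('f \<times> complex \<Rightarrow> 'a) \<Rightarrow> 'a set set" where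
  "boundary_components X F q =
     connected_components_of (subtopology X (surface_boundary F q))"

definition inner_punctures :: "'a set \<Rightarrow> 'f set \<Rightarrow> ('f \<times> complex \<Rightarrow> 'a) \<Rightarrow> 'a set" where
  "inner_punctures P F q = P - surface_boundary F q"

text \<open>The number (0, 1 or 2) of endpoints of the edge \<open>e\<close> lying in \<open>Q\<close>. Two sides carrying the same
  edge have the same endpoints up to order, so the chosen side is immaterial.\<close>

definition endpoints_in ::
    "'f set \<Rightarrow> ('f \<times> complex \<Rightarrow> 'a) \<Rightarrow> 'a set \<Rightarrow> 'a set \<Rightarrow> nat" where
  "endpoints_in F q Q e =
     (case (SOME s. s \<in> sides F \<and> edge_at (pattern_of F q) s = e) of
        (T, i) \<Rightarrow> of_bool (q (T, tri_vertex i) \<in> Q) + of_bool (q (T, tri_vertex (i + 1)) \<in> Q))"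

text \<open>The genus \<open>g\<close> of a compact connected oriented surface with \<open>b\<close> boundary components is given
  by \<open>\<chi> = 2 - 2 g - b\<close>; the triangulation is a cell decomposition that computes \<open>\<chi>\<close>.\<close>

definition euler_characteristic :: "'a set \<Rightarrow> 'f set \<Rightarrow> ('f \<times> complex \<Rightarrow> 'a) \<Rightarrow> int" where
  "euler_characteristic P F q =
     int (card P) - int (card (edges (pattern_of F q))) + int (card F)"

definition genus :: "'a topology \<Rightarrow> 'a set \<Rightarrow> 'f set \<Rightarrow> ('f \<times> complex \<Rightarrow> 'a) \<Rightarrow> nat" where
  "genus X P F q =
     (THE g. euler_characteristic P F q = 2 - 2 * int g - int (card (boundary_components X F q)))"


section \<open>Balanced Chekhov-Fock algebras\<close>

definition face_count :: "('f, 'e) pattern \<Rightarrow> 'e \<Rightarrow> 'e \<Rightarrow> nat" where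
  "face_count D e e' =
     card {T \<in> faces D. \<exists>i<3. edge_at D (T, i) = e \<and> edge_at D (T, (i + 1) mod 3) = e'}"

definition bracket :: "('f, 'e) pattern \<Rightarrow> 'e \<Rightarrow> 'e \<Rightarrow> int" where
  "bracket D e e' = int (face_count D e e') - int (face_count D e' e)"

definition form :: "('f, 'e) pattern \<Rightarrow> ('e \<Rightarrow> int) \<Rightarrow> ('e \<Rightarrow> int) \<Rightarrow> int" where
  "form D k l = (\<Sum>e\<in>edges D. \<Sum>e'\<in>edges D. k e * l e' * bracket D e e')"

text \<open>An element \<open>\<Sum>k. x\<^sub>k [Z\<^sup>k]\<close> of the quantum torus generated by the \<open>Z\<^sub>e\<^sup>\<plusminus>\<^sup>1\<close> is represented
  by its finitely many coefficients \<open>x\<^sub>k\<close> in the linear basis of Weyl-ordered monomials. In this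
  basis the product is \<open>[Z\<^sup>k] [Z\<^sup>l] = \<omega>\<^bsup>\<langle>k,l\<rangle>\<^esup> [Z\<^sup>k\<^sup>+\<^sup>l]\<close>; below, the defining relations of the torus
  and the formula for Weyl-ordered monomials are derived. The product \<open>(*)\<close> that the library puts
  on finitely supported functions is not used.\<close>

type_synonym 'e torus = "('e \<Rightarrow> int) \<Rightarrow>\<^sub>0 complex"

definition weyl :: "('e \<Rightarrow> int) \<Rightarrow> 'e torus" where
  "weyl k = Poly_Mapping.single k 1"

definition torus_scale :: "complex \<Rightarrow> 'e torus \<Rightarrow> 'e torus" where
  "torus_scale c = Poly_Mapping.map ((*) c)"

definition torus_mult :: "complex \<Rightarrow> ('f, 'e) pattern \<Rightarrow> 'e torus \<Rightarrow> 'e torus \<Rightarrow> 'e torus" where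
  "torus_mult \<omega> D x y =
     (\<Sum>k\<in>Poly_Mapping.keys x. \<Sum>l\<in>Poly_Mapping.keys y.
        Poly_Mapping.single (\<lambda>e. k e + l e)
          (Poly_Mapping.lookup x k * Poly_Mapping.lookup y l * \<omega> powi form D k l))"

definition torus_one :: "'e torus" where
  "torus_one = weyl (\<lambda>_. 0)"

text \<open>\<open>gen_pow e n\<close> is \<open>Z\<^sub>e\<^sup>n\<close>.\<close>

definition gen_pow :: "'e \<Rightarrow> int \<Rightarrow> 'e torus" where
  "gen_pow e n = weyl (\<lambda>e'. if e' = e then n else 0)"

lemma torus_scale_single:
  "torus_scale c (Poly_Mapping.single k a) = Poly_Mapping.single k (c * a)"
  by (rule poly_mapping_eqI)
    (simp add: torus_scale_def lookup_single when_def Poly_Mapping.map.rep_eq)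

lemma torus_mult_single:
  "torus_mult \<omega> D (Poly_Mapping.single k a) (Poly_Mapping.single l b) =
     Poly_Mapping.single (\<lambda>e. k e + l e) (a * b * \<omega> powi form D k l)"
  by (cases "a = 0"; cases "b = 0") (simp_all add: torus_mult_def)

lemma weyl_mult:
  "torus_mult \<omega> D (weyl k) (weyl l) = torus_scale (\<omega> powi form D k l) (weyl (\<lambda>e. k e + l e))"
  by (simp add: weyl_def torus_mult_single torus_scale_single)

lemma bracket_skew: "bracket D e e' = - bracket D e' e"
  by (simp add: bracket_def)

lemma form_single:
  assumes "finite (edges D)" "e \<in> edges D" "e' \<in> edges D"
  shows "form D (\<lambda>x. if x = e then m else 0) (\<lambda>x. if x = e' then n else 0) = m * n * bracket D e e'"
proof -
  have "form D (\<lambda>x. if x = e then m else 0) (\<lambda>x. if x = e' then n else 0) =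
      (\<Sum>x\<in>edges D. \<Sum>y\<in>edges D. if y = e' then (if x = e then m * n * bracket D e e' else 0) else 0)"
    unfolding form_def by (intro sum.cong) auto
  then show ?thesis
    using assms by (simp add: sum.delta)
qed

lemma gen_pow_add:
  assumes "finite (edges D)" "e \<in> edges D"
  shows "torus_mult \<omega> D (gen_pow e m) (gen_pow e n) = gen_pow e (m + n)"
proof -
  have "bracket D e e = 0" by (simp add: bracket_def)
  moreover have "(\<lambda>x. (if x = e then m else 0) + (if x = e then n else 0)) =
      (\<lambda>x. if x = e then m + n else (0::int))" by auto
  ultimately show ?thesis
    using form_single[OF assms(1,2,2), of m n]
    by (simp add: gen_pow_def torus_mult_single weyl_def)
qed

lemma gen_pow_0: "gen_pow e 0 = torus_one"
  by (simp add: gen_pow_def torus_one_def)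

lemma gen_commutation:
  assumes "finite (edges D)" "e \<in> edges D" "e' \<in> edges D" "\<omega> \<noteq> 0"
  shows "torus_mult \<omega> D (gen_pow e 1) (gen_pow e' 1) =
    torus_scale (\<omega> powi (2 * bracket D e e')) (torus_mult \<omega> D (gen_pow e' 1) (gen_pow e 1))"
proof -
  have eq: "(\<lambda>x. (if x = e' then 1 else 0) + (if x = e then 1 else 0)) =
      (\<lambda>x. (if x = e then 1 else 0) + (if x = e' then 1 else (0::int)))"
    by auto
  have "\<omega> powi (2 * bracket D e e') * \<omega> powi bracket D e' e = \<omega> powi bracket D e e'"
    using assms(4) bracket_skew[of D e' e] by (simp flip: power_int_add)
  then show ?thesis
    using form_single[OF assms(1-3), of 1 1] form_single[OF assms(1,3,2), of 1 1]
    by (simp add: gen_pow_def torus_mult_single torus_scale_single weyl_def eq)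
qed

lemma form_single_sum:
  assumes "finite (edges D)" "e \<in> edges D" "distinct es" "set es \<subseteq> edges D"
  shows "form D (\<lambda>x. if x = e then m else 0) (\<lambda>x. if x \<in> set es then k x else 0) =
    (\<Sum>j<length es. m * k (es ! j) * bracket D e (es ! j))"
proof -
  have "form D (\<lambda>x. if x = e then m else 0) (\<lambda>x. if x \<in> set es then k x else 0) =
      (\<Sum>x\<in>edges D. if x = e then (\<Sum>y\<in>edges D. if y \<in> set es then m * k y * bracket D e y else 0) else 0)"
    unfolding form_def by (intro sum.cong) (auto intro!: sum.cong)
  also have "\<dots> = (\<Sum>y\<in>edges D. if y \<in> set es then m * k y * bracket D e y else 0)"
    using assms by simp
  also have "\<dots> = (\<Sum>y\<in>set es. m * k y * bracket D e y)"
    using assms by (simp add: sum.If_cases Int_absorb1)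
  also have "\<dots> = (\<Sum>j<length es. m * k (es ! j) * bracket D e (es ! j))"
    using sum.reindex_bij_betw[OF bij_betw_nth[OF assms(3) refl refl],
        of "\<lambda>y. m * k y * bracket D e y"] by simp
  finally show ?thesis .
qed

lemma ordered_product:
  assumes "finite (edges D)" "distinct es" "set es \<subseteq> edges D" "\<omega> \<noteq> 0"
  shows "foldr (\<lambda>e. torus_mult \<omega> D (gen_pow e (k e))) es torus_one =
    torus_scale
      (\<omega> powi (\<Sum>i<length es. \<Sum>j\<in>{i<..<length es}.
          k (es ! i) * k (es ! j) * bracket D (es ! i) (es ! j)))
      (weyl (\<lambda>e. if e \<in> set es then k e else 0))"
  using assms(2,3)
proof (induction es)
  case Nil
  show ?case by (simp add: torus_one_def weyl_def torus_scale_single)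
next
  case (Cons a es)
  let ?S = "\<Sum>i<length es. \<Sum>j\<in>{i<..<length es}.
          k (es ! i) * k (es ! j) * bracket D (es ! i) (es ! j)"
  let ?T = "\<Sum>j<length es. k a * k (es ! j) * bracket D a (es ! j)"
  have shift: "{Suc i<..<Suc n} = Suc ` {i<..<n}" for i n :: nat
    by (auto simp: image_iff Suc_less_eq2 Bex_def)
  have shift0: "{0<..<Suc n} = Suc ` {..<n}" for n :: nat
    by (auto simp: image_iff) (metis Suc_less_eq gr0_implies_Suc lessThan_iff)
  have sum: "(\<Sum>i<length (a # es). \<Sum>j\<in>{i<..<length (a # es)}.
        k ((a # es) ! i) * k ((a # es) ! j) * bracket D ((a # es) ! i) ((a # es) ! j)) = ?T + ?S"
    by (simp add: sum.lessThan_Suc_shift shift shift0 sum.reindex del: sum.lessThan_Suc)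
  have f: "form D (\<lambda>x. if x = a then k a else 0) (\<lambda>x. if x \<in> set es then k x else 0) = ?T"
    using Cons.prems by (intro form_single_sum assms(1)) auto
  have fn: "(\<lambda>x. (if x = a then k a else 0) + (if x \<in> set es then k x else 0)) =
      (\<lambda>x. if x \<in> set (a # es) then k x else 0)"
    using Cons.prems by auto
  have IH: "foldr (\<lambda>e. torus_mult \<omega> D (gen_pow e (k e))) es torus_one =
      torus_scale (\<omega> powi ?S) (weyl (\<lambda>e. if e \<in> set es then k e else 0))"
    using Cons by simp
  have "foldr (\<lambda>e. torus_mult \<omega> D (gen_pow e (k e))) (a # es) torus_one =
      torus_scale (\<omega> powi (?T + ?S)) (weyl (\<lambda>x. if x \<in> set (a # es) then k x else 0))"
    unfolding foldr.simps o_apply IH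
    unfolding gen_pow_def weyl_def torus_scale_single torus_mult_single f fn
    using assms(4) by (simp add: power_int_add mult.commute)
  then show ?case
    by (simp only: sum)
qed

lemma weyl_ordering:
  assumes "finite (edges D)" "distinct es" "set es = edges D" "\<omega> \<noteq> 0" "\<forall>e. e \<notin> edges D \<longrightarrow> k e = 0"
  shows "weyl k = torus_scale
      (\<omega> powi (- (\<Sum>i<length es. \<Sum>j\<in>{i<..<length es}.
          k (es ! i) * k (es ! j) * bracket D (es ! i) (es ! j))))
      (foldr (\<lambda>e. torus_mult \<omega> D (gen_pow e (k e))) es torus_one)"
proof -
  have "(\<lambda>e. if e \<in> set es then k e else 0) = k"
    using assms by auto
  then show ?thesis
    using ordered_product[OF assms(1,2) _ assms(4), of k] assms(3,4)
    by (simp add: weyl_def torus_scale_single flip: power_int_add)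
qed

definition balanced :: "('f, 'e) pattern \<Rightarrow> ('e \<Rightarrow> int) set" where
  "balanced D = {k. (\<forall>e. e \<notin> edges D \<longrightarrow> k e = 0) \<and>
     (\<forall>T\<in>faces D. even (k (edge_at D (T, 0)) + k (edge_at D (T, 1)) + k (edge_at D (T, 2))))}"

inductive_set balanced_algebra :: "complex \<Rightarrow> ('f, 'e) pattern \<Rightarrow> 'e torus set"
  for \<omega> :: complex and D :: "('f, 'e) pattern" where
  monomial: "k \<in> balanced D \<Longrightarrow> weyl k \<in> balanced_algebra \<omega> D"
| one: "torus_one \<in> balanced_algebra \<omega> D"
| add: "x \<in> balanced_algebra \<omega> D \<Longrightarrow> y \<in> balanced_algebra \<omega> D \<Longrightarrow> x + y \<in> balanced_algebra \<omega> D"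
| scale: "x \<in> balanced_algebra \<omega> D \<Longrightarrow> torus_scale c x \<in> balanced_algebra \<omega> D"
| mult: "x \<in> balanced_algebra \<omega> D \<Longrightarrow> y \<in> balanced_algebra \<omega> D \<Longrightarrow>
    torus_mult \<omega> D x y \<in> balanced_algebra \<omega> D"


section \<open>Representations\<close>

text \<open>A complex vector space is a subspace \<open>V\<close> of a type carrying a scalar multiplication; an algebra
  element acts by a function of which only the restriction to \<open>V\<close> matters.\<close>

definition linear_on ::
    "(complex \<Rightarrow> 'v \<Rightarrow> 'v) \<Rightarrow> 'v set \<Rightarrow> (complex \<Rightarrow> 'w \<Rightarrow> 'w) \<Rightarrow>
     ('v::ab_group_add \<Rightarrow> 'w::ab_group_add) \<Rightarrow> bool" where
  "linear_on sv V sw f \<longleftrightarrow>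
     (\<forall>v\<in>V. \<forall>w\<in>V. f (v + w) = f v + f w) \<and> (\<forall>c. \<forall>v\<in>V. f (sv c v) = sw c (f v))"

definition representation ::
    "complex \<Rightarrow> ('f, 'e) pattern \<Rightarrow> (complex \<Rightarrow> 'v \<Rightarrow> 'v) \<Rightarrow> 'v set \<Rightarrow>
     ('e torus \<Rightarrow> 'v \<Rightarrow> 'v::ab_group_add) \<Rightarrow> bool" where
  "representation \<omega> D sv V r \<longleftrightarrow>
     module.subspace sv V \<and>
     (\<forall>x\<in>balanced_algebra \<omega> D. r x \<in> V \<rightarrow> V \<and> linear_on sv V sv (r x)) \<and>
     (\<forall>v\<in>V. r torus_one v = v) \<and>
     (\<forall>x\<in>balanced_algebra \<omega> D. \<forall>y\<in>balanced_algebra \<omega> D. \<forall>v\<in>V.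
        r (x + y) v = r x v + r y v \<and> r (torus_mult \<omega> D x y) v = r x (r y v)) \<and>
     (\<forall>c. \<forall>x\<in>balanced_algebra \<omega> D. \<forall>v\<in>V. r (torus_scale c x) v = sv c (r x v))"

definition submodule ::
    "complex \<Rightarrow> ('f, 'e) pattern \<Rightarrow> (complex \<Rightarrow> 'v \<Rightarrow> 'v) \<Rightarrow> 'v set \<Rightarrow>
     ('e torus \<Rightarrow> 'v \<Rightarrow> 'v::ab_group_add) \<Rightarrow> 'v set \<Rightarrow> bool" where
  "submodule \<omega> D sv V r U \<longleftrightarrow>
     U \<subseteq> V \<and> module.subspace sv U \<and> (\<forall>x\<in>balanced_algebra \<omega> D. r x \<in> U \<rightarrow> U)"

definition irreducible_rep ::
    "complex \<Rightarrow> ('f, 'e) pattern \<Rightarrow> (complex \<Rightarrow> 'v \<Rightarrow> 'v) \<Rightarrow> 'v set \<Rightarrow>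
     ('e torus \<Rightarrow> 'v \<Rightarrow> 'v::ab_group_add) \<Rightarrow> bool" where
  "irreducible_rep \<omega> D sv V r \<longleftrightarrow>
     representation \<omega> D sv V r \<and> V \<noteq> {0} \<and>
     (\<forall>U. submodule \<omega> D sv V r U \<longrightarrow> U = {0} \<or> U = V)"

definition simple_submodule ::
    "complex \<Rightarrow> ('f, 'e) pattern \<Rightarrow> (complex \<Rightarrow> 'v \<Rightarrow> 'v) \<Rightarrow> 'v set \<Rightarrow>
     ('e torus \<Rightarrow> 'v \<Rightarrow> 'v::ab_group_add) \<Rightarrow> 'v set \<Rightarrow> bool" where
  "simple_submodule \<omega> D sv V r S \<longleftrightarrow>
     submodule \<omega> D sv V r S \<and> irreducible_rep \<omega> D sv S r"

definition isomorphic_reps ::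
    "complex \<Rightarrow> ('f, 'e) pattern \<Rightarrow>
     (complex \<Rightarrow> 'v \<Rightarrow> 'v) \<Rightarrow> 'v set \<Rightarrow> ('e torus \<Rightarrow> 'v \<Rightarrow> 'v::ab_group_add) \<Rightarrow>
     (complex \<Rightarrow> 'w \<Rightarrow> 'w) \<Rightarrow> 'w set \<Rightarrow> ('e torus \<Rightarrow> 'w \<Rightarrow> 'w::ab_group_add) \<Rightarrow> bool" where
  "isomorphic_reps \<omega> D sv V r sw W R \<longleftrightarrow>
     (\<exists>\<phi>. linear_on sv V sw \<phi> \<and> bij_betw \<phi> V W \<and>
          (\<forall>x\<in>balanced_algebra \<omega> D. \<forall>v\<in>V. \<phi> (r x v) = R x (\<phi> v)))"

text \<open>\<open>B\<close> is a finite set of simple submodules of which \<open>V\<close> is the internal direct sum.\<close>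

definition simple_decomposition ::
    "complex \<Rightarrow> ('f, 'e) pattern \<Rightarrow> (complex \<Rightarrow> 'v \<Rightarrow> 'v) \<Rightarrow> 'v set \<Rightarrow>
     ('e torus \<Rightarrow> 'v \<Rightarrow> 'v::ab_group_add) \<Rightarrow> 'v set set \<Rightarrow> bool" where
  "simple_decomposition \<omega> D sv V r B \<longleftrightarrow>
     finite B \<and> (\<forall>S\<in>B. simple_submodule \<omega> D sv V r S) \<and>
     (\<forall>v\<in>V. \<exists>!f. f \<in> (\<Pi>\<^sub>E S\<in>B. S) \<and> v = (\<Sum>S\<in>B. f S))"

definition acts_by_scalar ::
    "(complex \<Rightarrow> 'v \<Rightarrow> 'v) \<Rightarrow> 'v set \<Rightarrow> ('e torus \<Rightarrow> 'v \<Rightarrow> 'v) \<Rightarrow> 'e torus \<Rightarrow> complex \<Rightarrow> bool" where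
  "acts_by_scalar sv V r x c \<longleftrightarrow> (\<forall>v\<in>V. r x v = sv c v)"


section \<open>Classical shadows and invariants\<close>

text \<open>The shadow is a function on \<open>K\<^sub>\<Delta>\<close>. Through the identification of \<open>K\<^sub>\<Delta>\<close> with the
  anti-invariant homology of the double covering, two shadows give the same point of the
  character variety exactly when they agree on \<open>K\<^sub>\<Delta>\<close>.\<close>

definition classical_shadow ::
    "('f, 'e) pattern \<Rightarrow> nat \<Rightarrow> (complex \<Rightarrow> 'v \<Rightarrow> 'v) \<Rightarrow> 'v set \<Rightarrow>
     ('e torus \<Rightarrow> 'v \<Rightarrow> 'v) \<Rightarrow> (('e \<Rightarrow> int) \<Rightarrow> complex) \<Rightarrow> bool" where
  "classical_shadow D N sv V r \<rho> \<longleftrightarrow>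
     (\<forall>k\<in>balanced D. acts_by_scalar sv V r (weyl (\<lambda>e. int N * k e)) (\<rho> k))"

text \<open>\<open>endpoint_element F q Q\<close> is \<open>H\<^sub>p\<close> for \<open>Q = {p}\<close> and \<open>H\<^sub>\<partial>\<close> for \<open>Q = \<partial>\<close>.\<close>

definition endpoint_element :: "'f set \<Rightarrow> ('f \<times> complex \<Rightarrow> 'a) \<Rightarrow> 'a set \<Rightarrow> 'a set torus" where
  "endpoint_element F q Q =
     weyl (\<lambda>e. if e \<in> edges (pattern_of F q) then int (endpoints_in F q Q e) else 0)"

definition central_element :: "('f, 'e) pattern \<Rightarrow> 'e torus" where
  "central_element D = weyl (\<lambda>e. if e \<in> edges D then 2 else 0)"

text \<open>The inner puncture and boundary invariants of the representation exist and have product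
  \<open>h\<close>.\<close>

definition invariants_product ::
    "'a topology \<Rightarrow> 'a set \<Rightarrow> 'f set \<Rightarrow> ('f \<times> complex \<Rightarrow> 'a) \<Rightarrow> (complex \<Rightarrow> 'v \<Rightarrow> 'v) \<Rightarrow> 'v set \<Rightarrow>
     ('a set torus \<Rightarrow> 'v \<Rightarrow> 'v) \<Rightarrow> complex \<Rightarrow> bool" where
  "invariants_product X P F q sv V r h \<longleftrightarrow>
     (\<exists>hp hb.
        (\<forall>p\<in>inner_punctures P F q. acts_by_scalar sv V r (endpoint_element F q {p}) (hp p)) \<and>
        (\<forall>d\<in>boundary_components X F q. acts_by_scalar sv V r (endpoint_element F q d) (hb d)) \<and>
        (\<Prod>d\<in>boundary_components X F q. hb d) * (\<Prod>p\<in>inner_punctures P F q. hp p) = h)"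


section \<open>Local representations\<close>

text \<open>A single triangle, and the disjoint union of all the faces: each side is an edge of its own.\<close>

definition triangle :: "'f \<Rightarrow> ('f, 'f \<times> nat) pattern" where
  "triangle T = \<lparr>faces = {T}, edge_at = (\<lambda>s. s)\<rparr>"

definition split_pattern :: "('f, 'e) pattern \<Rightarrow> ('f, 'f \<times> nat) pattern" where
  "split_pattern D = \<lparr>faces = faces D, edge_at = (\<lambda>s. s)\<rparr>"

text \<open>The tensor product of the algebras of the faces \<open>T\<close> is the balanced algebra of the
  disjoint union, the pure tensor of monomials \<open>[Z\<^sup>k\<^sup>T]\<close> being the monomial whose exponent
  restricts to \<open>k\<^sub>T\<close> on each \<open>T\<close>.\<close>

definition restrict_to_face :: "'f \<Rightarrow> ('f \<times> nat \<Rightarrow> int) \<Rightarrow> ('f \<times> nat \<Rightarrow> int)" where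
  "restrict_to_face T k = (\<lambda>s. if s \<in> edges (triangle T) then k s else 0)"

text \<open>The morphism \<open>i\<^sup>\<Delta>\<close>: the exponent of \<open>e\<close> is copied to all lifts of \<open>e\<close>.\<close>

definition lift_exponent :: "('f, 'e) pattern \<Rightarrow> ('e \<Rightarrow> int) \<Rightarrow> ('f \<times> nat \<Rightarrow> int)" where
  "lift_exponent D k = (\<lambda>s. if s \<in> sides (faces D) then k (edge_at D s) else 0)"

definition splitting :: "('f, 'e) pattern \<Rightarrow> 'e torus \<Rightarrow> ('f \<times> nat) torus" where
  "splitting D x =
     (\<Sum>k\<in>Poly_Mapping.keys x.
        Poly_Mapping.single (lift_exponent D k) (Poly_Mapping.lookup x k))"

text \<open>\<open>V\<close> is the tensor product of the vector spaces \<open>W T\<close>, with pure tensors \<open>\<tau> w\<close>.\<close>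

definition tensor_product ::
    "'f set \<Rightarrow> (complex \<Rightarrow> 'v \<Rightarrow> 'v) \<Rightarrow> ('f \<Rightarrow> 'v::ab_group_add set) \<Rightarrow>
     (complex \<Rightarrow> 'w \<Rightarrow> 'w) \<Rightarrow> 'w::ab_group_add set \<Rightarrow> (('f \<Rightarrow> 'v) \<Rightarrow> 'w) \<Rightarrow> bool" where
  "tensor_product F sv W sw V \<tau> \<longleftrightarrow>
     \<tau> \<in> (\<Pi>\<^sub>E T\<in>F. W T) \<rightarrow> V \<and>
     (\<forall>w\<in>(\<Pi>\<^sub>E T\<in>F. W T). \<forall>T\<in>F. linear_on sv (W T) sw (\<lambda>u. \<tau> (w(T := u)))) \<and>
     (\<forall>B. (\<forall>T\<in>F. \<not> module.dependent sv (B T) \<and> module.span sv (B T) = W T) \<longrightarrow>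
        inj_on \<tau> (\<Pi>\<^sub>E T\<in>F. B T) \<and>
        \<not> module.dependent sw (\<tau> ` (\<Pi>\<^sub>E T\<in>F. B T)) \<and>
        module.span sw (\<tau> ` (\<Pi>\<^sub>E T\<in>F. B T)) = V)"

text \<open>\<open>R'\<close> is the tensor product of the representations \<open>r T\<close>.\<close>

definition tensor_representation ::
    "complex \<Rightarrow> ('f, 'e) pattern \<Rightarrow> ('f \<Rightarrow> 'v set) \<Rightarrow> ('f \<Rightarrow> ('f \<times> nat) torus \<Rightarrow> 'v \<Rightarrow> 'v) \<Rightarrow>
     (('f \<Rightarrow> 'v) \<Rightarrow> 'w) \<Rightarrow> (complex \<Rightarrow> 'w \<Rightarrow> 'w) \<Rightarrow> 'w::ab_group_add set \<Rightarrow>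
     (('f \<times> nat) torus \<Rightarrow> 'w \<Rightarrow> 'w) \<Rightarrow> bool" where
  "tensor_representation \<omega> D W r \<tau> sw V R' \<longleftrightarrow>
     representation \<omega> (split_pattern D) sw V R' \<and>
     (\<forall>k\<in>balanced (split_pattern D). \<forall>w\<in>(\<Pi>\<^sub>E T\<in>faces D. W T).
        R' (weyl k) (\<tau> w) = \<tau> (\<lambda>T\<in>faces D. r T (weyl (restrict_to_face T k)) (w T)))"

definition local_representation ::
    "complex \<Rightarrow> ('f, 'e) pattern \<Rightarrow> (complex \<Rightarrow> 'v \<Rightarrow> 'v) \<Rightarrow> ('f \<Rightarrow> 'v::ab_group_add set) \<Rightarrow>
     ('f \<Rightarrow> ('f \<times> nat) torus \<Rightarrow> 'v \<Rightarrow> 'v) \<Rightarrow> (('f \<Rightarrow> 'v) \<Rightarrow> 'w) \<Rightarrow>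
     (complex \<Rightarrow> 'w \<Rightarrow> 'w) \<Rightarrow> 'w::ab_group_add set \<Rightarrow> ('e torus \<Rightarrow> 'w \<Rightarrow> 'w) \<Rightarrow> bool" where
  "local_representation \<omega> D sv W r \<tau> sw V R \<longleftrightarrow>
     (\<forall>T\<in>faces D. irreducible_rep \<omega> (triangle T) sv (W T) (r T)) \<and>
     tensor_product (faces D) sv W sw V \<tau> \<and>
     (\<exists>R'. tensor_representation \<omega> D W r \<tau> sw V R' \<and>
        (\<forall>x\<in>balanced_algebra \<omega> D. \<forall>v\<in>V. R x v = R' (splitting D x) v))"

definition root_of_unity_of_order :: "nat \<Rightarrow> complex \<Rightarrow> bool" where
  "root_of_unity_of_order N \<omega> \<longleftrightarrow> 0 < N \<and> \<omega> ^ N = 1 \<and> (\<forall>m. 0 < m \<and> m < N \<longrightarrow> \<omega> ^ m \<noteq> 1)"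

end

theory Submission
  imports Defs "HOL-Library.Function_Algebras" "HOL-Library.Countable_Set"
    "HOL-Computational_Algebra.Fundamental_Theorem_Algebra" "HOL-Combinatorics.Orbits"
begin

text \<open>
  Let \<open>E\<close> and \<open>F\<close> be the numbers of edges and faces. As \<open>N\<close> is odd, \<open>K\<^sub>\<Delta>\<close> modulo \<open>N\<close> is
  \<open>(\<int>/N)\<^sup>E\<close>. On the set of all sides of all faces consider the map that applies first the gluing
  involution and then the rotation to the next side of the same face. Its orbits correspond to the
  inner punctures and the boundary components, also at unglued sides, and solving linear equations
  face by face, where only 2 is inverted, shows that the radical of the form modulo \<open>N\<close> is free over
  \<open>\<int>/N\<close>, the exponents of the elements \<open>H\<^sub>p\<close> and \<open>H\<^sub>\<partial>\<close> being a basis. Let \<open>n\<close> be their number.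

  Decomposing linear maps between modules according to the characters of \<open>(\<int>/N)\<^sup>E\<close> produces
  nonzero intertwiners between modules on which the radical acts by the same scalars, so irreducible
  representations are classified by these scalars; Schur's lemma in countable dimension and a trace
  computation give \<open>d\<^sup>2 = N\<^bsup>E - n\<^esup>\<close> for their dimension \<open>d\<close>. Applied to a single triangle this yields
  \<open>d = N\<close>, so the local representation has dimension \<open>N\<^bsup>F\<^esup>\<close>. It is the direct sum of the joint
  eigenspaces of the \<open>H\<^sub>p\<close> and \<open>H\<^sub>\<partial>\<close>. The product of the eigenvalues is \<open>h\<^sub>C\<close>, which leaves
  \<open>N\<^bsup>n - 1\<^esup>\<close> tuples, and since the surface is connected the invertible elements of the algebra of the
  split surface permute the corresponding eigenspaces transitively: all of them are nonzero of
  dimension \<open>m d = N\<^bsup>F + 1 - n\<^esup>\<close>. Comparison with the Euler characteristic gives \<open>m = N\<^bsup>g\<^esup>\<close>. That \<open>E - n\<close>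
  is even, as needed for \<open>g\<close> to be defined, follows from the signs of the permutations above.
\<close>


section \<open>Linear maps on subspaces\<close>

text \<open>The irreducible representations to be compared with the summands live on arbitrary
  vector spaces, so their finite dimension must come out of the argument: a simple module is cyclic
  over a countable group of monomials, while the complex numbers are uncountable. On the Weyl basis
  a representation becomes a projective representation of the group of balanced exponents.
  Conjugating linear maps cancels its cocycle, so between modules with equal shadows the linear maps
  form an ordinary representation of a finite abelian group; averaging over it gives the
  intertwiners, complete reducibility and the orthogonality behind the trace computation.

  The permutation of eigenspaces rests on monomials of the split algebra supported on one side: they
  shift the eigenvalues at the two ends of the side in opposite directions, which keeps the product.
  The genus is specified by an equation that need not have a natural solution a priori; that the
  solution is nonnegative is read off from the multiplicity being at least 1, without any
  classification of surfaces.\<close>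

lemma linear_on_add: "linear_on sv V sw f \<Longrightarrow> v \<in> V \<Longrightarrow> w \<in> V \<Longrightarrow> f (v + w) = f v + f w"
  by (simp add: linear_on_def)

lemma linear_on_scale: "linear_on sv V sw f \<Longrightarrow> v \<in> V \<Longrightarrow> f (sv c v) = sw c (f v)"
  by (simp add: linear_on_def)

lemma linear_on_subset: "linear_on sv V sw f \<Longrightarrow> U \<subseteq> V \<Longrightarrow> linear_on sv U sw f"
  by (simp add: linear_on_def subset_iff)

lemma linear_on_compose:
  "linear_on sv V sw f \<Longrightarrow> linear_on sw W su g \<Longrightarrow> f \<in> V \<rightarrow> W \<Longrightarrow> linear_on sv V su (\<lambda>v. g (f v))"
  by (auto simp: linear_on_def Pi_iff)

text \<open>Operators are meaningful only on a subspace and arbitrary elsewhere, so the facts on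
  sums, kernels and images carry membership conditions.\<close>

locale linear_map_on = S: vector_space sv + T: vector_space sw
  for sv :: "complex \<Rightarrow> 'v::ab_group_add \<Rightarrow> 'v" and sw :: "complex \<Rightarrow> 'w::ab_group_add \<Rightarrow> 'w" +
  fixes V f
  assumes subspace: "S.subspace V" and linear: "linear_on sv V sw f"
begin

lemma map_0: "f 0 = 0"
  using linear_on_scale[OF linear, of 0 0] S.subspace_0[OF subspace] by simp

lemma map_sum: "(\<And>i. i \<in> I \<Longrightarrow> g i \<in> V) \<Longrightarrow> f (\<Sum>i\<in>I. g i) = (\<Sum>i\<in>I. f (g i))"
proof (induction I rule: infinite_finite_induct)
  case (insert i I)
  then show ?case
    using linear_on_add[OF linear] S.subspace_sum[OF subspace, of I g] by simp
qed (simp_all add: map_0)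

lemma map_minus: "v \<in> V \<Longrightarrow> f (- v) = - f v"
  using linear_on_scale[OF linear, of v "-1"] by simp

lemma map_diff: "v \<in> V \<Longrightarrow> w \<in> V \<Longrightarrow> f (v - w) = f v - f w"
  using linear_on_add[OF linear, of v "- w"] map_minus S.subspace_neg[OF subspace] by simp

lemma inj_onI0:
  assumes "\<And>v. v \<in> V \<Longrightarrow> f v = 0 \<Longrightarrow> v = 0"
  shows "inj_on f V"
proof (rule inj_onI)
  fix x y assume "x \<in> V" "y \<in> V" "f x = f y"
  then have "x - y = 0"
    by (intro assms) (simp_all add: map_diff S.subspace_diff[OF subspace])
  then show "x = y" by simp
qed

lemma subspace_image_on: 
  assumes "S.subspace U" "U \<subseteq> V"
  shows "T.subspace (f ` U)"
proof (rule T.subspaceI)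
  show "0 \<in> f ` U" using map_0 S.subspace_0[OF assms(1)] by force
next
  fix x y assume "x \<in> f ` U" "y \<in> f ` U"
  then obtain a b where *: "a \<in> U" "b \<in> U" "x = f a" "y = f b" by auto
  then have "x + y = f (a + b)" using linear_on_add[OF linear, of a b] assms by (auto simp: subset_iff)
  then show "x + y \<in> f ` U" using * S.subspace_add[OF assms(1)] by auto
next
  fix c x assume "x \<in> f ` U"
  then obtain a where *: "a \<in> U" "x = f a" by auto
  then have "sw c x = f (sv c a)" using linear_on_scale[OF linear, of a c] assms by auto
  then show "sw c x \<in> f ` U" using * S.subspace_scale[OF assms(1)] by auto
qed

lemma subspace_kernel_on: "S.subspace {v\<in>V. f v = 0}"
  using map_0 linear_on_add[OF linear] linear_on_scale[OF linear]
    S.subspace_0[OF subspace] S.subspace_add[OF subspace] S.subspace_scale[OF subspace]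
  by (intro S.subspaceI) auto

end

section \<open>Twisted modules over a lattice with an alternating form\<close>

lemma root_of_unity_powi_eq_1_iff:
  assumes "root_of_unity_of_order N \<omega>"
  shows "\<omega> powi j = 1 \<longleftrightarrow> int N dvd j"
proof -
  have N: "N > 0" "\<omega> ^ N = 1" and min: "\<And>m. 0 < m \<Longrightarrow> m < N \<Longrightarrow> \<omega> ^ m \<noteq> 1"
    using assms by (auto simp: root_of_unity_of_order_def)
  have nz: "\<omega> \<noteq> 0" using N by (auto simp: power_0_left split: if_splits)
  let ?m = "nat (j mod int N)"
  have m: "j mod int N = int ?m" "?m < N" using N by (simp_all add: nat_less_iff)
  have "\<omega> powi (int N * (j div int N)) = 1"
    using N by (simp add: power_int_mult)
  then have "\<omega> powi j = \<omega> powi (j mod int N)"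
    using nz power_int_add[of \<omega> "int N * (j div int N)" "j mod int N"] by simp
  also have "\<dots> = \<omega> ^ ?m"
    using m(1) by (metis power_int_of_nat)
  finally have "\<omega> powi j = \<omega> ^ ?m" .
  moreover have "\<omega> ^ ?m = 1 \<longleftrightarrow> ?m = 0"
    using min[of ?m] m(2) by (cases "?m = 0") auto
  ultimately show ?thesis
    using m(1) by (metis dvd_eq_mod_eq_0 of_nat_0 of_nat_eq_iff)
qed

text \<open>\<open>K\<close>, \<open>B\<close> and \<open>M\<close> stand for the balanced
  exponents, the exchange form and the balanced exponents divisible by \<open>N\<close>;
  \<open>R\<close> represents \<open>K\<close> modulo \<open>M\<close>, so that averages over the
  finite quotient become sums over \<open>R\<close>. The abstraction serves the glued surface, the
  split surface and a single triangle alike.\<close>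

locale alternating_lattice =
  fixes K :: "'k::ab_group_add set" and B :: "'k \<Rightarrow> 'k \<Rightarrow> int" and N :: nat and \<omega> :: complex
    and M R :: "'k set"
  assumes countable_K: "countable K"
    and K_0: "0 \<in> K" and K_add: "k \<in> K \<Longrightarrow> l \<in> K \<Longrightarrow> k + l \<in> K" and K_minus: "k \<in> K \<Longrightarrow> - k \<in> K"
    and B_add: "k \<in> K \<Longrightarrow> l \<in> K \<Longrightarrow> m \<in> K \<Longrightarrow> B (k + l) m = B k m + B l m"
    and B_skew: "k \<in> K \<Longrightarrow> l \<in> K \<Longrightarrow> B k l = - B l k"
    and odd_N: "odd N" and root: "root_of_unity_of_order N \<omega>"
    and M_K: "M \<subseteq> K" and M_0: "0 \<in> M"
    and M_add: "k \<in> M \<Longrightarrow> l \<in> M \<Longrightarrow> k + l \<in> M" and M_minus: "k \<in> M \<Longrightarrow> - k \<in> M"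
    and M_radical: "m \<in> M \<Longrightarrow> k \<in> K \<Longrightarrow> int N dvd B m k"
    and R: "finite R" "R \<subseteq> K" "k \<in> K \<Longrightarrow> \<exists>!r. r \<in> R \<and> k - r \<in> M"
begin

definition radical :: "'k set" where
  "radical = {k\<in>K. \<forall>l\<in>K. int N dvd B k l}"

lemma radical_K: "k \<in> radical \<Longrightarrow> k \<in> K"
  by (simp add: radical_def)

lemma M_subset_radical: "M \<subseteq> radical"
  using M_K M_radical by (auto simp: radical_def)

lemma omega_nz: "\<omega> \<noteq> 0"
  using root by (auto simp: root_of_unity_of_order_def power_0_left split: if_splits)

lemma K_diff: "k \<in> K \<Longrightarrow> l \<in> K \<Longrightarrow> k - l \<in> K"
  using K_add[of k "- l"] K_minus by simp

lemma B_self: "k \<in> K \<Longrightarrow> B k k = 0"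
  using B_skew[of k k] by simp

lemma B_add_right: "k \<in> K \<Longrightarrow> l \<in> K \<Longrightarrow> m \<in> K \<Longrightarrow> B k (l + m) = B k l + B k m"
  using B_add[of l m k] B_skew[of k] K_add by simp

lemma B_0: "k \<in> K \<Longrightarrow> B 0 k = 0"
  using B_add[of 0 0 k] K_0 by simp

lemma B_minus: "k \<in> K \<Longrightarrow> l \<in> K \<Longrightarrow> B (- k) l = - B k l"
  using B_add[of k "- k" l] K_minus B_0 by simp

lemma B_minus_right: "k \<in> K \<Longrightarrow> l \<in> K \<Longrightarrow> B k (- l) = - B k l"
  using B_skew[of k] B_minus K_minus by simp

lemma powi_add: "\<omega> powi (a + b) = \<omega> powi a * \<omega> powi b"
  using omega_nz by (simp add: power_int_add)

text \<open>Commutators of monomials are powers of \<omega> to twice the form; since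
  \<open>N\<close> is odd they still detect the form modulo \<open>N\<close>.\<close>

lemma powi_eq_1_iff: "\<omega> powi (2 * j) = 1 \<longleftrightarrow> int N dvd j"
  using root_of_unity_powi_eq_1_iff[OF root] odd_N
  by (simp add: coprime_dvd_mult_right_iff)

lemma radical_pairing: "k \<in> radical \<Longrightarrow> l \<in> K \<Longrightarrow> \<omega> powi (2 * B k l) = 1"
  by (simp add: powi_eq_1_iff radical_def)

lemma radical_minus: "k \<in> radical \<Longrightarrow> - k \<in> radical"
  by (auto simp: radical_def B_minus K_minus)

text \<open>A sum over \<open>R\<close> of a function that is periodic modulo \<open>M\<close> is a sum over \<open>K / M\<close>.\<close>

lemma sum_transversal_shift:
  fixes \<Psi> :: "'k \<Rightarrow> 'b::comm_monoid_add"
  assumes per: "\<And>k m. k \<in> K \<Longrightarrow> m \<in> M \<Longrightarrow> \<Psi> (k + m) = \<Psi> k" and "l \<in> K"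
  shows "(\<Sum>r\<in>R. \<Psi> (r + l)) = (\<Sum>r\<in>R. \<Psi> r)"
proof -
  define rep where "rep k = (THE r. r \<in> R \<and> k - r \<in> M)" for k
  have rep: "rep k \<in> R" "k - rep k \<in> M" if "k \<in> K" for k
    using theI'[OF R(3)[OF that]] by (simp_all add: rep_def)
  have rep_eq: "rep k = r" if "k \<in> K" "r \<in> R" "k - r \<in> M" for k r
    using R(3)[OF that(1)] rep[OF that(1)] that by blast
  have rK: "r \<in> K" if "r \<in> R" for r using R that by auto
  have inverse: "rep (rep (r + l) + l') = r" if "r \<in> R" "l \<in> K" "l' = - l" for r l l'
  proof (rule rep_eq)
    have "r + l \<in> K" using that R(2) K_add by auto
    then have "rep (r + l) \<in> K" using rep(1) R(2) by blast
    then show "rep (r + l) + l' \<in> K" using that K_diff by simp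
    show "r \<in> R" by fact
    have "- (r + l - rep (r + l)) \<in> M"
      using M_minus[OF rep(2)[OF \<open>r + l \<in> K\<close>]] .
    then show "rep (r + l) + l' - r \<in> M"
      using that by (simp add: algebra_simps)
  qed
  show ?thesis
  \<comment> \<open>Translation by \<open>l\<close> followed by reduction to \<open>R\<close>
    permutes \<open>R\<close>; translation by \<open>- l\<close> is its inverse.\<close>
  proof (rule sum.reindex_bij_witness[where j = "\<lambda>r. rep (r + l)" and i = "\<lambda>r. rep (r + (- l))"])
    fix r assume r: "r \<in> R"
    show "rep (rep (r + l) + - l) = r" "rep (rep (r + - l) + l) = r"
      using inverse[OF r, of l "- l"] inverse[OF r, of "- l" l] assms(2) K_minus by simp_all
    show "rep (r + l) \<in> R" "rep (r + - l) \<in> R"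
      using rep(1) K_add[OF rK[OF r] assms(2)] K_diff[OF rK[OF r] assms(2)] by simp_all
    have "\<Psi> (rep (r + l) + (r + l - rep (r + l))) = \<Psi> (rep (r + l))"
      using r assms(2) rep rK K_add by (intro per) auto
    then show "\<Psi> (rep (r + l)) = \<Psi> (r + l)" by simp
  qed
qed

text \<open>Orthogonality of characters: outside of the radical the summand is a nontrivial
  character of \<open>K\<close> modulo \<open>M\<close>, and translating the sum by an
  \<open>l\<close> of value other than 1 multiplies it by that value without changing it.\<close>

lemma sum_pairing:
  assumes "k \<in> K"
  shows "(\<Sum>r\<in>R. \<omega> powi (2 * B k r)) = (if k \<in> radical then of_nat (card R) else 0)"
proof (cases "k \<in> radical")
  case True
  then have "(\<Sum>r\<in>R. \<omega> powi (2 * B k r)) = (\<Sum>r\<in>R. 1)"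
    using R radical_pairing by (intro sum.cong) auto
  then show ?thesis using True by simp
next
  case False
  then obtain l where l: "l \<in> K" "\<not> int N dvd B k l"
    using assms by (auto simp: radical_def)
  let ?f = "\<lambda>r. \<omega> powi (2 * B k r)"
  have "(\<Sum>r\<in>R. ?f (r + l)) = (\<Sum>r\<in>R. ?f r)"
  proof (rule sum_transversal_shift[OF _ l(1)])
    fix k' m assume "k' \<in> K" "m \<in> M"
    then have "\<omega> powi (2 * B k m) = 1"
      using M_radical[of m k] assms M_K B_skew[of k m] by (auto simp: powi_eq_1_iff)
    then show "?f (k' + m) = ?f k'"
      using \<open>k' \<in> K\<close> \<open>m \<in> M\<close> M_K assms by (auto simp: B_add_right powi_add distrib_left)
  qed
  moreover have "(\<Sum>r\<in>R. ?f (r + l)) = ?f l * (\<Sum>r\<in>R. ?f r)"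
    unfolding sum_distrib_left using R assms l
    by (intro sum.cong) (auto simp: B_add_right powi_add distrib_left)
  moreover have "?f l \<noteq> 1" using l powi_eq_1_iff by simp
  ultimately show ?thesis using False by simp
qed

end

text \<open>A projective representation of the group \<open>K\<close> with cocycle
  \<open>\<omega> powi B k l\<close>: the shape that a representation of the balanced algebra takes
  on the Weyl basis.\<close>

locale twisted_module = alternating_lattice K B N \<omega> M R + vector_space sv
  for K :: "'k::ab_group_add set" and B N \<omega> M R
    and sv :: "complex \<Rightarrow> 'v::ab_group_add \<Rightarrow> 'v" +
  fixes V :: "'v set" and T :: "'k \<Rightarrow> 'v \<Rightarrow> 'v"
  assumes V: "subspace V"
    and T_V: "k \<in> K \<Longrightarrow> v \<in> V \<Longrightarrow> T k v \<in> V"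
    and T_linear: "k \<in> K \<Longrightarrow> linear_on sv V sv (T k)"
    and T_0: "v \<in> V \<Longrightarrow> T 0 v = v"
    and T_T: "k \<in> K \<Longrightarrow> l \<in> K \<Longrightarrow> v \<in> V \<Longrightarrow> T k (T l v) = sv (\<omega> powi B k l) (T (k + l) v)"
begin

lemma linear_map_T: "k \<in> K \<Longrightarrow> linear_map_on sv sv V (T k)"
  by (intro linear_map_on.intro linear_map_on_axioms.intro vector_space_axioms V T_linear)

lemma T_add: "k \<in> K \<Longrightarrow> v \<in> V \<Longrightarrow> w \<in> V \<Longrightarrow> T k (v + w) = T k v + T k w"
  using T_linear linear_on_add by blast

lemma T_scale: "k \<in> K \<Longrightarrow> v \<in> V \<Longrightarrow> T k (sv c v) = sv c (T k v)"
  using T_linear linear_on_scale by blast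

lemma T_sum: "k \<in> K \<Longrightarrow> (\<And>i. i \<in> I \<Longrightarrow> f i \<in> V) \<Longrightarrow> T k (\<Sum>i\<in>I. f i) = (\<Sum>i\<in>I. T k (f i))"
  using linear_map_on.map_sum[OF linear_map_T] by blast

lemma T_zero: "k \<in> K \<Longrightarrow> T k 0 = 0"
  using linear_map_on.map_0[OF linear_map_T] by blast

lemma T_inv: "k \<in> K \<Longrightarrow> v \<in> V \<Longrightarrow> T k (T (- k) v) = v"
  and T_inv': "k \<in> K \<Longrightarrow> v \<in> V \<Longrightarrow> T (- k) (T k v) = v"
  by (simp_all add: T_T K_minus B_minus B_minus_right B_self T_0)

lemma T_comm:
  assumes "k \<in> K" "l \<in> K" "v \<in> V"
  shows "T k (T l v) = sv (\<omega> powi (2 * B k l)) (T l (T k v))"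
proof -
  have "\<omega> powi (2 * B k l) * \<omega> powi B l k = \<omega> powi B k l"
    using B_skew[of k l] assms by (simp flip: powi_add)
  then show ?thesis
    using assms by (simp add: T_T add.commute[of l k])
qed

lemma T_radical_comm:
  assumes "c \<in> radical" "l \<in> K" "v \<in> V"
  shows "T c (T l v) = T l (T c v)"
  using T_comm[of c l v] assms radical_K radical_pairing by simp

definition invariant :: "'v set \<Rightarrow> bool" where
  "invariant U \<longleftrightarrow> subspace U \<and> U \<subseteq> V \<and> (\<forall>k\<in>K. \<forall>u\<in>U. T k u \<in> U)"

definition simple :: "'v set \<Rightarrow> bool" where
  "simple U \<longleftrightarrow> invariant U \<and> U \<noteq> {0} \<and> (\<forall>U'. invariant U' \<and> U' \<subseteq> U \<longrightarrow> U' = {0} \<or> U' = U)"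

lemma invariant_V: "invariant V"
  using V T_V by (simp add: invariant_def)

lemma invariant_module: "invariant U \<Longrightarrow> twisted_module K B N \<omega> M R sv U T"
  using T_0 T_T linear_on_subset[OF T_linear]
  by unfold_locales (auto simp: invariant_def subset_iff)

lemma invariant_invariant:
  assumes "invariant U"
  shows "twisted_module.invariant K sv U T U' \<longleftrightarrow> invariant U' \<and> U' \<subseteq> U"
  using assms unfolding twisted_module.invariant_def[OF invariant_module[OF assms]] invariant_def
  by auto

lemma simple_simple:
  assumes "invariant U" "U' \<subseteq> U"
  shows "twisted_module.simple K sv U T U' \<longleftrightarrow> simple U'"
  unfolding twisted_module.simple_def[OF invariant_module[OF assms(1)]] simple_def
    invariant_invariant[OF assms(1)] using assms by blast

lemma cyclic_invariant: 
  assumes "v \<in> V"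
  shows "invariant (span ((\<lambda>k. T k v) ` K))"
  unfolding invariant_def
proof (intro conjI ballI subspace_span)
  let ?G = "(\<lambda>k. T k v) ` K"
  show sub: "span ?G \<subseteq> V"
    using assms T_V V by (intro span_minimal) auto
  fix k u assume k: "k \<in> K" and u: "u \<in> span ?G"
  have "T k (T l v) \<in> span ?G" if "l \<in> K" for l
    unfolding T_T[OF k that assms] using K_add[OF k that]
    by (intro span_scale span_base) auto
  moreover have "subspace {u \<in> V. T k u \<in> span ?G}"
    using V k by (auto simp: subspace_def T_zero T_add T_scale intro: span_zero span_add span_scale)
  ultimately have "span ?G \<subseteq> {u \<in> V. T k u \<in> span ?G}"
    using assms T_V by (intro span_minimal) auto
  then show "T k u \<in> span ?G" using u by auto
qed

text \<open>As \<open>K\<close> is countable this yields a countable spanning set, the size bound on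
  which Schur's lemma relies.\<close>

lemma simple_cyclic:
  assumes "simple V" "v \<in> V" "v \<noteq> 0"
  shows "span ((\<lambda>k. T k v) ` K) = V"
proof -
  let ?U = "span ((\<lambda>k. T k v) ` K)"
  have "v \<in> ?U" using K_0 T_0[OF assms(2)] by (force intro: span_base)
  then show ?thesis
    using assms cyclic_invariant[OF assms(2)] unfolding simple_def invariant_def by blast
qed

end

section \<open>Conjugation of linear maps, Fourier parts and intertwiners\<close>

locale twisted_module_pair =
  D: twisted_module K B N \<omega> M R sv V T + C: twisted_module K B N \<omega> M R sw W S
  for K :: "'k::ab_group_add set" and B N \<omega> M R
    and sv :: "complex \<Rightarrow> 'v::ab_group_add \<Rightarrow> 'v" and V T
    and sw :: "complex \<Rightarrow> 'w::ab_group_add \<Rightarrow> 'w" and W S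
begin

definition intertwiner :: "('v \<Rightarrow> 'w) \<Rightarrow> bool" where
  "intertwiner f \<longleftrightarrow> f \<in> V \<rightarrow> W \<and> linear_on sv V sw f \<and> (\<forall>k\<in>K. \<forall>v\<in>V. f (T k v) = S k (f v))"

definition same_scalars :: "'k set \<Rightarrow> bool" where
  "same_scalars A \<longleftrightarrow> (\<forall>c\<in>A. \<exists>z. (\<forall>v\<in>V. T c v = sv z v) \<and> (\<forall>w\<in>W. S c w = sw z w))"

lemma intertwinerD:
  assumes "intertwiner f"
  shows "linear_map_on sv sw V f" "\<And>v. v \<in> V \<Longrightarrow> f v \<in> W"
    "\<And>k v. k \<in> K \<Longrightarrow> v \<in> V \<Longrightarrow> f (T k v) = S k (f v)"
  using assms D.V D.vector_space_axioms C.vector_space_axioms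
  unfolding intertwiner_def linear_map_on_def linear_map_on_axioms_def by auto

lemma kernel_invariant:
  assumes "intertwiner f"
  shows "D.invariant {v\<in>V. f v = 0}"
  using linear_map_on.subspace_kernel_on[OF intertwinerD(1)[OF assms]] intertwinerD(3)[OF assms]
    C.T_zero D.T_V by (auto simp: D.invariant_def)

lemma image_invariant:
  assumes "intertwiner f" "D.invariant U"
  shows "C.invariant (f ` U)"
proof -
  have U: "D.subspace U" "U \<subseteq> V" "\<And>k u. k \<in> K \<Longrightarrow> u \<in> U \<Longrightarrow> T k u \<in> U"
    using assms(2) by (auto simp: D.invariant_def)
  have "S k (f u) \<in> f ` U" if "k \<in> K" "u \<in> U" for k u
  proof -
    have "S k (f u) = f (T k u)" using intertwinerD(3)[OF assms(1)] that U by auto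
    then show ?thesis using U that by auto
  qed
  moreover have "C.subspace (f ` U)"
    by (rule linear_map_on.subspace_image_on[OF intertwinerD(1)[OF assms(1)] U(1,2)])
  ultimately show ?thesis
    using intertwinerD(2)[OF assms(1)] U by (auto simp: C.invariant_def)
qed

lemma simple_intertwiner_inj:
  assumes "intertwiner f" "D.simple V" "v \<in> V" "f v \<noteq> 0"
  shows "inj_on f V"
proof (rule linear_map_on.inj_onI0[OF intertwinerD(1)[OF assms(1)]])
  fix u assume u: "u \<in> V" "f u = 0"
  have "D.invariant {v\<in>V. f v = 0}" by (rule kernel_invariant[OF assms(1)])
  then have "{v\<in>V. f v = 0} = {0} \<or> {v\<in>V. f v = 0} = V"
    using assms(2) unfolding D.simple_def by blast
  then show "u = 0" using assms(3,4) u by auto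
qed

lemma simple_image:
  assumes f: "intertwiner f" and simple: "D.simple V" and v: "v \<in> V" "f v \<noteq> 0"
  shows "C.simple (f ` V)"
  unfolding C.simple_def
proof (intro conjI allI impI)
  show "C.invariant (f ` V)" by (rule image_invariant[OF f D.invariant_V])
  show "f ` V \<noteq> {0}" using v by auto
  fix U' assume U': "C.invariant U' \<and> U' \<subseteq> f ` V"
  let ?U = "{v\<in>V. f v \<in> U'}"
  note lin = linear_map_on.linear[OF intertwinerD(1)[OF f]]
  have U's: "C.subspace U'" "\<And>k u. k \<in> K \<Longrightarrow> u \<in> U' \<Longrightarrow> S k u \<in> U'"
    using U' by (auto simp: C.invariant_def)
  have "D.subspace ?U"
    using D.V U's(1) linear_on_add[OF lin] linear_on_scale[OF lin]
      linear_map_on.map_0[OF intertwinerD(1)[OF f]]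
    by (auto simp: D.subspace_def C.subspace_def)
  then have "D.invariant ?U"
    using intertwinerD(3)[OF f] U's D.T_V by (auto simp: D.invariant_def)
  then have "?U = {0} \<or> ?U = V" using simple unfolding D.simple_def by blast
  moreover have "U' = f ` ?U" using U' by auto
  ultimately show "U' = {0} \<or> U' = f ` V"
    using linear_map_on.map_0[OF intertwinerD(1)[OF f]] by fastforce
qed

text \<open>The cocycles of \<open>S\<close> and \<open>T\<close> cancel here, so this is an honest
  action of the abelian group \<open>K\<close> on linear maps (\<open>conj_add\<close>). Its fixed
  maps are the intertwiners.\<close>

definition twisted_conj :: "'k \<Rightarrow> ('v \<Rightarrow> 'w) \<Rightarrow> 'v \<Rightarrow> 'w" where
  "twisted_conj k f v = S k (f (T (- k) v))"

context
  fixes f :: "'v \<Rightarrow> 'w"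
  assumes f_W: "f \<in> V \<rightarrow> W" and f_linear: "linear_on sv V sw f"
begin

lemma conj_W: "k \<in> K \<Longrightarrow> v \<in> V \<Longrightarrow> twisted_conj k f v \<in> W"
  unfolding twisted_conj_def using f_W by (intro C.T_V funcset_mem[OF f_W] D.T_V D.K_minus)

lemma conj_add:
  assumes "k \<in> K" "l \<in> K" "v \<in> V"
  shows "twisted_conj (k + l) f v = S k (twisted_conj l f (T (- k) v))"
proof -
  have v: "T (- (k + l)) v \<in> V" using assms D.T_V D.K_add D.K_minus by blast
  have "S k (twisted_conj l f (T (- k) v)) = sw (\<omega> powi B k l) (S (k + l) (f (T (- l) (T (- k) v))))"
    unfolding twisted_conj_def using assms f_W D.T_V D.K_minus by (intro C.T_T) auto
  also have "T (- l) (T (- k) v) = sv (\<omega> powi B l k) (T (- (k + l)) v)"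
    using assms by (simp add: D.T_T D.K_minus D.B_minus D.B_minus_right add.commute)
  also have "S (k + l) (f (sv (\<omega> powi B l k) (T (- (k + l)) v))) =
      sw (\<omega> powi B l k) (twisted_conj (k + l) f v)"
    unfolding twisted_conj_def using v f_W assms D.K_add
    by (simp add: linear_on_scale[OF f_linear] C.T_scale Pi_iff)
  finally show ?thesis
    using D.B_skew[of k l] assms by (simp flip: D.powi_add)
qed

lemma conj_scalar:
  assumes "same_scalars A" "c \<in> A" "- c \<in> A" "c \<in> K" "v \<in> V"
  shows "twisted_conj c f v = f v"
proof -
  obtain z where z: "T (- c) v = sv z v" "S (- c) (f v) = sw z (f v)"
    using assms f_W unfolding same_scalars_def Pi_iff by meson
  have "f (T (- c) v) = S (- c) (f v)"
    using z assms by (simp add: linear_on_scale[OF f_linear])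
  then show ?thesis
    using assms f_W C.T_inv by (auto simp: twisted_conj_def)
qed

text \<open>Up to a factor, the projection of \<open>f\<close> to the maps on which conjugation by
  \<open>k\<close> is multiplication by \<open>\<omega> powi (2 * B k l)\<close>.\<close>

definition fourier_part :: "'k \<Rightarrow> 'v \<Rightarrow> 'w" where
  "fourier_part l v = (\<Sum>r\<in>R. sw (\<omega> powi (- (2 * B r l))) (twisted_conj r f v))"

lemma fourier_part_W: "v \<in> V \<Longrightarrow> fourier_part l v \<in> W"
  unfolding fourier_part_def using D.R C.V conj_W
  by (intro C.subspace_sum C.subspace_scale) auto

lemma fourier_part_linear: "linear_on sv V sw (fourier_part l)"
proof -
  have conj_lin: "linear_on sv V sw (twisted_conj k f)" if "k \<in> K" for k
    unfolding twisted_conj_def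
    using linear_on_compose[OF linear_on_compose[OF D.T_linear f_linear] C.T_linear] that
      D.K_minus D.T_V f_W by (auto simp: Pi_iff)
  note a = linear_on_add[OF conj_lin] and s = linear_on_scale[OF conj_lin]
  show ?thesis
    unfolding linear_on_def fourier_part_def
  proof (intro conjI ballI allI)
    fix v w assume "v \<in> V" "w \<in> V"
    then show "(\<Sum>r\<in>R. sw (\<omega> powi (- (2 * B r l))) (twisted_conj r f (v + w))) =
       (\<Sum>r\<in>R. sw (\<omega> powi (- (2 * B r l))) (twisted_conj r f v)) +
       (\<Sum>r\<in>R. sw (\<omega> powi (- (2 * B r l))) (twisted_conj r f w))"
      unfolding sum.distrib[symmetric] using D.R
      by (intro sum.cong) (auto simp: a C.scale_right_distrib subset_iff)
  next
    fix c v assume "v \<in> V"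
    then show "(\<Sum>r\<in>R. sw (\<omega> powi (- (2 * B r l))) (twisted_conj r f (sv c v))) =
       sw c (\<Sum>r\<in>R. sw (\<omega> powi (- (2 * B r l))) (twisted_conj r f v))"
      unfolding C.scale_sum_right using D.R
      by (intro sum.cong) (auto simp: s subset_iff mult.commute)
  qed
qed

text \<open>Conjugation by \<open>k\<close> shifts the summation variable by \<open>k\<close>. This
  is harmless because the summand is periodic modulo \<open>M\<close>: both modules have the same
  scalars there, so conjugation by \<open>M\<close> is trivial.\<close>

lemma fourier_part_conj:
  assumes "same_scalars M" "k \<in> K" "l \<in> K" "v \<in> V"
  shows "S k (fourier_part l (T (- k) v)) = sw (\<omega> powi (2 * B k l)) (fourier_part l v)"
proof -
  define \<Psi> where "\<Psi> x = sw (\<omega> powi (- (2 * B x l))) (twisted_conj x f v)" for x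
  have per: "\<Psi> (x + m) = \<Psi> x" if "x \<in> K" "m \<in> M" for x m
  proof -
    have m: "m \<in> K" using that D.M_K by auto
    have "twisted_conj m f (T (- x) v) = f (T (- x) v)"
      using that m assms D.M_minus D.T_V D.K_minus by (intro conj_scalar[OF assms(1)]) auto
    then have c: "twisted_conj (x + m) f v = twisted_conj x f v"
      using conj_add[of x m v] that m assms by (simp add: twisted_conj_def)
    have "\<omega> powi (2 * B m l) = 1"
      using D.M_radical[OF that(2) assms(3)] by (simp add: D.powi_eq_1_iff)
    then have "\<omega> powi (- (2 * B m l)) = 1" by (simp add: power_int_minus)
    then have "\<omega> powi (- (2 * B (x + m) l)) = \<omega> powi (- (2 * B x l))"
      using D.B_add[OF that(1) m assms(3)] D.powi_add[of "- (2 * B x l)" "- (2 * B m l)"]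
      by (simp add: distrib_left)
    then show ?thesis by (simp add: \<Psi>_def c)
  qed
  have "S k (fourier_part l (T (- k) v)) =
      (\<Sum>r\<in>R. sw (\<omega> powi (- (2 * B r l))) (S k (twisted_conj r f (T (- k) v))))"
    unfolding fourier_part_def using assms D.R conj_W D.T_V D.K_minus C.V
    by (subst C.T_sum) (auto simp: C.T_scale subset_iff C.subspace_scale intro!: sum.cong)
  also have "\<dots> = (\<Sum>r\<in>R. sw (\<omega> powi (2 * B k l)) (\<Psi> (r + k)))"
  proof (rule sum.cong[OF refl])
    fix r assume "r \<in> R"
    then have r: "r \<in> K" using D.R by auto
    have "S k (twisted_conj r f (T (- k) v)) = twisted_conj (r + k) f v"
      using conj_add[of k r v] r assms by (simp add: add.commute)
    moreover have "\<omega> powi (- (2 * B r l)) = \<omega> powi (2 * B k l) * \<omega> powi (- (2 * B (r + k) l))"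
      using D.B_add[of r k l] r assms by (simp add: algebra_simps flip: D.powi_add)
    ultimately show "sw (\<omega> powi (- (2 * B r l))) (S k (twisted_conj r f (T (- k) v))) =
        sw (\<omega> powi (2 * B k l)) (\<Psi> (r + k))"
      by (simp add: \<Psi>_def)
  qed
  also have "\<dots> = sw (\<omega> powi (2 * B k l)) (\<Sum>r\<in>R. \<Psi> (r + k))"
    by (simp add: C.scale_sum_right)
  also have "(\<Sum>r\<in>R. \<Psi> (r + k)) = (\<Sum>r\<in>R. \<Psi> r)"
    using D.sum_transversal_shift[where \<Psi> = \<Psi>, OF per assms(2)] .
  finally show ?thesis by (simp add: \<Psi>_def fourier_part_def)
qed

lemma fourier_part_0_intertwiner:
  assumes "same_scalars M"
  shows "intertwiner (fourier_part 0)"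
  unfolding intertwiner_def
proof (intro conjI ballI)
  show "fourier_part 0 \<in> V \<rightarrow> W" using fourier_part_W by auto
  show "linear_on sv V sw (fourier_part 0)" by (rule fourier_part_linear)
  fix k v assume kv: "k \<in> K" "v \<in> V"
  have "B k 0 = 0" using D.B_skew[of k 0] D.B_0 kv D.K_0 by simp
  then show "fourier_part 0 (T k v) = S k (fourier_part 0 v)"
    using fourier_part_conj[OF assms kv(1) D.K_0, of "T k v"] kv D.T_V D.T_inv' by simp
qed

text \<open>Fourier inversion: after exchanging the sums, orthogonality keeps only those
  \<open>r\<close> in the radical, and conjugation by these fixes \<open>f\<close> as they act by
  equal scalars on both modules.\<close>

lemma sum_fourier_part:
  assumes "same_scalars D.radical" "v \<in> V"
  shows "(\<Sum>l\<in>R. fourier_part l v) = sw (of_nat (card R) * of_nat (card (R \<inter> D.radical))) (f v)"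
proof -
  have "(\<Sum>l\<in>R. fourier_part l v) =
      (\<Sum>r\<in>R. sw (\<Sum>l\<in>R. \<omega> powi (2 * B (- r) l)) (twisted_conj r f v))"
    unfolding fourier_part_def C.scale_sum_left
    using D.R D.B_minus by (subst sum.swap) (auto simp: subset_iff intro!: sum.cong)
  also have "\<dots> = (\<Sum>r\<in>R. if r \<in> D.radical then sw (of_nat (card R)) (f v) else 0)"
  proof (rule sum.cong[OF refl])
    fix r assume "r \<in> R"
    then have r: "r \<in> K" using D.R by auto
    have "- r \<in> D.radical \<longleftrightarrow> r \<in> D.radical"
      using D.radical_minus[of r] D.radical_minus[of "- r"] by auto
    moreover have "twisted_conj r f v = f v" if "r \<in> D.radical"
      using that assms r D.radical_minus by (intro conj_scalar[OF assms(1)]) auto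
    ultimately show "sw (\<Sum>l\<in>R. \<omega> powi (2 * B (- r) l)) (twisted_conj r f v) =
        (if r \<in> D.radical then sw (of_nat (card R)) (f v) else 0)"
      using r by (simp add: D.sum_pairing D.K_minus)
  qed
  also have "\<dots> = (\<Sum>r\<in>R \<inter> D.radical. sw (of_nat (card R)) (f v))"
    using D.R by (simp add: sum.inter_restrict)
  finally show ?thesis
    by (simp add: C.sum_constant_scale mult.commute)
qed

end

lemma card_R_radical: "card (R \<inter> D.radical) > 0"
proof -
  obtain r where "r \<in> R" "0 - r \<in> M" using D.R(3)[OF D.K_0] by auto
  then have "r \<in> R \<inter> D.radical" using D.M_minus[of "0 - r"] D.M_subset_radical by auto
  then show ?thesis using D.R by (auto simp: card_gt_0_iff)
qed

text \<open>Some Fourier part \<open>f\<^sub>l\<close> of \<open>f\<close> is nonzero; since it commutes with the action up to the character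
  of \<open>l\<close>, composing it with \<open>T (- l)\<close> yields an intertwiner.\<close>

lemma exists_nonzero_intertwiner:
  assumes f: "f \<in> V \<rightarrow> W" "linear_on sv V sw f" and v: "v \<in> V" "f v \<noteq> 0"
    and scalars: "same_scalars D.radical"
  shows "\<exists>g. intertwiner g \<and> (\<exists>v\<in>V. g v \<noteq> 0)"
proof -
  let ?F = "fourier_part f"
  have M: "same_scalars M"
    using scalars D.M_subset_radical unfolding same_scalars_def by blast
  have "card R > 0" using card_R_radical by (metis Int_iff card_gt_0_iff empty_iff finite_Int ex_in_conv D.R(1))
  then have "(\<Sum>l\<in>R. ?F l v) \<noteq> 0"
    using sum_fourier_part[OF f scalars v(1)] v card_R_radical by simp
  then obtain l where l: "l \<in> R" "?F l v \<noteq> 0" by (meson sum.neutral)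
  then have lK: "l \<in> K" using D.R by auto
  define g where "g u = ?F l (T (- l) u)" for u
  have "intertwiner g"
    unfolding intertwiner_def
  proof (intro conjI ballI)
    show "g \<in> V \<rightarrow> W" using fourier_part_W[OF f] D.T_V D.K_minus lK by (auto simp: g_def)
    show "linear_on sv V sw g"
      unfolding g_def using D.T_linear D.K_minus lK D.T_V
      by (intro linear_on_compose[OF _ fourier_part_linear[OF f]]) auto
    fix k u assume k: "k \<in> K" and u: "u \<in> V"
    let ?w = "T (- l) (T k u)"
    have w: "?w \<in> V" using k u lK D.T_V D.K_minus by auto
    have "S k (?F l (T (- k) ?w)) = sw (\<omega> powi (2 * B k l)) (?F l ?w)"
      by (rule fourier_part_conj[OF f M k lK w])
    moreover have "T (- k) ?w = sv (\<omega> powi (2 * B k l)) (T (- l) u)"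
      using k u lK D.T_comm[of "- k" "- l" "T k u"] D.K_minus D.T_V D.T_inv'
        D.B_minus D.B_minus_right by simp
    ultimately have "sw (\<omega> powi (2 * B k l)) (S k (g u)) = sw (\<omega> powi (2 * B k l)) (g (T k u))"
      using k u lK D.K_minus D.T_V fourier_part_W[OF f]
      by (simp add: g_def linear_on_scale[OF fourier_part_linear[OF f]] C.T_scale)
    then show "g (T k u) = S k (g u)"
      using D.omega_nz by simp
  qed
  moreover have "g (T l v) \<noteq> 0" using l lK v D.T_inv' by (simp add: g_def)
  ultimately show ?thesis using D.T_V lK v by blast
qed

end

section \<open>Schur's lemma in countable dimension\<close>

lemma (in vector_space) countable_independent_in_span:
  assumes "countable C" "independent b" "b \<subseteq> span C"
  shows "countable b"
proof -
  \<comment> \<open>There are only countably many finite subsets of \<open>C\<close>, and the span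
    of each contains only finitely many vectors of an independent set.\<close>
  have cover: "b \<subseteq> (\<Union>t\<in>{t. t \<subseteq> C \<and> finite t}. b \<inter> span t)"
  proof
    fix x assume "x \<in> b"
    then obtain t r where "finite t" "t \<subseteq> C" and x: "x = (\<Sum>a\<in>t. scale (r a) a)"
      using assms(3) unfolding span_explicit by blast
    have "x \<in> span t" unfolding x by (intro span_sum span_scale span_base)
    then show "x \<in> (\<Union>t\<in>{t. t \<subseteq> C \<and> finite t}. b \<inter> span t)"
      using \<open>x \<in> b\<close> \<open>finite t\<close> \<open>t \<subseteq> C\<close> by blast
  qed
  have "finite (b \<inter> span t)" if "finite t" for t
    using independent_span_bound[OF that independent_mono[OF assms(2)], of "b \<inter> span t"] by simp
  moreover have "countable {t. t \<subseteq> C \<and> finite t}"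
    using countable_Collect_finite_subset[OF assms(1)] by (simp add: conj_commute)
  ultimately have "countable (\<Union>t\<in>{t. t \<subseteq> C \<and> finite t}. b \<inter> span t)"
    by (intro countable_UN) (simp_all add: countable_finite)
  then show ?thesis by (rule countable_subset[OF cover])
qed

locale endomorphism_on = vector_space sv for sv :: "complex \<Rightarrow> 'v::ab_group_add \<Rightarrow> 'v" +
  fixes V \<phi>
  assumes V: "subspace V" and phi_V: "v \<in> V \<Longrightarrow> \<phi> v \<in> V" and phi_linear: "linear_on sv V sv \<phi>"
begin

lemma phi_add: "v \<in> V \<Longrightarrow> w \<in> V \<Longrightarrow> \<phi> (v + w) = \<phi> v + \<phi> w"
  using phi_linear linear_on_add by blast

lemma phi_scale: "v \<in> V \<Longrightarrow> \<phi> (sv c v) = sv c (\<phi> v)"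
  using phi_linear linear_on_scale by blast

lemma pow_V: "v \<in> V \<Longrightarrow> (\<phi> ^^ n) v \<in> V"
  by (induction n) (auto intro: phi_V)

lemma pow_linear: "linear_on sv V sv (\<phi> ^^ n)"
proof (induction n)
  case (Suc n)
  then show ?case
    using linear_on_compose[OF Suc phi_linear] pow_V by (simp add: o_def)
qed (simp add: linear_on_def)

lemma phi_sum: "(\<And>i. i \<in> I \<Longrightarrow> g i \<in> V) \<Longrightarrow> \<phi> (\<Sum>i\<in>I. g i) = (\<Sum>i\<in>I. \<phi> (g i))"
  by (intro linear_map_on.map_sum[of sv sv V] linear_map_on.intro linear_map_on_axioms.intro
      vector_space_axioms V phi_linear)

definition poly_act :: "complex poly \<Rightarrow> 'v \<Rightarrow> 'v" where
  "poly_act p v = (\<Sum>i\<le>degree p. sv (coeff p i) ((\<phi> ^^ i) v))"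

lemma poly_act_bound:
  assumes "degree p \<le> n"
  shows "poly_act p v = (\<Sum>i\<le>n. sv (coeff p i) ((\<phi> ^^ i) v))"
  unfolding poly_act_def using assms
  by (intro sum.mono_neutral_left) (auto simp: coeff_eq_0)

lemma poly_act_V: "v \<in> V \<Longrightarrow> poly_act p v \<in> V"
  unfolding poly_act_def by (intro subspace_sum V subspace_scale pow_V)

lemma poly_act_linear: "linear_on sv V sv (poly_act p)"
  using linear_on_add[OF pow_linear] linear_on_scale[OF pow_linear]
  by (simp add: linear_on_def poly_act_def scale_right_distrib sum.distrib scale_sum_right mult.commute)

lemma poly_act_add: "poly_act (p + q) v = poly_act p v + poly_act q v"
proof -
  let ?n = "max (degree p) (degree q)"
  have "degree (p + q) \<le> ?n" by (rule degree_add_le_max)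
  then show ?thesis
    using poly_act_bound[of "p + q" ?n v] poly_act_bound[of p ?n v] poly_act_bound[of q ?n v]
    by (simp add: scale_left_distrib sum.distrib)
qed

lemma poly_act_0: "poly_act 0 v = 0"
  by (simp add: poly_act_def)

lemma poly_act_smult: "poly_act (smult c p) v = sv c (poly_act p v)"
  using poly_act_bound[of "smult c p" "degree p" v]
  by (simp add: poly_act_def degree_smult_le scale_sum_right)

lemma poly_act_sum: "poly_act (\<Sum>i\<in>I. p i) v = (\<Sum>i\<in>I. poly_act (p i) v)"
  by (induction I rule: infinite_finite_induct) (simp_all add: poly_act_0 poly_act_add)

lemma poly_act_pCons_0: "poly_act (pCons 0 p) v = poly_act p (\<phi> v)"
proof -
  have "poly_act (pCons 0 p) v = (\<Sum>i\<le>Suc (degree p). sv (coeff (pCons 0 p) i) ((\<phi> ^^ i) v))"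
    by (intro poly_act_bound) (simp add: degree_pCons_le)
  also have "\<dots> = (\<Sum>i\<le>degree p. sv (coeff p i) ((\<phi> ^^ i) (\<phi> v)))"
    by (simp add: sum.atMost_Suc_shift funpow_swap1 del: sum.atMost_Suc)
  finally show ?thesis by (simp add: poly_act_def)
qed

lemma poly_act_commute: "v \<in> V \<Longrightarrow> poly_act p (\<phi> v) = \<phi> (poly_act p v)"
  unfolding poly_act_def using pow_V V
  by (subst phi_sum) (auto simp: phi_scale subspace_scale funpow_swap1 pow_V intro!: sum.cong)

text \<open>The factor can be split off on either side: the first form makes it cancel a resolvent
  vector, the second drives the induction on the degree.\<close>

lemma poly_act_linear_factor:
  assumes "v \<in> V"
  shows "poly_act ([:- z, 1:] * p) v = poly_act p (\<phi> v - sv z v)"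
    and "poly_act ([:- z, 1:] * p) v = \<phi> (poly_act p v) - sv z (poly_act p v)"
proof -
  have "poly_act ([:- z, 1:] * p) v = poly_act (smult (- z) p + pCons 0 p) v"
    by simp
  also have "\<dots> = poly_act p (\<phi> v) - sv z (poly_act p v)"
    unfolding poly_act_add poly_act_smult poly_act_pCons_0 by simp
  finally show "poly_act ([:- z, 1:] * p) v = \<phi> (poly_act p v) - sv z (poly_act p v)"
    "poly_act ([:- z, 1:] * p) v = poly_act p (\<phi> v - sv z v)"
    using assms linear_map_on.map_diff[of sv sv V "poly_act p" "\<phi> v" "sv z v"] poly_act_linear
      linear_on_scale[OF poly_act_linear assms] phi_V V subspace_scale vector_space_axioms
    by (simp_all add: poly_act_commute linear_map_on_def linear_map_on_axioms_def)
qed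

text \<open>If every \<open>\<phi> - z\<close> is bijective the resolvents \<open>(\<phi> - z)\<^sup>-\<^sup>1 v\<close> are linearly independent, and there
  are too many of them for a space of countable dimension.\<close>

lemma resolvent_independent:
  assumes inj: "\<And>z w. w \<in> V \<Longrightarrow> \<phi> w - sv z w = 0 \<Longrightarrow> w = 0"
    and y: "\<And>z. y z \<in> V" "\<And>z. \<phi> (y z) - sv z (y z) = v" and v: "v \<in> V" "v \<noteq> 0"
  shows "inj y" "independent (range y)"
proof -
  \<comment> \<open>Over the complex numbers \<open>p\<close> is a product of linear factors, and
    each \<open>\<phi> - z\<close> is injective.\<close>
  have poly_inj: "w = 0" if "p \<noteq> 0" "w \<in> V" "poly_act p w = 0" for p w
    using that
  proof (induction "degree p" arbitrary: p)
    case 0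
    then obtain a where "p = [:a:]" using degree_eq_zeroE by metis
    with 0 show ?case by (simp add: poly_act_def)
  next
    case (Suc n)
    then have "\<not> constant (poly p)" by (simp add: constant_degree)
    then obtain z where "poly p z = 0" using fundamental_theorem_of_algebra by blast
    then obtain q where q: "p = [:- z, 1:] * q" using poly_eq_0_iff_dvd[of p z] by (auto elim: dvdE)
    then have "q \<noteq> 0" using Suc.prems by auto
    then have "degree p = Suc (degree q)"
      unfolding q by (subst degree_mult_eq) (simp_all del: mult_pCons_left)
    then have "n = degree q" using Suc.hyps(2) by simp
    moreover have "poly_act q w = 0"
      using Suc.prems inj[of "poly_act q w" z] poly_act_linear_factor(2) poly_act_V q by auto
    ultimately show ?case using Suc \<open>q \<noteq> 0\<close> by blast
  qed
  show inj_y: "inj y"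
  proof (rule injI)
    fix a b assume "y a = y b"
    then have "\<phi> (y a) - sv a (y a) = \<phi> (y a) - sv b (y a)" using y(2)[of a] y(2)[of b] by simp
    then have "a = b \<or> y a = 0" by simp
    moreover have "y a \<noteq> 0" using y(2)[of a] v phi_scale[OF V[THEN subspace_0], of 0] by auto
    ultimately show "a = b" by blast
  qed
  \<comment> \<open>Clearing denominators: applying all \<open>\<phi> - z\<close> with
    \<open>z \<in> A\<close> to the relation gives a polynomial in \<open>\<phi>\<close> that kills
    \<open>v\<close>, hence the zero polynomial. Its value at \<open>c\<close> retains only the term
    of \<open>c\<close>.\<close>
  have coeff_0: "a c = 0" if "finite A" "(\<Sum>z\<in>A. sv (a z) (y z)) = 0" "c \<in> A" for A a c
  proof -
    let ?P = "\<lambda>A. \<Prod>z\<in>A. [:- z, 1:]"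
    have P: "?P A = [:- z, 1:] * ?P (A - {z})" if "z \<in> A" for z
      using prod.remove[OF \<open>finite A\<close> that] .
    have "poly_act (\<Sum>z\<in>A. smult (a z) (?P (A - {z}))) v = (\<Sum>z\<in>A. sv (a z) (poly_act (?P (A - {z})) v))"
      by (simp add: poly_act_sum poly_act_smult)
    also have "\<dots> = (\<Sum>z\<in>A. sv (a z) (poly_act (?P A) (y z)))"
      using poly_act_linear_factor(1)[OF y(1)] y(2) P by (intro sum.cong) simp_all
    also have "\<dots> = poly_act (?P A) (\<Sum>z\<in>A. sv (a z) (y z))"
      using linear_map_on.map_sum[of sv sv V "poly_act (?P A)" A "\<lambda>z. sv (a z) (y z)"]
        y(1) V vector_space_axioms poly_act_linear linear_on_scale[OF poly_act_linear]
      by (simp add: linear_map_on_def linear_map_on_axioms_def subspace_scale)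
    also have "\<dots> = 0"
      using that linear_map_on.map_0[of sv sv V "poly_act (?P A)"] V vector_space_axioms poly_act_linear
      by (simp add: linear_map_on_def linear_map_on_axioms_def)
    finally have "(\<Sum>z\<in>A. smult (a z) (?P (A - {z}))) = 0"
      using poly_inj v by blast
    then have "0 = poly (\<Sum>z\<in>A. smult (a z) (?P (A - {z}))) c" by simp
    also have "\<dots> = (\<Sum>z\<in>A. a z * (\<Prod>w\<in>A - {z}. c - w))"
      by (simp add: poly_sum poly_prod)
    also have "\<dots> = (\<Sum>z\<in>A. if z = c then a c * (\<Prod>w\<in>A - {c}. c - w) else 0)"
      using that by (intro sum.cong) (auto simp: prod_zero_iff)
    also have "\<dots> = a c * (\<Prod>w\<in>A - {c}. c - w)"
      using that by simp
    finally show "a c = 0" using that by (simp add: prod_zero_iff)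
  qed
  show "independent (range y)"
    unfolding independent_explicit_module
  proof (intro allI impI)
    fix t u w assume t: "finite t" "t \<subseteq> range y" "(\<Sum>v\<in>t. sv (u v) v) = 0" "w \<in> t"
    let ?A = "y -` t"
    have t_eq: "t = y ` ?A" using t(2) by auto
    have fin: "finite ?A" using finite_vimageI[OF t(1) inj_y] .
    have "(\<Sum>z\<in>?A. sv (u (y z)) (y z)) = (\<Sum>v\<in>y ` ?A. sv (u v) v)"
      using inj_y by (subst sum.reindex) (auto intro: inj_on_subset)
    also have "\<dots> = 0" using t_eq t(3) by simp
    finally have "u (y z) = 0" if "z \<in> ?A" for z
      using coeff_0[OF fin, of "\<lambda>z. u (y z)"] that by blast
    then show "u w = 0" using t(2,4) by auto
  qed
qed

end

context twisted_module
begin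

text \<open>If \<open>\<phi>\<close> were no scalar, every \<open>\<phi> - z\<close> would be a
  nonzero endomorphism of a simple module and therefore bijective; the resolvents of one vector
  would then be an independent family indexed by all complex numbers.\<close>

theorem schur:
  assumes simple: "simple V" and lin: "linear_on sv V sv \<phi>" and phi_V: "\<And>v. v \<in> V \<Longrightarrow> \<phi> v \<in> V"
    and comm: "\<And>k v. k \<in> K \<Longrightarrow> v \<in> V \<Longrightarrow> \<phi> (T k v) = T k (\<phi> v)"
  shows "\<exists>z. \<forall>v\<in>V. \<phi> v = sv z v"
proof (rule ccontr)
  assume contra: "\<not> ?thesis"
  interpret endomorphism_on sv V \<phi>
    by unfold_locales (simp_all add: V phi_V lin)
  interpret P: twisted_module_pair K B N \<omega> M R sv V T sv V T ..
  have int: "P.intertwiner (\<lambda>v. \<phi> v - sv z v)" for z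
    unfolding P.intertwiner_def
  proof (intro conjI ballI)
    show "(\<lambda>v. \<phi> v - sv z v) \<in> V \<rightarrow> V"
      using phi_V V by (auto intro: subspace_diff subspace_scale)
    show "linear_on sv V sv (\<lambda>v. \<phi> v - sv z v)"
      by (auto simp: linear_on_def phi_add phi_scale scale_right_distrib scale_right_diff_distrib
          mult.commute)
    fix k v assume kv: "k \<in> K" "v \<in> V"
    have "T k (\<phi> v - sv z v) = T k (\<phi> v) - T k (sv z v)"
      using linear_map_on.map_diff[OF linear_map_T[OF kv(1)]] kv phi_V V subspace_scale by blast
    then show "\<phi> (T k v) - sv z (T k v) = T k (\<phi> v - sv z v)"
      using comm kv T_scale by simp
  qed
  obtain v where v: "v \<in> V" "v \<noteq> 0"
    using simple V subspace_0 unfolding simple_def by blast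
  have nz: "\<exists>w\<in>V. \<phi> w - sv z w \<noteq> 0" for z using contra by auto
  have inj0: "w = 0" if "w \<in> V" "\<phi> w - sv z w = 0" for z w
  proof -
    obtain u where u: "u \<in> V" "\<phi> u - sv z u \<noteq> 0" using nz by blast
    have inj: "inj_on (\<lambda>v. \<phi> v - sv z v) V"
      by (rule P.simple_intertwiner_inj[OF int simple u])
    moreover have "\<phi> 0 - sv z 0 = 0" using phi_sum[of "{}" id] by simp
    ultimately show "w = 0"
      using inj_onD[OF inj, of w 0] that subspace_0[OF V] by simp
  qed
  have "\<exists>w\<in>V. \<phi> w - sv z w = v" for z
  proof -
    obtain u where u: "u \<in> V" "\<phi> u - sv z u \<noteq> 0" using nz by blast
    have "simple ((\<lambda>v. \<phi> v - sv z v) ` V)"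
      by (rule P.simple_image[OF int simple u])
    then have "(\<lambda>v. \<phi> v - sv z v) ` V = V"
      using simple unfolding simple_def invariant_def by blast
    then have "v \<in> (\<lambda>v. \<phi> v - sv z v) ` V" using v(1) by (rule ssubst)
    then show ?thesis by auto
  qed
  then obtain y where y: "\<And>z. y z \<in> V" "\<And>z. \<phi> (y z) - sv z (y z) = v"
    by metis
  have ind: "inj y" "independent (range y)"
    by (rule resolvent_independent[OF inj0 y v]; assumption)+
  have "countable (range y)"
  proof (rule countable_independent_in_span[OF _ ind(2)])
    show "range y \<subseteq> span ((\<lambda>k. T k v) ` K)"
      using simple_cyclic[OF simple v] y(1) by auto
  qed (use countable_K in auto)
  then have "countable (UNIV :: complex set)"
    using ind(1) by (simp add: countable_image_inj_eq)
  then have "countable (range complex_of_real)"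
    by (rule countable_subset[rotated]) simp
  then have "countable (UNIV :: real set)"
    by (simp add: countable_image_inj_eq inj_of_real)
  then show False using uncountable_UNIV_real by simp
qed

lemma simple_radical_scalar:
  assumes "simple V" "c \<in> radical"
  shows "\<exists>z. \<forall>v\<in>V. T c v = sv z v"
  using assms radical_K T_radical_comm T_V
  by (intro schur T_linear) auto

text \<open>The trace of \<open>\<Sum>\<^sub>r T r \<otimes> T (- r)\<close> is computed in two ways: by Schur's lemma, and from
  the vanishing of the trace of \<open>T r\<close> for \<open>r\<close> outside of the radical.\<close>

theorem simple_dimension:
  assumes simple: "simple V"
  shows "\<exists>b. finite b \<and> independent b \<and> span b = V \<and> (card b)\<^sup>2 * card (R \<inter> radical) = card R"
proof -
  obtain v0 where v0: "v0 \<in> V" "v0 \<noteq> 0"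
    using simple V subspace_0 unfolding simple_def by blast
  \<comment> \<open>Elements of \<open>M\<close> act by scalars, so the finitely many
    representatives in \<open>R\<close> already generate the cyclic module: this is where finite
    dimension is obtained.\<close>
  have T_in: "T k v0 \<in> span ((\<lambda>r. T r v0) ` R)" if k: "k \<in> K" for k
  proof -
    obtain r where r: "r \<in> R" "k - r \<in> M" using R(3)[OF k] by auto
    then have rK: "r \<in> K" "k - r \<in> K" using R(2) k K_diff by auto
    obtain z where "T (k - r) v0 = sv z v0"
      using simple_radical_scalar[OF simple, of "k - r"] r M_subset_radical v0 by auto
    then have "T r (sv z v0) = sv (\<omega> powi B r (k - r)) (T k v0)"
      using T_T[OF rK v0(1)] by simp
    then have "sv z (T r v0) = sv (\<omega> powi B r (k - r)) (T k v0)"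
      using T_scale rK v0 by simp
    then have eq: "T k v0 = sv (inverse (\<omega> powi B r (k - r))) (sv z (T r v0))"
      using omega_nz by simp
    show ?thesis unfolding eq using r by (intro span_scale span_base imageI)
  qed
  have spanning: "V \<subseteq> span ((\<lambda>r. T r v0) ` R)"
    unfolding simple_cyclic[OF simple v0, symmetric]
    using T_in by (intro span_minimal subspace_span) auto
  obtain b where b: "b \<subseteq> V" "independent b" "V \<subseteq> span b"
    using maximal_independent_subset by blast
  then have "finite b"
    using independent_span_bound[of "(\<lambda>r. T r v0) ` R" b] R(1) spanning b(1,2) by blast
  have span_b: "span b = V"
    using b V span_minimal by blast
  define \<kappa> where "\<kappa> c v = representation b v c" for c v
  have k_add: "\<kappa> c (v + w) = \<kappa> c v + \<kappa> c w" if "v \<in> V" "w \<in> V" for c v w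
    using representation_add[OF b(2)] that span_b by (simp add: \<kappa>_def)
  have k_scale: "\<kappa> c (sv a v) = a * \<kappa> c v" if "v \<in> V" for a c v
    using representation_scale[OF b(2)] that span_b by (simp add: \<kappa>_def)
  have k_sum: "\<kappa> c (\<Sum>i\<in>I. g i) = (\<Sum>i\<in>I. \<kappa> c (g i))" if "\<And>i. i \<in> I \<Longrightarrow> g i \<in> V" for c g and I :: "'x set"
    using representation_sum[OF b(2), of I g] that span_b by (simp add: \<kappa>_def)
  have k_basis: "\<kappa> c d = (if c = d then 1 else 0)" if "c \<in> b" "d \<in> b" for c d
    using representation_basis[OF b(2)] that by (simp add: \<kappa>_def)
  have k_expand: "(\<Sum>c\<in>b. sv (\<kappa> c v) c) = v" if "v \<in> V" for v
    using sum_representation_eq[OF b(2), of v b] that span_b \<open>finite b\<close> by (simp add: \<kappa>_def)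
  have bV: "c \<in> V" if "c \<in> b" for c using that b by auto
  have RK: "r \<in> K" "- r \<in> K" if "r \<in> R" for r using that R(2) K_minus by auto
  define d where "d = card b"
  have "d \<noteq> 0"
    using span_b simple \<open>finite b\<close> unfolding d_def simple_def by auto
  define tr where "tr A = (\<Sum>c\<in>b. \<kappa> c (A c))" for A
  have tr_swap: "tr (\<lambda>v. A (A' v)) = tr (\<lambda>v. A' (A v))"
    if A: "linear_on sv V sv A" "A \<in> V \<rightarrow> V" "linear_on sv V sv A'" "A' \<in> V \<rightarrow> V" for A A'
  proof -
    have expand: "\<kappa> c (A (A' c)) = (\<Sum>e\<in>b. \<kappa> e (A' c) * \<kappa> c (A e))"
      if "c \<in> b" and A: "linear_on sv V sv A" "A \<in> V \<rightarrow> V" "A' \<in> V \<rightarrow> V" for c A A'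
    proof -
      interpret A: linear_map_on sv sv V A
        by unfold_locales (simp_all add: V A)
      have "A (A' c) = A (\<Sum>e\<in>b. sv (\<kappa> e (A' c)) e)"
        using k_expand[of "A' c"] funcset_mem[OF A(3) bV[OF \<open>c \<in> b\<close>]] by simp
      also have "\<dots> = (\<Sum>e\<in>b. sv (\<kappa> e (A' c)) (A e))"
        using bV V by (subst A.map_sum) (auto intro: subspace_scale simp: linear_on_scale[OF A(1)])
      finally have "A (A' c) = (\<Sum>e\<in>b. sv (\<kappa> e (A' c)) (A e))" .
      moreover have "A e \<in> V" if "e \<in> b" for e using A(2) bV that by auto
      ultimately show ?thesis
        using V by (simp add: k_sum subspace_scale k_scale)
    qed
    have "tr (\<lambda>v. A (A' v)) = (\<Sum>c\<in>b. \<Sum>e\<in>b. \<kappa> e (A' c) * \<kappa> c (A e))"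
      unfolding tr_def using expand A by (intro sum.cong) auto
    also have "\<dots> = (\<Sum>e\<in>b. \<Sum>c\<in>b. \<kappa> c (A e) * \<kappa> e (A' c))"
      by (subst sum.swap) (simp add: mult.commute)
    also have "\<dots> = tr (\<lambda>v. A' (A v))"
      unfolding tr_def using expand[of _ A' A] A by (intro sum.cong) auto
    finally show ?thesis .
  qed
  \<comment> \<open>Conjugation by \<open>T k\<close> preserves the trace but multiplies
    \<open>T r\<close> by a root of unity other than 1.\<close>
  have tr_0: "tr (T r) = 0" if r: "r \<in> K" "r \<notin> radical" for r
  proof -
    obtain k where k: "k \<in> K" "\<not> int N dvd B r k"
      using r by (auto simp: radical_def)
    then have "\<not> int N dvd B k r" using B_skew[of k r] r by simp
    then have "\<omega> powi (2 * B k r) \<noteq> 1" using powi_eq_1_iff by simp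
    have "tr (\<lambda>v. T k (T r (T (- k) v))) = tr (\<lambda>v. T r (T (- k) (T k v)))"
    proof (rule tr_swap[of "T k" "\<lambda>v. T r (T (- k) v)"])
      show "linear_on sv V sv (\<lambda>v. T r (T (- k) v))"
        using k r T_V K_minus by (intro linear_on_compose[OF T_linear T_linear]) auto
    qed (use k r T_V T_linear K_minus in auto)
    also have "\<dots> = tr (T r)"
      unfolding tr_def using k r bV T_inv' by (intro sum.cong) auto
    also have "tr (\<lambda>v. T k (T r (T (- k) v))) = \<omega> powi (2 * B k r) * tr (T r)"
      unfolding tr_def sum_distrib_left
    proof (intro sum.cong refl)
      fix c assume "c \<in> b"
      then have "T k (T r (T (- k) c)) = sv (\<omega> powi (2 * B k r)) (T r c)"
        using T_comm[of k r "T (- k) c"] k r bV T_V K_minus T_inv by simp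
      then show "\<kappa> c (T k (T r (T (- k) c))) = \<omega> powi (2 * B k r) * \<kappa> c (T r c)"
        using k_scale T_V r bV \<open>c \<in> b\<close> by simp
    qed
    finally show ?thesis using \<open>\<omega> powi (2 * B k r) \<noteq> 1\<close> by simp
  qed
  interpret P: twisted_module_pair K B N \<omega> M R sv V T sv V T ..
  have B_0_right: "B r 0 = 0" if "r \<in> K" for r
    using B_skew[of r 0] B_0 that K_0 by simp
  have M_scalars: "P.same_scalars M"
    using simple_radical_scalar[OF simple] M_subset_radical unfolding P.same_scalars_def by blast
  \<comment> \<open>Schur orthogonality: the average of the map \<open>f\<close> of rank at most one
    is an intertwiner, hence a scalar \<open>s\<close>, and comparing traces determines
    \<open>s * of_nat d\<close>.\<close>
  have schur_b: "of_nat d * (\<Sum>r\<in>R. \<kappa> c (T (- r) e) * \<kappa> v (T r v)) = of_nat (card R) * \<kappa> c v * \<kappa> v e"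
    if c: "c \<in> b" and v: "v \<in> b" and e: "e \<in> b" for c v e
  proof -
    define f where "f u = sv (\<kappa> c u) v" for u
    have f: "f \<in> V \<rightarrow> V" "linear_on sv V sv f"
      using V bV[OF v] subspace_scale
      by (auto simp: f_def linear_on_def k_add k_scale scale_left_distrib)
    have F: "P.fourier_part f 0 u = (\<Sum>r\<in>R. sv (\<kappa> c (T (- r) u)) (T r v))" if "u \<in> V" for u
      unfolding P.fourier_part_def[OF f] P.twisted_conj_def f_def using RK that bV[OF v] T_V
      by (intro sum.cong) (auto simp: B_0_right T_scale)
    note int = P.fourier_part_0_intertwiner[OF f M_scalars]
    obtain s where s: "\<And>u. u \<in> V \<Longrightarrow> P.fourier_part f 0 u = sv s u"
      using schur[OF simple, of "P.fourier_part f 0"] int unfolding P.intertwiner_def by (auto simp: Pi_iff)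
    have "s * of_nat d = (\<Sum>a\<in>b. \<kappa> a (sv s a))"
      using k_basis bV k_scale by (simp add: d_def)
    also have "\<dots> = (\<Sum>a\<in>b. \<Sum>r\<in>R. \<kappa> c (T (- r) a) * \<kappa> a (T r v))"
    proof (intro sum.cong refl)
      fix a assume a: "a \<in> b"
      have "sv s a = (\<Sum>r\<in>R. sv (\<kappa> c (T (- r) a)) (T r v))"
        using F s bV[OF a] by simp
      then show "\<kappa> a (sv s a) = (\<Sum>r\<in>R. \<kappa> c (T (- r) a) * \<kappa> a (T r v))"
        using RK T_V bV[OF v] V by (simp add: k_sum subspace_scale k_scale)
    qed
    also have "\<dots> = (\<Sum>r\<in>R. \<kappa> c (T (- r) (T r v)))"
    proof (subst sum.swap, intro sum.cong refl)
      fix r assume r: "r \<in> R"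
      have "T (- r) (T r v) = T (- r) (\<Sum>a\<in>b. sv (\<kappa> a (T r v)) a)"
        using k_expand T_V RK[OF r] bV[OF v] by simp
      also have "\<dots> = (\<Sum>a\<in>b. sv (\<kappa> a (T r v)) (T (- r) a))"
        using RK[OF r] bV V by (subst T_sum) (auto simp: subspace_scale T_scale)
      finally show "(\<Sum>a\<in>b. \<kappa> c (T (- r) a) * \<kappa> a (T r v)) = \<kappa> c (T (- r) (T r v))"
        using RK[OF r] bV V T_V by (simp add: k_sum subspace_scale k_scale mult.commute)
    qed
    also have "\<dots> = of_nat (card R) * \<kappa> c v"
      using RK bV[OF v] T_inv' by simp
    finally have sd: "s * of_nat d = of_nat (card R) * \<kappa> c v" .
    have "(\<Sum>r\<in>R. \<kappa> c (T (- r) e) * \<kappa> v (T r v)) = \<kappa> v (P.fourier_part f 0 e)"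
      using F[OF bV[OF e]] RK T_V bV[OF v] V by (simp add: k_sum subspace_scale k_scale)
    also have "\<dots> = s * \<kappa> v e"
      using s bV[OF e] k_scale by simp
    finally show ?thesis using sd by (simp add: mult_ac)
  qed
  \<comment> \<open>In the expanded product of the two traces only the diagonal terms survive
    summation over \<open>R\<close>.\<close>
  let ?X = "\<lambda>r c v. \<kappa> c (T (- r) c) * \<kappa> v (T r v)"
  have "(\<Sum>r\<in>R. tr (T (- r)) * tr (T r)) = (\<Sum>r\<in>R. \<Sum>c\<in>b. \<Sum>v\<in>b. ?X r c v)"
    unfolding tr_def sum_product ..
  also have "\<dots> = (\<Sum>c\<in>b. \<Sum>r\<in>R. \<Sum>v\<in>b. ?X r c v)"
    by (rule sum.swap)
  also have "\<dots> = (\<Sum>c\<in>b. \<Sum>v\<in>b. \<Sum>r\<in>R. ?X r c v)"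
    by (intro sum.cong refl sum.swap)
  finally have "of_nat d * (\<Sum>r\<in>R. tr (T (- r)) * tr (T r)) =
      (\<Sum>c\<in>b. \<Sum>v\<in>b. of_nat d * (\<Sum>r\<in>R. ?X r c v))"
    by (simp only: sum_distrib_left)
  also have "\<dots> = (\<Sum>c\<in>b. \<Sum>v\<in>b. if v = c then of_nat (card R) else 0)"
  proof (intro sum.cong refl)
    fix c v assume c: "c \<in> b" and v: "v \<in> b"
    show "of_nat d * (\<Sum>r\<in>R. ?X r c v) = (if v = c then of_nat (card R) else 0)"
      unfolding schur_b[OF c v c] k_basis[OF c v] k_basis[OF v c] by simp
  qed
  also have "\<dots> = of_nat d * of_nat (card R)"
    using \<open>finite b\<close> by (simp add: d_def)
  finally have "(\<Sum>r\<in>R. tr (T (- r)) * tr (T r)) = of_nat (card R)"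
    using \<open>d \<noteq> 0\<close> by simp
  \<comment> \<open>On the radical \<open>T r\<close> and \<open>T (- r)\<close> are inverse
    scalars, so the traces multiply to the square of the dimension.\<close>
  moreover have "tr (T (- r)) * tr (T r) = (if r \<in> radical then (of_nat d)\<^sup>2 else 0)" if r: "r \<in> R" for r
  proof (cases "r \<in> radical")
    case True
    then obtain z z' where z: "\<And>v. v \<in> V \<Longrightarrow> T r v = sv z v" and z': "\<And>v. v \<in> V \<Longrightarrow> T (- r) v = sv z' v"
      using simple_radical_scalar[OF simple] radical_minus by metis
    have "tr (T r) = z * of_nat d" "tr (T (- r)) = z' * of_nat d"
      unfolding tr_def using z z' bV k_scale k_basis by (simp_all add: d_def)
    moreover have "sv (z' * z) v0 = v0"
      using T_inv'[OF RK(1)[OF r] v0(1)] z z' v0 V subspace_scale by (metis scale_scale)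
    then have "z' * z = 1"
      using v0 scale_cancel_right[of "z' * z" v0 1] by simp
    ultimately show ?thesis using True by (simp add: power2_eq_square mult_ac)
  next
    case False
    then show ?thesis using tr_0 RK[OF r] by simp
  qed
  ultimately have "(of_nat d)\<^sup>2 * of_nat (card (R \<inter> radical)) = (of_nat (card R) :: complex)"
    using R(1) by (simp add: sum.inter_restrict[symmetric] mult.commute)
  then have "d\<^sup>2 * card (R \<inter> radical) = card R"
    by (simp flip: of_nat_power of_nat_mult)
  then show ?thesis using \<open>finite b\<close> b(2) span_b d_def by blast
qed

end

section \<open>Direct sums and complete reducibility\<close>

locale complex_vector_space = vector_space sv
  for sv :: "complex \<Rightarrow> 'v::ab_group_add \<Rightarrow> 'v"
begin

text \<open>Modelled on \<open>simple_decomposition\<close>, which becomes the case where each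
  summand is its own index; extensional families make uniqueness meaningful.\<close>

definition direct_sum :: "'i set \<Rightarrow> ('i \<Rightarrow> 'v set) \<Rightarrow> 'v set \<Rightarrow> bool" where
  "direct_sum I U V \<longleftrightarrow> finite I \<and> (\<forall>i\<in>I. subspace (U i) \<and> U i \<subseteq> V) \<and>
     (\<forall>v\<in>V. \<exists>!f. f \<in> (\<Pi>\<^sub>E i\<in>I. U i) \<and> v = (\<Sum>i\<in>I. f i))"

lemma direct_sumI:
  assumes "finite I" "\<And>i. i \<in> I \<Longrightarrow> subspace (U i)" "\<And>i. i \<in> I \<Longrightarrow> U i \<subseteq> V"
    and sum: "\<And>v. v \<in> V \<Longrightarrow> \<exists>f. (\<forall>i\<in>I. f i \<in> U i) \<and> v = (\<Sum>i\<in>I. f i)"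
    and zero: "\<And>f i. (\<And>i. i \<in> I \<Longrightarrow> f i \<in> U i) \<Longrightarrow> (\<Sum>i\<in>I. f i) = 0 \<Longrightarrow> i \<in> I \<Longrightarrow> f i = 0"
  shows "direct_sum I U V"
  unfolding direct_sum_def
proof (intro conjI ballI)
  fix v assume "v \<in> V"
  then obtain f where f: "\<forall>i\<in>I. f i \<in> U i" "v = (\<Sum>i\<in>I. f i)" using sum by blast
  show "\<exists>!f. f \<in> (\<Pi>\<^sub>E i\<in>I. U i) \<and> v = (\<Sum>i\<in>I. f i)"
  proof (rule ex1I[of _ "restrict f I"])
    show "restrict f I \<in> (\<Pi>\<^sub>E i\<in>I. U i) \<and> v = (\<Sum>i\<in>I. restrict f I i)" using f by auto
    fix h assume h: "h \<in> (\<Pi>\<^sub>E i\<in>I. U i) \<and> v = (\<Sum>i\<in>I. h i)"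
    have "h i - f i = 0" if "i \<in> I" for i
    proof (rule zero[of "\<lambda>i. h i - f i", OF _ _ that])
      show "h i - f i \<in> U i" if "i \<in> I" for i
        using that h f assms(2) by (intro subspace_diff) auto
      show "(\<Sum>i\<in>I. h i - f i) = 0" using h f by (simp add: sum_subtractf)
    qed
    then show "h = restrict f I" using h by (intro ext) (auto simp: restrict_def PiE_def extensional_def)
  qed
qed (use assms in auto)

lemma direct_sum_expand:
  assumes "direct_sum I U V" "v \<in> V"
  shows "\<exists>f. (\<forall>i\<in>I. f i \<in> U i) \<and> v = (\<Sum>i\<in>I. f i)"
  using assms unfolding direct_sum_def by (meson PiE_mem)

lemma direct_sum_unique:
  assumes "direct_sum I U V" "subspace V" "\<And>i. i \<in> I \<Longrightarrow> f i \<in> U i" "\<And>i. i \<in> I \<Longrightarrow> h i \<in> U i"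
    and "(\<Sum>i\<in>I. f i) = (\<Sum>i\<in>I. h i)" "i \<in> I"
  shows "f i = h i"
proof -
  let ?v = "\<Sum>i\<in>I. f i"
  have "?v \<in> V" using assms by (intro subspace_sum) (auto simp: direct_sum_def)
  then have ex1: "\<exists>!f. f \<in> (\<Pi>\<^sub>E i\<in>I. U i) \<and> ?v = (\<Sum>i\<in>I. f i)" using assms(1) unfolding direct_sum_def by blast
  have "restrict f I \<in> (\<Pi>\<^sub>E i\<in>I. U i) \<and> ?v = (\<Sum>i\<in>I. restrict f I i)" using assms(3) by auto
  moreover have "restrict h I \<in> (\<Pi>\<^sub>E i\<in>I. U i) \<and> ?v = (\<Sum>i\<in>I. restrict h I i)"
    using assms(4,5) by auto
  ultimately have "restrict f I = restrict h I" using ex1 by blast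
  then show ?thesis using assms(6) by (metis restrict_apply')
qed

lemma direct_sum_zero:
  assumes "direct_sum I U V" "subspace V" "\<And>i. i \<in> I \<Longrightarrow> f i \<in> U i" "(\<Sum>i\<in>I. f i) = 0" "i \<in> I"
  shows "f i = 0"
  using direct_sum_unique[OF assms(1,2,3), of "\<lambda>_. 0" i] assms
  by (simp add: direct_sum_def subspace_0)

lemma finite_basis_exists:
  assumes "finite b0" "V \<subseteq> span b0"
  obtains b where "finite b" "b \<subseteq> V" "independent b" "V \<subseteq> span b" "card b = dim V"
proof -
  obtain b where b: "b \<subseteq> V" "independent b" "V \<subseteq> span b" "card b = dim V"
    using basis_exists by blast
  moreover have "finite b" using independent_span_bound[OF assms(1) b(2)] b assms by blast
  ultimately show ?thesis using that by blast
qed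

lemma direct_sum_dim:
  assumes ds: "direct_sum I U V" and V: "subspace V" and fin: "finite b0" "V \<subseteq> span b0"
  shows "dim V = (\<Sum>i\<in>I. dim (U i))"
proof -
  have U: "finite I" "subspace (U i)" "U i \<subseteq> V" if "i \<in> I" for i
    using ds that by (auto simp: direct_sum_def)
  have "\<exists>b. finite b \<and> b \<subseteq> U i \<and> independent b \<and> U i \<subseteq> span b \<and> card b = dim (U i)" if "i \<in> I" for i
    using finite_basis_exists[OF fin(1), of "U i"] U(3)[OF that] fin by (metis subset_trans)
  then obtain b where b: "\<And>i. i \<in> I \<Longrightarrow> finite (b i)" "\<And>i. i \<in> I \<Longrightarrow> b i \<subseteq> U i"
    "\<And>i. i \<in> I \<Longrightarrow> independent (b i)" "\<And>i. i \<in> I \<Longrightarrow> U i \<subseteq> span (b i)"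
    "\<And>i. i \<in> I \<Longrightarrow> card (b i) = dim (U i)"
    by metis
  have I: "finite I" using ds by (simp add: direct_sum_def)
  have disj: "b i \<inter> b j = {}" if "i \<in> I" "j \<in> I" "i \<noteq> j" for i j
  proof (rule ccontr)
    assume "b i \<inter> b j \<noteq> {}"
    then obtain x where x: "x \<in> b i" "x \<in> b j" by auto
    \<comment> \<open>A vector common to two of the bases would have two decompositions, one
      concentrated at \<open>i\<close> and one at \<open>j\<close>.\<close>
    define f h where "f k = (if k = i then x else 0)" and "h k = (if k = j then x else 0)" for k
    have "f i = h i"
    proof (rule direct_sum_unique[OF ds V])
      show "f k \<in> U k" "h k \<in> U k" if "k \<in> I" for k
        using that x b(2) \<open>i \<in> I\<close> \<open>j \<in> I\<close> U(2) subspace_0 by (auto simp: f_def h_def)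
      show "(\<Sum>i\<in>I. f i) = (\<Sum>i\<in>I. h i)" using I that by (simp add: f_def h_def)
    qed fact
    then have "x = 0" using that by (simp add: f_def h_def)
    then show False using b(3)[OF that(1)] x dependent_zero by blast
  qed
  define bb where "bb = (\<Union>i\<in>I. b i)"
  have fin_bb: "finite bb" using I b(1) by (simp add: bb_def)
  have "independent bb"
  proof (rule independent_if_scalars_zero[OF fin_bb])
    fix f x assume z: "(\<Sum>x\<in>bb. sv (f x) x) = 0" and "x \<in> bb"
    then obtain i where i: "i \<in> I" "x \<in> b i" by (auto simp: bb_def)
    have "(\<Sum>i\<in>I. \<Sum>x\<in>b i. sv (f x) x) = 0"
      using z unfolding bb_def by (subst (asm) sum.UNION_disjoint) (use I b(1) disj in auto)
    then have "(\<Sum>x\<in>b i. sv (f x) x) = 0"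
    proof (intro direct_sum_zero[OF ds V, where f = "\<lambda>i. \<Sum>x\<in>b i. sv (f x) x" and i = i] i(1))
      fix j assume j: "j \<in> I"
      show "(\<Sum>x\<in>b j. sv (f x) x) \<in> U j"
        using b(2)[OF j] by (intro subspace_sum subspace_scale U(2)[OF j]) auto
    qed
    then show "f x = 0" using independentD[OF b(3)[OF i(1)] b(1)[OF i(1)]] i by blast
  qed
  moreover have "V \<subseteq> span bb"
  proof
    fix v assume "v \<in> V"
    then obtain f where f: "\<forall>i\<in>I. f i \<in> U i" "v = (\<Sum>i\<in>I. f i)"
      using direct_sum_expand[OF ds] by blast
    have "f i \<in> span bb" if "i \<in> I" for i
      using f(1) b(4)[OF that] span_mono[of "b i" bb] that by (auto simp: bb_def)
    then show "v \<in> span bb" unfolding f(2) by (intro span_sum)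
  qed
  moreover have "bb \<subseteq> V" using b(2) U(3) by (auto simp: bb_def)
  ultimately have "dim V = card bb" using basis_card_eq_dim by metis
  also have "card bb = (\<Sum>i\<in>I. card (b i))"
    unfolding bb_def using I b(1) disj by (intro card_UN_disjoint) auto
  finally show ?thesis using b(5) by simp
qed

lemma direct_sum_insert:
  assumes ds: "direct_sum I U V'" and "i \<notin> I" and sub: "subspace (U i)" "subspace V'" "subspace V"
    "U i \<subseteq> V" "V' \<subseteq> V"
    and sum: "\<And>v. v \<in> V \<Longrightarrow> \<exists>u\<in>U i. v - u \<in> V'" and int: "U i \<inter> V' \<subseteq> {0}"
  shows "direct_sum (insert i I) U V"
proof (rule direct_sumI)
  have I: "finite I" "\<And>j. j \<in> I \<Longrightarrow> subspace (U j)" "\<And>j. j \<in> I \<Longrightarrow> U j \<subseteq> V'"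
    using ds by (auto simp: direct_sum_def)
  show "finite (insert i I)" "\<And>j. j \<in> insert i I \<Longrightarrow> subspace (U j)"
    "\<And>j. j \<in> insert i I \<Longrightarrow> U j \<subseteq> V"
    using I sub by blast+
  fix v assume "v \<in> V"
  then obtain u where u: "u \<in> U i" "v - u \<in> V'" using sum by blast
  then obtain f where f: "\<forall>j\<in>I. f j \<in> U j" "v - u = (\<Sum>j\<in>I. f j)"
    using direct_sum_expand[OF ds] by blast
  have "(\<Sum>j\<in>I. (f(i := u)) j) = (\<Sum>j\<in>I. f j)"
    using \<open>i \<notin> I\<close> by (intro sum.cong) auto
  then have "v = (\<Sum>j\<in>insert i I. (f(i := u)) j)"
    using I \<open>i \<notin> I\<close> f(2) by (simp add: algebra_simps)
  then show "\<exists>f. (\<forall>j\<in>insert i I. f j \<in> U j) \<and> v = (\<Sum>j\<in>insert i I. f j)"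
    using f u by (intro exI[of _ "f(i := u)"]) auto
next
  fix f j assume f: "\<And>j. j \<in> insert i I \<Longrightarrow> f j \<in> U j" "(\<Sum>j\<in>insert i I. f j) = 0" "j \<in> insert i I"
  have I: "finite I" "\<And>j. j \<in> I \<Longrightarrow> U j \<subseteq> V'"
    using ds by (auto simp: direct_sum_def)
  have s: "(\<Sum>j\<in>I. f j) \<in> V'" using f I sub by (intro subspace_sum) auto
  have "f i + (\<Sum>j\<in>I. f j) = 0" using f I \<open>i \<notin> I\<close> by simp
  then have "f i = - (\<Sum>j\<in>I. f j)" by (simp add: eq_neg_iff_add_eq_0)
  then have "f i \<in> V'" using s sub subspace_neg by metis
  then have "f i = 0" using int f(1) by auto
  moreover then have "(\<Sum>j\<in>I. f j) = 0" using \<open>f i + _ = 0\<close> by simp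
  ultimately show "f j = 0" using direct_sum_zero[OF ds sub(2), of f j] f by auto
qed

end

sublocale twisted_module \<subseteq> complex_vector_space sv ..

sublocale endomorphism_on \<subseteq> complex_vector_space sv ..

context twisted_module
begin

text \<open>Averaging a linear projection over \<open>K / M\<close>, as in Maschke's theorem.\<close>

lemma invariant_complement:
  assumes U: "invariant U" and M_scalars: "\<And>m. m \<in> M \<Longrightarrow> \<exists>z. \<forall>v\<in>V. T m v = sv z v"
  obtains U' where "invariant U'" "U \<inter> U' = {0}" "\<And>v. v \<in> V \<Longrightarrow> \<exists>u\<in>U. v - u \<in> U'"
proof -
  interpret P: twisted_module_pair K B N \<omega> M R sv V T sv V T ..
  have Us: "subspace U" "U \<subseteq> V" "\<And>k u. k \<in> K \<Longrightarrow> u \<in> U \<Longrightarrow> T k u \<in> U"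
    using U by (auto simp: invariant_def)
  interpret VV: vector_space_pair sv sv ..
  obtain b where b: "b \<subseteq> U" "independent b" "U \<subseteq> span b"
    using maximal_independent_subset by blast
  \<comment> \<open>Any linear projection onto \<open>U\<close> serves as input; it comes from
    extending the identity on a basis of \<open>U\<close> to the whole space.\<close>
  obtain p where p: "Vector_Spaces.linear sv sv p" "\<And>x. x \<in> b \<Longrightarrow> p x = id x" "range p = span (id ` b)"
    using VV.linear_independent_extend[OF b(2), of id] VV.linear_independent_extend_subspace[OF b(2), of id] by metis
  interpret p: Vector_Spaces.linear sv sv p by fact
  have span_b: "span b = U" using b Us by (metis span_minimal subset_antisym)
  have p_U: "p v \<in> U" for v using p(3) span_b by auto
  have p_id: "p v = v" if "v \<in> U" for v
  proof -
    have "Vector_Spaces.linear sv sv id" by (rule linear_id)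
    moreover have "v \<in> span b" using that span_b by simp
    ultimately have "p v = id v" using VV.linear_eq_on[OF p(1)] p(2) by metis
    then show ?thesis by simp
  qed
  have pf: "p \<in> V \<rightarrow> V" "linear_on sv V sv p"
    using p_U Us by (auto simp: linear_on_def p.add p.scale)
  have scalars: "P.same_scalars M" using M_scalars unfolding P.same_scalars_def by metis
  \<comment> \<open>The Fourier part of the trivial character is the unnormalised average, hence an
    intertwiner. On \<open>U\<close> it is multiplication by the number of elements of
    \<open>R\<close>.\<close>
  define q where "q = P.fourier_part p 0"
  have int: "P.intertwiner q" unfolding q_def by (rule P.fourier_part_0_intertwiner[OF pf scalars])
  have q_eq: "q v = (\<Sum>r\<in>R. T r (p (T (- r) v)))" if "v \<in> V" for v
    unfolding q_def P.fourier_part_def[OF pf] P.twisted_conj_def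
  proof (intro sum.cong refl)
    fix r assume "r \<in> R"
    then have "B r 0 = 0" using B_skew[of r 0] B_0[of r] R(2) K_0 by auto
    then show "sv (\<omega> powi - (2 * B r 0)) (T r (p (T (- r) v))) = T r (p (T (- r) v))" by simp
  qed
  have q_U: "q v \<in> U" if "v \<in> V" for v
    unfolding q_eq[OF that] using R(2) p_U Us by (intro subspace_sum) auto
  define n where "n = (of_nat (card R) :: complex)"
  have n: "n \<noteq> 0" 
    using P.card_R_radical R(1) by (auto simp: n_def card_gt_0_iff)
  have q_on_U: "q u = sv n u" if "u \<in> U" for u
  proof -
    have "u \<in> V" using that Us by auto
    then have "q u = (\<Sum>r\<in>R. u)"
      unfolding q_eq[OF \<open>u \<in> V\<close>] using R(2) Us that K_minus T_inv
      by (intro sum.cong) (auto simp: p_id subset_iff)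
    then show ?thesis by (simp add: sum_constant_scale n_def)
  qed
  have q_lin: "linear_on sv V sv q" using int by (simp add: P.intertwiner_def)
  let ?U' = "{v\<in>V. q v = 0}"
  have "U \<inter> ?U' = {0}"
    using q_on_U n Us subspace_0[OF Us(1)] by auto
  moreover have "\<exists>u\<in>U. v - u \<in> ?U'" if v: "v \<in> V" for v
  proof -
    define u where "u = sv (inverse n) (q v)"
    have u: "u \<in> U" using q_U[OF v] Us subspace_scale by (simp add: u_def)
    have "q (v - u) = q v - q u"
      using linear_map_on.map_diff[OF P.intertwinerD(1)[OF int]] v u Us by blast
    also have "q u = q v" using q_on_U[OF u] n by (simp add: u_def)
    finally have "v - u \<in> ?U'" using v u Us V subspace_diff by auto
    then show ?thesis using u by blast
  qed
  ultimately show ?thesis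
    using that P.kernel_invariant[OF int] by blast
qed

text \<open>Strong induction on the dimension of an invariant subspace: a nonzero invariant subspace
  of least dimension is simple and is split off by \<open>invariant_complement\<close>.\<close>

lemma simple_direct_sum_exists:
  assumes fin: "finite b0" "V \<subseteq> span b0" and M_scalars: "\<And>m. m \<in> M \<Longrightarrow> \<exists>z. \<forall>v\<in>V. T m v = sv z v"
  shows "\<exists>Bs. (\<forall>S\<in>Bs. simple S) \<and> direct_sum Bs (\<lambda>S. S) V"
proof -
  have "\<exists>Bs. (\<forall>S\<in>Bs. simple S) \<and> direct_sum Bs (\<lambda>S. S) U" if "invariant U" for U
    using that
  proof (induction "dim U" arbitrary: U rule: less_induct)
    case less
    have dim_less: "dim U' < dim U''" if U': "subspace U'" "U' \<subseteq> U''" "U'' \<subseteq> V" "U' \<noteq> U''" for U' U''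
    proof -
      obtain b where b: "finite b" "b \<subseteq> U'" "independent b" "U' \<subseteq> span b" "card b = dim U'"
        using finite_basis_exists[OF fin(1), of U'] U' fin(2) by blast
      obtain x where x: "x \<in> U''" "x \<notin> U'" using U' by blast
      obtain b'' where b'': "finite b''" "b'' \<subseteq> U''" "independent b''" "U'' \<subseteq> span b''" "card b'' = dim U''"
        using finite_basis_exists[OF fin(1), of U''] U' fin(2) by blast
      have "x \<notin> span b" using x b U' span_minimal by blast
      then have ind: "independent (insert x b)" using b(3) by (rule independent_insertI)
      have "insert x b \<subseteq> span b''" using x b U' b'' by blast
      then have "card (insert x b) \<le> card b''"
        using independent_span_bound[OF b''(1) ind] by blast
      moreover have "x \<notin> b" using \<open>x \<notin> span b\<close> span_base by blast
      ultimately show ?thesis using b b'' by simp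
    qed
    have U: "subspace U" "U \<subseteq> V" using less.prems by (auto simp: invariant_def)
    show ?case
    proof (cases "U = {0}")
      case True
      then have "direct_sum {} (\<lambda>S. S) U" by (intro direct_sumI) auto
      then show ?thesis by blast
    next
      case False
      define d where "d = (LEAST d. \<exists>S. invariant S \<and> S \<subseteq> U \<and> S \<noteq> {0} \<and> dim S = d)"
      have "\<exists>S. invariant S \<and> S \<subseteq> U \<and> S \<noteq> {0} \<and> dim S = d"
        unfolding d_def using less.prems False by (intro LeastI_ex[of "\<lambda>d. \<exists>S. invariant S \<and> S \<subseteq> U \<and> S \<noteq> {0} \<and> dim S = d"]) auto
      then obtain S where S: "invariant S" "S \<subseteq> U" "S \<noteq> {0}" "dim S = d" by blast
      have min: "d \<le> dim S'" if "invariant S'" "S' \<subseteq> U" "S' \<noteq> {0}" for S'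
        unfolding d_def using that by (intro Least_le) blast
      have Ss: "subspace S" "S \<subseteq> V" using S U by (auto simp: invariant_def)
      have simple: "simple S"
        unfolding simple_def
      proof (intro conjI allI impI S)
        fix U' assume U': "invariant U' \<and> U' \<subseteq> S"
        show "U' = {0} \<or> U' = S"
        proof (rule ccontr)
          assume "\<not> ?thesis"
          then have "dim U' < dim S" "U' \<noteq> {0}"
            using U' dim_less[of U' S] Ss by (auto simp: invariant_def)
          then show False using min[of U'] U' S by auto
        qed
      qed
      obtain S' where S': "invariant S'" "S \<inter> S' = {0}" "\<And>v. v \<in> V \<Longrightarrow> \<exists>u\<in>S. v - u \<in> S'"
        using invariant_complement[OF S(1) M_scalars] by blast
      \<comment> \<open>The complement was taken in \<open>V\<close>. Its intersection with
        \<open>U\<close> complements \<open>S\<close> in \<open>U\<close> because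
        \<open>S \<subseteq> U\<close>.\<close>
      let ?U' = "U \<inter> S'"
      have inv': "invariant ?U'"
        using less.prems S'(1) subspace_inter by (auto simp: invariant_def)
      moreover have "dim ?U' < dim U"
      proof (rule dim_less)
        show "?U' \<noteq> U" using S S'(2) by auto
      qed (use inv' U in \<open>auto simp: invariant_def\<close>)
      ultimately obtain Bs where Bs: "\<forall>S\<in>Bs. simple S" "direct_sum Bs (\<lambda>S. S) ?U'"
        using less.hyps by blast
      have "direct_sum (insert S Bs) (\<lambda>S. S) U"
      proof (rule direct_sum_insert[OF Bs(2)])
        show "S \<notin> Bs"
        proof
          assume "S \<in> Bs"
          then have "S \<subseteq> ?U'" using Bs(2) by (auto simp: direct_sum_def)
          then show False using S'(2) S by auto
        qed
        show "\<exists>u\<in>S. v - u \<in> ?U'" if "v \<in> U" for v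
          using S'(3)[of v] that U S(2) subspace_diff[OF U(1)] by blast
      qed (use Ss U inv' S S' in \<open>auto simp: invariant_def\<close>)
      then show ?thesis using Bs simple by (intro exI[of _ "insert S Bs"]) simp
    qed
  qed
  then show ?thesis using invariant_V by blast
qed

end

section \<open>Eigenspaces of an operator with a scalar power\<close>

lemma sum_nth_roots_inverse_power:
  fixes c :: complex
  assumes "n > 0" "c \<noteq> 0" "j < n"
  shows "(\<Sum>z\<in>{z. z ^ n = c}. inverse z ^ j) = (if j = 0 then of_nat n else 0)"
proof (cases "j = 0")
  case True
  then show ?thesis using card_nth_roots[of c n] assms by simp
next
  case False
  \<comment> \<open>A primitive root of unity: multiplication by it permutes the solutions of
    \<open>z ^ n = c\<close> and multiplies the sum by \<open>inverse \<zeta> ^ j\<close>, which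
    differs from 1 for \<open>0 < j < n\<close>.\<close>
  define \<zeta> where "\<zeta> = cis (2 * pi / of_nat n)"
  have "\<zeta> ^ j \<noteq> 1"
  proof
    assume "\<zeta> ^ j = 1"
    then have "cis (real j * (2 * pi / real n)) = 1" unfolding \<zeta>_def Complex.DeMoivre .
    moreover have "real j * (2 * pi / real n) = 2 * pi * real j / real n" by simp
    ultimately have "cis (2 * pi * real j / real n) = 1" by metis
    then have "cos (2 * pi * (real j / real n)) = 1" by (metis cis.simps(1) one_complex.simps(1) times_divide_eq_right)
    then obtain m :: int where m: "2 * pi * (real j / real n) = of_int m * 2 * pi"
      using cos_one_2pi_int by blast
    have "real j / real n = 2 * pi * (real j / real n) / (2 * pi)"
      by (rule nonzero_mult_div_cancel_left[symmetric]) simp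
    also have "\<dots> = of_int m" unfolding m by simp
    finally have "real j / real n = of_int m" .
    then have "real j = of_int m * real n" using assms by (simp add: field_simps)
    then have "real_of_int (int j) = real_of_int (m * int n)" by simp
    then have "int j = m * int n" by (simp only: of_int_eq_iff)
    then have "int n dvd int j" by simp
    then show False using False assms by (auto dest: dvd_imp_le)
  qed
  have zn: "\<zeta> ^ n = 1" using assms by (simp add: \<zeta>_def Complex.DeMoivre)
  have znz: "\<zeta> \<noteq> 0" using zn assms by (auto simp: power_0_left split: if_splits)
  have "(\<Sum>z\<in>{z. z ^ n = c}. inverse z ^ j) = (\<Sum>z\<in>{z. z ^ n = c}. inverse (\<zeta> * z) ^ j)"
    by (rule sum.reindex_bij_witness[where i = "\<lambda>z. \<zeta> * z" and j = "\<lambda>z. z / \<zeta>"])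
      (use zn znz in \<open>auto simp: power_mult_distrib power_divide\<close>)
  also have "\<dots> = inverse \<zeta> ^ j * (\<Sum>z\<in>{z. z ^ n = c}. inverse z ^ j)"
    by (simp add: sum_distrib_left power_mult_distrib)
  finally have "(1 - inverse \<zeta> ^ j) * (\<Sum>z\<in>{z. z ^ n = c}. inverse z ^ j) = 0" by (simp add: algebra_simps)
  moreover have "inverse \<zeta> ^ j \<noteq> 1" using \<open>\<zeta> ^ j \<noteq> 1\<close> by (simp add: power_inverse)
  ultimately show ?thesis using False by simp
qed

context endomorphism_on
begin

text \<open>The operator is annihilated by the polynomial \<open>x ^ n - c\<close>, which has
  \<open>n\<close> distinct roots because \<open>c \<noteq> 0\<close>.\<close>

lemma root_eigenspaces:
  assumes "n > 0" "c \<noteq> 0" and pow: "\<And>v. v \<in> V \<Longrightarrow> (\<phi> ^^ n) v = sv c v"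
  shows "direct_sum {z. z ^ n = c} (\<lambda>z. {v\<in>V. \<phi> v = sv z v}) V"
proof (rule direct_sumI)
  let ?Z = "{z. z ^ n = c}" and ?E = "\<lambda>z. {v\<in>V. \<phi> v = sv z v}"
  have nz: "z \<noteq> 0" if "z \<in> ?Z" for z using that assms by (auto simp: power_0_left split: if_splits)
  show fin: "finite ?Z" using assms by (intro finite_nth_roots) simp
  show "subspace (?E z)" for z
    using V by (auto simp: subspace_def phi_add phi_scale scale_right_distrib mult.commute
        intro: phi_sum[of "{}" id, simplified])
  show "?E z \<subseteq> V" for z by auto
  \<comment> \<open>The spectral projections, written as a discrete Fourier transform of the powers
    of \<open>\<phi>\<close>.\<close>
  define p where "p z v = sv (1 / of_nat n) (\<Sum>j<n. sv (inverse z ^ j) ((\<phi> ^^ j) v))" for z v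
  have p_V: "p z v \<in> V" if "v \<in> V" for z v
    using that V unfolding p_def by (intro subspace_scale subspace_sum pow_V)
  have p_E: "p z v \<in> ?E z" if v: "v \<in> V" and z: "z \<in> ?Z" for z v
  proof -
    have shift: "sv (inverse z ^ j) (\<phi> ((\<phi> ^^ j) v)) = sv z (sv (inverse z ^ Suc j) ((\<phi> ^^ Suc j) v))" for j
      using nz[OF z] by simp
    have "(\<Sum>j<n. sv (inverse z ^ j) (\<phi> ((\<phi> ^^ j) v))) =
        sv z (\<Sum>j<n. sv (inverse z ^ Suc j) ((\<phi> ^^ Suc j) v))"
      unfolding shift scale_sum_right ..
    also have "(\<Sum>j<n. sv (inverse z ^ Suc j) ((\<phi> ^^ Suc j) v)) =
        (\<Sum>j<Suc n. sv (inverse z ^ j) ((\<phi> ^^ j) v)) - v"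
      by (subst sum.lessThan_Suc_shift) simp
    also have "\<dots> = (\<Sum>j<n. sv (inverse z ^ j) ((\<phi> ^^ j) v)) + sv (inverse z ^ n * c) v - v"
      using pow[OF v] by simp
    also have "inverse z ^ n * c = 1"
      using z assms by (simp add: power_inverse)
    finally have "(\<Sum>j<n. sv (inverse z ^ j) (\<phi> ((\<phi> ^^ j) v))) = sv z (\<Sum>j<n. sv (inverse z ^ j) ((\<phi> ^^ j) v))"
      by simp
    moreover have "\<phi> (\<Sum>j<n. sv (inverse z ^ j) ((\<phi> ^^ j) v)) = (\<Sum>j<n. sv (inverse z ^ j) (\<phi> ((\<phi> ^^ j) v)))"
      using v V pow_V by (subst phi_sum) (auto simp: phi_scale subspace_scale)
    ultimately have "\<phi> (p z v) = sv z (p z v)"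
      unfolding p_def using v V pow_V
      by (subst phi_scale) (auto intro!: subspace_sum subspace_scale simp: mult.commute)
    then show ?thesis using p_V v by simp
  qed
  fix v assume v: "v \<in> V"
  note root_sum = sum_nth_roots_inverse_power[OF assms(1,2)]
  have "(\<Sum>z\<in>?Z. p z v) = sv (1 / of_nat n) (\<Sum>z\<in>?Z. \<Sum>j<n. sv (inverse z ^ j) ((\<phi> ^^ j) v))"
    unfolding p_def by (rule scale_sum_right[symmetric])
  also have "(\<Sum>z\<in>?Z. \<Sum>j<n. sv (inverse z ^ j) ((\<phi> ^^ j) v)) =
      (\<Sum>j<n. \<Sum>z\<in>?Z. sv (inverse z ^ j) ((\<phi> ^^ j) v))"
    by (rule sum.swap)
  also have "\<dots> = (\<Sum>j<n. sv (\<Sum>z\<in>?Z. inverse z ^ j) ((\<phi> ^^ j) v))"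
    by (simp only: scale_sum_left)
  also have "(\<Sum>j<n. sv (\<Sum>z\<in>?Z. inverse z ^ j) ((\<phi> ^^ j) v)) = (\<Sum>j<n. if j = 0 then sv (of_nat n) v else 0)"
    by (intro sum.cong refl) (simp add: root_sum)
  also have "\<dots> = sv (of_nat n) v" using assms by simp
  finally have v_eq: "v = (\<Sum>z\<in>?Z. p z v)" using assms by simp
  have E: "\<forall>z\<in>?Z. p z v \<in> ?E z" using p_E[OF v] by simp
  show "\<exists>f. (\<forall>z\<in>?Z. f z \<in> ?E z) \<and> v = (\<Sum>z\<in>?Z. f z)"
    by (rule exI[of _ "\<lambda>z. p z v"], rule conjI[OF E v_eq])
next
  let ?Z = "{z. z ^ n = c}" and ?E = "\<lambda>z. {v\<in>V. \<phi> v = sv z v}"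
  fix f z assume f: "\<And>z. z \<in> ?Z \<Longrightarrow> f z \<in> ?E z" "(\<Sum>z\<in>?Z. f z) = 0" "z \<in> ?Z"
  have fin: "finite ?Z" using assms by (intro finite_nth_roots) simp
  have pow_z: "(\<phi> ^^ j) v = sv (z ^ j) v" if "v \<in> V" "\<phi> v = sv z v" for j z v
    using that by (induction j) (simp_all add: phi_scale mult.commute)
  \<comment> \<open>Lagrange interpolation: the product over the other roots kills every component
    except the one at \<open>z\<close>, which it multiplies by a nonzero number.\<close>
  have "poly_act (\<Prod>w\<in>?Z - {z}. [:- w, 1:]) v = sv (poly (\<Prod>w\<in>?Z - {z}. [:- w, 1:]) u) v"
    if "v \<in> V" "\<phi> v = sv u v" for u v
    unfolding poly_act_def poly_altdef scale_sum_left
    by (intro sum.cong refl) (simp add: pow_z[OF that])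
  then have act: "poly_act (\<Prod>w\<in>?Z - {z}. [:- w, 1:]) (f u) = sv (\<Prod>w\<in>?Z - {z}. u - w) (f u)" if "u \<in> ?Z" for u
    using f(1)[OF that] by (simp add: poly_prod)
  have "0 = poly_act (\<Prod>w\<in>?Z - {z}. [:- w, 1:]) (\<Sum>u\<in>?Z. f u)"
    using f(2) linear_map_on.map_0[of sv sv V] V vector_space_axioms poly_act_linear
    by (simp add: linear_map_on_def linear_map_on_axioms_def)
  also have "\<dots> = (\<Sum>u\<in>?Z. poly_act (\<Prod>w\<in>?Z - {z}. [:- w, 1:]) (f u))"
    using f(1) V vector_space_axioms poly_act_linear
    by (intro linear_map_on.map_sum[of sv sv V]) (auto simp: linear_map_on_def linear_map_on_axioms_def)
  also have "\<dots> = (\<Sum>u\<in>?Z. if u = z then sv (\<Prod>w\<in>?Z - {z}. z - w) (f z) else 0)"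
    using fin by (intro sum.cong refl) (auto simp: act prod_zero_iff)
  also have "\<dots> = sv (\<Prod>w\<in>?Z - {z}. z - w) (f z)" using fin f(3) by simp
  finally have "sv (\<Prod>w\<in>?Z - {z}. z - w) (f z) = 0" by (rule sym)
  moreover have "(\<Prod>w\<in>?Z - {z}. z - w) \<noteq> 0" using fin by (subst prod_zero_iff) auto
  ultimately show "f z = 0" by (simp only: scale_eq_0_iff) blast
qed

end

section \<open>Parity of a permutation and its number of orbits\<close>

text \<open>\<open>p'\<close> follows the cycles of \<open>p\<close> but skips \<open>x\<close>: the
  point sent to \<open>x\<close> is now sent to \<open>p x\<close>. So the cycle of \<open>x\<close>
  merely loses one point.\<close>

lemma orbit_remove:
  assumes p: "p permutes insert x F" "x \<notin> F" "p x \<noteq> x" and y: "y \<in> F"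
  defines "p' \<equiv> Transposition.transpose x (p x) \<circ> p"
  shows "orbit p' y = orbit p y - {x}"
proof -
  have inj: "p a = p b \<longleftrightarrow> a = b" for a b using p(1) permutes_inj by (metis injD)
  have p': "p' z = (if p z = x then p x else p z)" if "z \<noteq> x" for z
    using that inj by (auto simp: p'_def Transposition.transpose_def)
  have perm': "p' permutes F" unfolding p'_def by (rule permutes_insert_lemma[OF p(1)])
  show ?thesis
  proof (intro subset_antisym subsetI)
    fix z assume "z \<in> orbit p' y"
    then have "z \<in> F \<and> z \<in> orbit p y"
    proof induction
      case base
      have "p' y \<in> F" using perm' y by (simp add: permutes_in_image)
      moreover have "p' y \<in> orbit p y"
        using p'[of y] y p(2) by (metis orbit.base orbit.step)
      ultimately show ?case by simp
    next
      case (step z)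
      have "p' z \<in> F" using perm' step by (simp add: permutes_in_image)
      moreover have "z \<noteq> x" using step p(2) by auto
      ultimately show ?case using p'[of z] step by (metis orbit.step)
    qed
    then show "z \<in> orbit p y - {x}" using p(2) by auto
  next
    fix z assume "z \<in> orbit p y - {x}"
    then have "z \<in> orbit p y" "z \<noteq> x" by auto
    \<comment> \<open>The second conjunct covers the moment at which the walk meets
      \<open>x\<close>; the modified permutation has then already arrived at
      \<open>p x\<close>.\<close>
    from this(1) have "(z \<noteq> x \<longrightarrow> z \<in> orbit p' y) \<and> (z = x \<longrightarrow> p x \<in> orbit p' y)"
    proof induction
      case base
      show ?case using p'[of y] y p(2) orbit.base[of p' y] by (metis)
    next
      case (step z)
      show ?case
      proof (cases "z = x")
        case True
        then show ?thesis using step p(3) by simp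
      next
        case False
        then have "p' z \<in> orbit p' y" using step orbit.step by metis
        then show ?thesis using p'[OF False] by (metis)
      qed
    qed
    then show "z \<in> orbit p' y" using \<open>z \<noteq> x\<close> by simp
  qed
qed

text \<open>Induction removing a point \<open>x\<close>. If \<open>x\<close> is fixed, the
  cardinality and the number of orbits drop by one and the sign stays; otherwise the number of
  orbits stays, the cardinality drops by one and the sign changes.\<close>

lemma evenperm_iff_even_orbits:
  assumes "finite S" "p permutes S"
  shows "evenperm p \<longleftrightarrow> even (card S + card (orbit p ` S))"
  using assms
proof (induction S arbitrary: p rule: finite_induct)
  case empty
  then show ?case by (simp add: permutes_empty evenperm_id)
next
  case (insert x F)
  have perm: "permutation p"
    using insert.prems insert.hyps by (auto simp: permutation_permutes)
  have self: "z \<in> orbit p z" for z by (rule permutation_self_in_orbit[OF perm])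
  show ?case
  proof (cases "p x = x")
    case True
    then have pF: "p permutes F"
      using insert.prems by (metis permutes_superset Diff_iff insertE)
    have "orbit p x = {x}" using True by (simp add: orbit_eq_singleton_iff)
    moreover have "{x} \<notin> orbit p ` F"
      using permutes_orbit_subset[OF pF] insert.hyps(2) by fastforce
    ultimately show ?thesis using insert.IH[OF pF] insert.hyps by simp
  next
    case False
    define p' where "p' = Transposition.transpose x (p x) \<circ> p"
    have perm': "p' permutes F" unfolding p'_def by (rule permutes_insert_lemma[OF insert.prems])
    have orb: "orbit p' y = orbit p y - {x}" if "y \<in> F" for y
      unfolding p'_def using orbit_remove[OF insert.prems insert.hyps(2) False that] .
    have px: "p x \<in> F" using insert.prems False permutes_in_image[of p "insert x F" x] by auto
    have "orbit p x = orbit p (p x)" using permutation_orbit_step[OF perm] by simp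
    then have "orbit p ` insert x F = orbit p ` F" using px by auto
    moreover have "orbit p' ` F = (\<lambda>C. C - {x}) ` orbit p ` F"
      using orb by (auto simp: image_image)
    moreover have "inj_on (\<lambda>C. C - {x}) (orbit p ` F)"
    proof (rule inj_onI, clarify)
      fix y y' assume y: "y \<in> F" "y' \<in> F" "orbit p y - {x} = orbit p y' - {x}"
      then have "y \<in> orbit p y'" using self[of y] insert.hyps(2) by auto
      then show "orbit p y = orbit p y'"
        using orbit_cyclic_eq3[OF cyclic_on_orbit'[OF perm]] by blast
    qed
    ultimately have "card (orbit p' ` F) = card (orbit p ` insert x F)"
      by (simp add: card_image)
    moreover have "evenperm p' \<longleftrightarrow> \<not> evenperm p"
      unfolding p'_def using False perm
      by (subst evenperm_comp) (auto simp: evenperm_swap permutation_swap_id)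
    ultimately show ?thesis using insert.IH[OF perm'] insert.hyps by simp
  qed
qed

section \<open>Sides of a glued pattern\<close>

definition nxt :: "'f \<times> nat \<Rightarrow> 'f \<times> nat" where
  "nxt s = (fst s, (snd s + 1) mod 3)"

definition prv :: "'f \<times> nat \<Rightarrow> 'f \<times> nat" where
  "prv s = (fst s, (snd s + 2) mod 3)"

lemma nxt_simps': "nxt (T, 0) = (T, 1)" "nxt (T, 1) = (T, 2)" "nxt (T, 2) = (T, 0)"
  and prv_simps': "prv (T, 0) = (T, 2)" "prv (T, 1) = (T, 0)" "prv (T, 2) = (T, 1)"
  by (simp_all add: nxt_def prv_def del: One_nat_def)

lemmas nxt_simps = nxt_simps'[unfolded One_nat_def] and prv_simps = prv_simps'[unfolded One_nat_def]

lemma less_3_cases: "(i::nat) < 3 \<Longrightarrow> i = 0 \<or> i = 1 \<or> i = 2"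
  by linarith

lemma in_sides: "s \<in> sides F \<longleftrightarrow> fst s \<in> F \<and> snd s < 3"
  by (cases s) (simp add: sides_def)

lemma nxt_sides: "s \<in> sides F \<Longrightarrow> nxt s \<in> sides F"
  and prv_sides: "s \<in> sides F \<Longrightarrow> prv s \<in> sides F"
  by (simp_all add: in_sides nxt_def prv_def)

lemma nxt_prv: "s \<in> sides F \<Longrightarrow> nxt (prv s) = s"
  and prv_nxt: "s \<in> sides F \<Longrightarrow> prv (nxt s) = s"
  and nxt_nxt: "s \<in> sides F \<Longrightarrow> nxt (nxt s) = prv s"
  and prv_prv: "s \<in> sides F \<Longrightarrow> prv (prv s) = nxt s"
  by (auto simp: in_sides nxt_def prv_def prod_eq_iff dest!: less_3_cases)

lemma sum_nxt: "(\<Sum>s\<in>sides F. f (nxt s)) = (\<Sum>s\<in>sides F. f s)"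
  by (rule sum.reindex_bij_witness[where i = prv and j = nxt])
    (auto simp: nxt_sides prv_sides nxt_prv prv_nxt)

lemma finite_sides: "finite F \<Longrightarrow> finite (sides F)"
  by (simp add: sides_def)

lemma card_sides: "card (sides F) = 3 * card F"
  by (simp add: sides_def card_cartesian_product)

text \<open>A face contains at most one side with label \<open>x\<close> followed by label
  \<open>y\<close>, so faces and sides are counted alike. For equal labels this can fail in a
  general pattern, but there the bracket vanishes.\<close>

lemma face_count_sides:
  assumes "x \<noteq> y"
  shows "face_count D x y = card {s \<in> sides (faces D). edge_at D s = x \<and> edge_at D (nxt s) = y}"
proof -
  let ?A = "{s \<in> sides (faces D). edge_at D s = x \<and> edge_at D (nxt s) = y}"
  have inj: "inj_on fst ?A"
  proof (rule inj_onI)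
    fix s t assume st: "s \<in> ?A" "t \<in> ?A" "fst s = fst t"
    then obtain T i j where eq: "s = (T, i)" "t = (T, j)" and ij: "i < 3" "j < 3"
      by (cases s; cases t) (auto simp: in_sides)
    have "t \<noteq> nxt s" "s \<noteq> nxt t" using st(1,2) assms by auto
    then show "s = t" using less_3_cases[OF ij(1)] less_3_cases[OF ij(2)]
      unfolding eq nxt_def by auto
  qed
  have "fst ` ?A = {T \<in> faces D. \<exists>i<3. edge_at D (T, i) = x \<and> edge_at D (T, (i + 1) mod 3) = y}"
  proof (intro subset_antisym subsetI)
    fix T assume "T \<in> {T \<in> faces D. \<exists>i<3. edge_at D (T, i) = x \<and> edge_at D (T, (i + 1) mod 3) = y}"
    then obtain i where "T \<in> faces D" "i < 3" "edge_at D (T, i) = x" "edge_at D (T, (i + 1) mod 3) = y"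
      by blast
    then have "(T, i) \<in> ?A" by (simp add: in_sides nxt_def)
    then have "fst (T, i) \<in> fst ` ?A" by (rule imageI)
    then show "T \<in> fst ` ?A" unfolding fst_conv .
  next
    fix T assume "T \<in> fst ` ?A"
    then obtain s where s: "T = fst s" "s \<in> ?A" by (rule imageE)
    then have "T \<in> faces D" "snd s < 3" "edge_at D (T, snd s) = x" "edge_at D (T, (snd s + 1) mod 3) = y"
      by (simp_all add: in_sides nxt_def)
    then show "T \<in> {T \<in> faces D. \<exists>i<3. edge_at D (T, i) = x \<and> edge_at D (T, (i + 1) mod 3) = y}"
      unfolding mem_Collect_eq by (intro conjI exI[of _ "snd s"])
  qed
  then show ?thesis unfolding face_count_def card_image[OF inj, symmetric] by (rule arg_cong[OF sym])
qed

text \<open>The form becomes a sum over the corners of the faces. In this shape it is local in each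
  face and therefore insensitive to cutting the surface open, which \<open>form_lift\<close>
  exploits.\<close>

lemma form_sides:
  assumes "finite (faces D)"
  shows "form D k l = (\<Sum>s\<in>sides (faces D). k (edge_at D s) * l (edge_at D (nxt s)) -
    k (edge_at D (nxt s)) * l (edge_at D s))"
proof -
  let ?S = "sides (faces D)" and ?E = "edges D" and ?e = "edge_at D"
  have fin: "finite ?S" "finite ?E" using assms by (simp_all add: finite_sides edges_def)
  have eE: "?e s \<in> ?E" if "s \<in> ?S" for s using that by (simp add: edges_def)
  define c where "c x y = (\<Sum>s\<in>?S. of_bool (?e s = x \<and> ?e (nxt s) = y) :: int)" for x y
  have "c x y = int (card {s\<in>?S. ?e s = x \<and> ?e (nxt s) = y})" for x y
    unfolding c_def using fin by (simp add: sum.inter_filter[symmetric] of_bool_def)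
  then have br: "bracket D x y = c x y - c y x" for x y
    by (cases "x = y") (simp_all add: bracket_def face_count_sides)
  have half: "(\<Sum>x\<in>?E. \<Sum>y\<in>?E. f x y * c x y) = (\<Sum>s\<in>?S. f (?e s) (?e (nxt s)))" for f
  proof -
    have "(\<Sum>x\<in>?E. \<Sum>y\<in>?E. f x y * c x y) =
        (\<Sum>x\<in>?E. \<Sum>y\<in>?E. \<Sum>s\<in>?S. f x y * of_bool (?e s = x \<and> ?e (nxt s) = y))"
      by (simp add: c_def sum_distrib_left)
    also have "\<dots> = (\<Sum>x\<in>?E. \<Sum>s\<in>?S. \<Sum>y\<in>?E. f x y * of_bool (?e s = x \<and> ?e (nxt s) = y))"
      by (intro sum.cong refl sum.swap)
    also have "\<dots> = (\<Sum>s\<in>?S. \<Sum>x\<in>?E. \<Sum>y\<in>?E. f x y * of_bool (?e s = x \<and> ?e (nxt s) = y))"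
      by (rule sum.swap)
    also have "\<dots> = (\<Sum>s\<in>?S. f (?e s) (?e (nxt s)))"
    proof (intro sum.cong refl)
      fix s assume s: "s \<in> ?S"
      define a b where "a = ?e s" and "b = ?e (nxt s)"
      have ab: "a \<in> ?E" "b \<in> ?E" using eE[OF s] eE[OF nxt_sides[OF s]] by (simp_all add: a_def b_def)
      have "(\<Sum>y\<in>?E. f x y * of_bool (a = x \<and> b = y)) = (if x = a then f a b else 0)" for x
      proof -
        have "f x y * of_bool (a = x \<and> b = y) = (if y = b then (if x = a then f a b else 0) else 0)" for y
          by simp
        then show ?thesis using fin(2) ab by simp
      qed
      then have "(\<Sum>x\<in>?E. \<Sum>y\<in>?E. f x y * of_bool (a = x \<and> b = y)) = f a b"
        using fin(2) ab by simp
      then show "(\<Sum>x\<in>?E. \<Sum>y\<in>?E. f x y * of_bool (?e s = x \<and> ?e (nxt s) = y)) = f (?e s) (?e (nxt s))"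
        by (simp only: a_def b_def)
    qed
    finally show ?thesis .
  qed
  have "form D k l = (\<Sum>x\<in>?E. \<Sum>y\<in>?E. k x * l y * c x y) - (\<Sum>x\<in>?E. \<Sum>y\<in>?E. k x * l y * c y x)"
    unfolding form_def br by (simp add: right_diff_distrib sum_subtractf)
  also have "(\<Sum>x\<in>?E. \<Sum>y\<in>?E. k x * l y * c y x) = (\<Sum>x\<in>?E. \<Sum>y\<in>?E. k y * l x * c x y)"
    by (rule sum.swap)
  finally show ?thesis
    by (simp add: half sum_subtractf)
qed

text \<open>Summation by parts around each face collects the coefficient of \<open>l\<close> at
  every side.\<close>

lemma form_sides':
  assumes "finite (faces D)"
  shows "form D k l = (\<Sum>s\<in>sides (faces D). l (edge_at D s) *
    (k (edge_at D (prv s)) - k (edge_at D (nxt s))))"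
proof -
  let ?S = "sides (faces D)" and ?e = "edge_at D"
  have "(\<Sum>s\<in>?S. k (?e s) * l (?e (nxt s))) = (\<Sum>s\<in>?S. k (?e (prv (nxt s))) * l (?e (nxt s)))"
    by (intro sum.cong refl) (simp add: prv_nxt)
  also have "\<dots> = (\<Sum>s\<in>?S. k (?e (prv s)) * l (?e s))"
    by (rule sum_nxt)
  finally show ?thesis
    unfolding form_sides[OF assms] by (simp add: sum_subtractf right_diff_distrib mult.commute)
qed

lemma form_add: "form D (k + k') l = form D k l + form D k' l"
  unfolding form_def plus_fun_apply distrib_right sum.distrib ..

lemma form_skew: "form D k l = - form D l k"
proof -
  have "form D k l = (\<Sum>x\<in>edges D. \<Sum>y\<in>edges D. k y * l x * bracket D y x)"
    unfolding form_def by (rule sum.swap)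
  also have "\<dots> = (\<Sum>x\<in>edges D. \<Sum>y\<in>edges D. - (l x * k y * bracket D x y))"
    by (intro sum.cong refl) (subst bracket_skew, simp)
  finally show ?thesis by (simp add: form_def sum_negf)
qed

lemma balanced_sides:
  "k \<in> balanced D \<longleftrightarrow> (\<forall>x. x \<notin> edges D \<longrightarrow> k x = 0) \<and>
    (\<forall>s\<in>sides (faces D). even (k (edge_at D (prv s)) + k (edge_at D s) + k (edge_at D (nxt s))))"
  (is "_ \<longleftrightarrow> ?z \<and> ?s")
proof
  assume k: "k \<in> balanced D"
  show "?z \<and> ?s"
  proof
    show ?z using k by (simp add: balanced_def)
    show ?s
    proof
      fix s assume "s \<in> sides (faces D)"
      then obtain T i where "s = (T, i)" "T \<in> faces D" "i < 3" by (cases s) (auto simp: in_sides)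
      moreover from this have "even (k (edge_at D (T, 0)) + k (edge_at D (T, 1)) + k (edge_at D (T, 2)))"
        using k by (simp add: balanced_def)
      ultimately show "even (k (edge_at D (prv s)) + k (edge_at D s) + k (edge_at D (nxt s)))"
        using less_3_cases[of i] by (auto simp: nxt_simps prv_simps add_ac)
    qed
  qed
next
  assume k: "?z \<and> ?s"
  have "even (k (edge_at D (T, 0)) + k (edge_at D (T, 1)) + k (edge_at D (T, 2)))" if "T \<in> faces D" for T
  proof -
    have "(T, 1) \<in> sides (faces D)" using that by (simp add: in_sides)
    then have "even (k (edge_at D (prv (T, 1))) + k (edge_at D (T, 1)) + k (edge_at D (nxt (T, 1))))"
      using k by blast
    then show ?thesis by (simp add: nxt_simps prv_simps)
  qed
  then show "k \<in> balanced D" using k by (simp add: balanced_def)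
qed

section \<open>The radical of the form modulo N\<close>

definition exponents_mod :: "('f, 'e) pattern \<Rightarrow> nat \<Rightarrow> ('e \<Rightarrow> int) set" where
  "exponents_mod D N = {k \<in> balanced D. \<forall>x. int N dvd k x}"

text \<open>As \<open>N\<close> is odd, the doubled exponents with entries in \<open>{0..<N}\<close> represent the classes of
  balanced exponents modulo \<open>N\<close>.\<close>

definition residue_box :: "('f, 'e) pattern \<Rightarrow> nat \<Rightarrow> ('e \<Rightarrow> int) set" where
  "residue_box D N = {u. (\<forall>x\<in>edges D. u x \<in> {0..<int N}) \<and> (\<forall>x. x \<notin> edges D \<longrightarrow> u x = 0)}"

definition residue_reps :: "('f, 'e) pattern \<Rightarrow> nat \<Rightarrow> ('e \<Rightarrow> int) set" where
  "residue_reps D N = (\<lambda>u x. 2 * u x) ` residue_box D N"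

lemma card_functions_default:
  fixes B :: "int set"
  assumes "finite A"
  shows "card {u. (\<forall>x\<in>A. u x \<in> B) \<and> (\<forall>x. x \<notin> A \<longrightarrow> u x = 0)} = card B ^ card A"
    and "finite B \<Longrightarrow> finite {u. (\<forall>x\<in>A. u x \<in> B) \<and> (\<forall>x. x \<notin> A \<longrightarrow> u x = (0::int))}"
proof -
  let ?X = "{u. (\<forall>x\<in>A. u x \<in> B) \<and> (\<forall>x. x \<notin> A \<longrightarrow> u x = (0::int))}"
  have bij: "bij_betw (\<lambda>u. restrict u A) ?X (A \<rightarrow>\<^sub>E B)"
  proof (rule bij_betw_byWitness[where f' = "\<lambda>f x. if x \<in> A then f x else 0"])
    show "\<forall>a\<in>A \<rightarrow>\<^sub>E B. restrict (\<lambda>x. if x \<in> A then a x else 0) A = a"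
      by (auto simp: fun_eq_iff restrict_def PiE_def extensional_def)
  qed (auto simp: fun_eq_iff)
  then show "card ?X = card B ^ card A"
    using bij_betw_same_card[OF bij] card_PiE[OF assms, of "\<lambda>_. B"] by simp
  show "finite ?X" if "finite B"
    using bij_betw_finite[OF bij] finite_PiE[OF assms, of "\<lambda>_. B"] that by simp
qed

text \<open>\<open>(N + 1) div 2\<close> is the inverse of 2 modulo \<open>N\<close>; the same
  constant appears below wherever an exponent has to be halved.\<close>

lemma odd_inverse_2:
  assumes "odd N"
  shows "int N dvd 2 * (int ((N + 1) div 2) * x) - x"
proof -
  have "2 * int ((N + 1) div 2) = int N + 1" using assms by (auto elim: oddE)
  then have "2 * (int ((N + 1) div 2) * x) - x = int N * x"
    by (metis add_diff_cancel_right' distrib_right mult.assoc mult_1)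
  then show ?thesis by simp
qed

lemma odd_dvd_double: "odd N \<Longrightarrow> int N dvd 2 * x \<longleftrightarrow> int N dvd x"
  by (simp add: coprime_dvd_mult_right_iff)

lemma mod_eq_int_less: "int N dvd a - b \<Longrightarrow> a \<in> {0..<int N} \<Longrightarrow> b \<in> {0..<int N} \<Longrightarrow> a = b"
  by (metis atLeastLessThan_iff mod_eq_dvd_iff mod_pos_pos_trivial)

lemma balanced_countable:
  assumes "finite (edges D)"
  shows "countable (balanced D)"
proof -
  have "inj_on (\<lambda>k. restrict k (edges D)) (balanced D)"
  proof (rule inj_onI)
    fix k l assume kl: "k \<in> balanced D" "l \<in> balanced D" "restrict k (edges D) = restrict l (edges D)"
    have "restrict k (edges D) x = restrict l (edges D) x" for x by (simp only: kl(3))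
    then have "k x = l x" if "x \<in> edges D" for x using that by (metis restrict_apply')
    moreover have "k x = l x" if "x \<notin> edges D" for x using that kl(1,2) by (simp add: balanced_def)
    ultimately show "k = l" by blast
  qed
  moreover have "countable ((\<lambda>k. restrict k (edges D)) ` balanced D)"
    by (rule countable_subset[OF _ countable_PiE[OF assms, of "\<lambda>_. UNIV"]]) auto
  ultimately show ?thesis by (simp add: countable_image_inj_eq)
qed

lemma double_balanced: "(\<forall>x. x \<notin> edges D \<longrightarrow> u x = 0) \<Longrightarrow> (\<lambda>x. 2 * u x) \<in> balanced D"
  by (simp add: balanced_def)

lemma balanced_lattice:
  assumes fin: "finite (faces D)" and N: "odd N" and root: "root_of_unity_of_order N \<omega>"
  shows "alternating_lattice (balanced D) (form D) N \<omega> (exponents_mod D N) (residue_reps D N)"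
proof
  have finE: "finite (edges D)" using fin by (simp add: edges_def finite_sides)
  then show "countable (balanced D)" by (rule balanced_countable)
  have Npos: "N > 0" using N by (auto intro: odd_pos)
  show "0 \<in> balanced D" "0 \<in> exponents_mod D N" by (simp_all add: balanced_def exponents_mod_def)
  show add: "k + l \<in> balanced D" if "k \<in> balanced D" "l \<in> balanced D" for k l
    using that by (auto simp: balanced_sides)
  show neg: "- k \<in> balanced D" if "k \<in> balanced D" for k
  proof -
    have "- a + - b + - c = - (a + b + c)" for a b c :: int by simp
    then show ?thesis using that unfolding balanced_def by (auto simp only: uminus_apply mem_Collect_eq even_minus neg_equal_0_iff_equal)
  qed
  show "form D (k + l) m = form D k m + form D l m" for k l m by (rule form_add)
  show "form D k l = - form D l k" for k l by (rule form_skew)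
  show "exponents_mod D N \<subseteq> balanced D" by (auto simp: exponents_mod_def)
  show "k + l \<in> exponents_mod D N" if "k \<in> exponents_mod D N" "l \<in> exponents_mod D N" for k l
    using that add by (auto simp: exponents_mod_def)
  show "- k \<in> exponents_mod D N" if "k \<in> exponents_mod D N" for k
    using that neg by (auto simp: exponents_mod_def)
  show "int N dvd form D m k" if "m \<in> exponents_mod D N" for m k
    using that unfolding form_def exponents_mod_def by (intro dvd_sum dvd_mult2) auto
  show "finite (residue_reps D N)"
    unfolding residue_reps_def residue_box_def
    by (intro finite_imageI card_functions_default(2)[OF finE]) simp
  show "residue_reps D N \<subseteq> balanced D"
    by (auto simp: residue_reps_def residue_box_def intro!: double_balanced)
  fix k assume k: "k \<in> balanced D"
  \<comment> \<open>\<open>u\<close> is half of \<open>k\<close> modulo \<open>N\<close>, so that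
    the doubled function is congruent to \<open>k\<close> and balanced for trivial reasons.\<close>
  define u where "u x = (int ((N + 1) div 2) * k x) mod int N" for x
  have "u \<in> residue_box D N"
    using Npos k by (auto simp: residue_box_def u_def balanced_def)
  then have r: "(\<lambda>x. 2 * u x) \<in> residue_reps D N" by (auto simp: residue_reps_def)
  have "int N dvd k x - 2 * u x" for x
  proof -
    have "k x - 2 * u x = - (2 * (int ((N + 1) div 2) * k x) - k x) +
        2 * (int ((N + 1) div 2) * k x - u x)" by simp
    moreover have "int N dvd int ((N + 1) div 2) * k x - u x" by (simp add: u_def minus_mod_eq_mult_div)
    ultimately show ?thesis using odd_inverse_2[OF N, of "k x"] by (metis dvd_add dvd_minus_iff dvd_mult)
  qed
  moreover have "k - (\<lambda>x. 2 * u x) \<in> balanced D"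
    using add[OF k neg[OF double_balanced[of D u]]] \<open>u \<in> _\<close> by (simp add: residue_box_def)
  ultimately have m: "k - (\<lambda>x. 2 * u x) \<in> exponents_mod D N" by (simp add: exponents_mod_def)
  show "\<exists>!r. r \<in> residue_reps D N \<and> k - r \<in> exponents_mod D N"
  proof (rule ex1I[of _ "\<lambda>x. 2 * u x"])
    fix r assume r: "r \<in> residue_reps D N \<and> k - r \<in> exponents_mod D N"
    then obtain v where v: "r = (\<lambda>x. 2 * v x)" "v \<in> residue_box D N" by (auto simp: residue_reps_def)
    have "v x = u x" for x
    proof (cases "x \<in> edges D")
      case True
      have "int N dvd k x - 2 * u x" "int N dvd k x - 2 * v x"
        using r m v(1) by (auto simp: exponents_mod_def)
      then have "int N dvd (k x - 2 * u x) - (k x - 2 * v x)" by (rule dvd_diff)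
      then have "int N dvd 2 * (v x - u x)" by (simp add: algebra_simps)
      then have "int N dvd v x - u x" using odd_dvd_double[OF N] by blast
      then show ?thesis
        using True v(2) \<open>u \<in> _\<close> by (intro mod_eq_int_less) (auto simp: residue_box_def)
    next
      case False
      then show ?thesis using v \<open>u \<in> _\<close> by (simp add: residue_box_def)
    qed
    then show "r = (\<lambda>x. 2 * u x)" using v by auto
  qed (use r m in blast)
qed (use N root in auto)

lemma card_residue_reps:
  assumes "finite (faces D)"
  shows "card (residue_reps D N) = N ^ card (edges D)"
proof -
  have "inj_on (\<lambda>u x. 2 * u x) (residue_box D N)"
    by (rule inj_onI) (auto simp: fun_eq_iff)
  then show ?thesis
    using card_functions_default(1)[of "edges D" "{0..<int N}"] assms
    by (simp add: residue_reps_def card_image residue_box_def edges_def finite_sides)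
qed

text \<open>All that the algebra sees of the triangulation. Fixed points of \<open>g\<close> are
  unglued sides; with the identity for \<open>g\<close> the results apply to disjoint
  triangles.\<close>

locale glued_pattern =
  fixes D :: "('f, 'e) pattern" and g :: "'f \<times> nat \<Rightarrow> 'f \<times> nat"
  assumes finite_faces: "finite (faces D)"
    and g_sides: "s \<in> sides (faces D) \<Longrightarrow> g s \<in> sides (faces D)"
    and g_g: "s \<in> sides (faces D) \<Longrightarrow> g (g s) = s"
    and edge_eq: "s \<in> sides (faces D) \<Longrightarrow> s' \<in> sides (faces D) \<Longrightarrow>
      edge_at D s = edge_at D s' \<longleftrightarrow> s' = s \<or> s' = g s"
begin

abbreviation S where "S \<equiv> sides (faces D)"

lemmas S_simps = nxt_sides[where F = "faces D"] prv_sides[where F = "faces D"]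
  nxt_prv[where F = "faces D"] prv_nxt[where F = "faces D"] nxt_nxt[where F = "faces D"]
  prv_prv[where F = "faces D"] g_sides g_g

lemma finite_S: "finite S"
  by (rule finite_sides[OF finite_faces])

lemma finite_edges: "finite (edges D)"
  using finite_S by (simp add: edges_def)

lemma edge_g: "s \<in> S \<Longrightarrow> edge_at D (g s) = edge_at D s"
  using edge_eq[of s "g s"] g_sides by simp

lemma edge_in: "s \<in> S \<Longrightarrow> edge_at D s \<in> edges D"
  by (simp add: edges_def)

lemma sum_g: "(\<Sum>s\<in>S. f (g s)) = (\<Sum>s\<in>S. f s)"
  by (rule sum.reindex_bij_witness[where i = g and j = g]) (auto simp: g_g g_sides)

text \<open>Rotation about the start of a side, continued along the boundary at an unglued side: the
  orbits of \<open>turn\<close> are the inner punctures and the boundary components.\<close>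

definition turn :: "'f \<times> nat \<Rightarrow> 'f \<times> nat" where
  "turn s = (if s \<in> S then nxt (g s) else s)"

lemma turn_permutes: "turn permutes S"
proof (rule bij_imp_permutes)
  show "bij_betw turn S S"
    by (rule bij_betw_byWitness[where f' = "\<lambda>s. g (prv s)"])
      (auto simp: turn_def S_simps)
qed (simp add: turn_def)

lemma turn_permutation: "permutation turn"
  using turn_permutes finite_S permutation_permutes by blast

abbreviation orb where "orb s \<equiv> orbit turn s"

definition orbs :: "('f \<times> nat) set set" where
  "orbs = orb ` S"

lemma finite_orbs: "finite orbs"
  using finite_S by (simp add: orbs_def)

lemma self_orb: "s \<in> orb s"
  by (rule permutation_self_in_orbit[OF turn_permutation])

lemma orb_eq: "s' \<in> orb s \<Longrightarrow> orb s' = orb s"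
  using orbit_cyclic_eq3[OF cyclic_on_orbit'[OF turn_permutation]] .

lemma orb_turn: "s \<in> S \<Longrightarrow> orb (nxt (g s)) = orb s"
  using permutation_orbit_step[OF turn_permutation, of s] by (simp add: turn_def)

text \<open>The side \<open>nxt s\<close> starts where \<open>s\<close> ends, and so does
  \<open>g s\<close>, whose direction is opposite. Thus \<open>orb (g s)\<close> stands for the end
  point of \<open>s\<close>.\<close>

lemma orb_nxt: "s \<in> S \<Longrightarrow> orb (nxt s) = orb (g s)"
  using orb_turn[of "g s"] g_sides g_g by simp

lemma orbs_mem: "C \<in> orbs \<Longrightarrow> s \<in> C \<longleftrightarrow> s \<in> S \<and> orb s = C"
  using orb_eq self_orb permutes_orbit_subset[OF turn_permutes] unfolding orbs_def by blast

lemma orb_in: "s \<in> S \<Longrightarrow> orb s \<in> orbs"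
  by (simp add: orbs_def)

text \<open>\<open>spread a\<close> is the exponent \<open>\<Sum>\<^sub>p a\<^sub>p k\<^sub>p\<close> for a function \<open>a\<close> on the set of orbits.\<close>

definition side_of :: "'e \<Rightarrow> 'f \<times> nat" where
  "side_of x = (SOME s. s \<in> S \<and> edge_at D s = x)"

definition spread :: "(('f \<times> nat) set \<Rightarrow> int) \<Rightarrow> 'e \<Rightarrow> int" where
  "spread a x = (if x \<in> edges D then a (orb (side_of x)) + a (orb (g (side_of x))) else 0)"

lemma side_of:
  assumes "x \<in> edges D"
  shows "side_of x \<in> S" "edge_at D (side_of x) = x"
proof -
  have "\<exists>s. s \<in> S \<and> edge_at D s = x" using assms by (auto simp: edges_def)
  from someI_ex[OF this] show "side_of x \<in> S" "edge_at D (side_of x) = x"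
    by (simp_all add: side_of_def)
qed

lemma spread_edge:
  assumes "s \<in> S"
  shows "spread a (edge_at D s) = a (orb s) + a (orb (g s))"
proof -
  let ?t = "side_of (edge_at D s)"
  have "?t \<in> S" "edge_at D ?t = edge_at D s"
    using side_of edge_in[OF assms] by auto
  then have "?t = s \<or> ?t = g s" using edge_eq[of s ?t] assms by auto
  then show ?thesis using assms edge_in[OF assms] by (auto simp: spread_def g_g)
qed

lemma spread_nxt: "s \<in> S \<Longrightarrow> spread a (edge_at D s) = a (orb s) + a (orb (nxt s))"
  by (simp add: spread_edge orb_nxt)

lemma spread_outside: "x \<notin> edges D \<Longrightarrow> spread a x = 0"
  by (simp add: spread_def)

lemma spread_balanced: "spread a \<in> balanced D"
  unfolding balanced_sides
proof (intro conjI ballI allI impI)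
  fix s assume s: "s \<in> S"
  have "spread a (edge_at D (prv s)) + spread a (edge_at D s) + spread a (edge_at D (nxt s)) =
      2 * (a (orb s) + a (orb (nxt s)) + a (orb (prv s)))"
    using s by (simp add: spread_nxt S_simps)
  then show "even (spread a (edge_at D (prv s)) + spread a (edge_at D s) + spread a (edge_at D (nxt s)))"
    by simp
qed (rule spread_outside)

lemma spread_add: "spread (\<lambda>C. a C + b C) = spread a + spread b"
  by (rule ext) (simp add: spread_def)

lemma spread_cong:
  assumes "\<And>C. C \<in> orbs \<Longrightarrow> a C = b C"
  shows "spread a = spread b"
  using assms side_of by (auto simp: spread_def orbs_def g_sides intro!: ext)

text \<open>The coefficient of \<open>l\<close> at the side \<open>s\<close> in
  \<open>form_sides'\<close>.\<close>

definition defect :: "('e \<Rightarrow> int) \<Rightarrow> 'f \<times> nat \<Rightarrow> int" where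
  "defect k s = k (edge_at D (prv s)) - k (edge_at D (nxt s))"

text \<open>A sum over sides meets a glued edge twice and an unglued one once. Doubling and
  symmetrising under \<open>g\<close> treats both kinds uniformly.\<close>

lemma double_form:
  "2 * form D k l = (\<Sum>s\<in>S. l (edge_at D s) * (defect k s + defect k (g s)))"
proof -
  have "form D k l = (\<Sum>s\<in>S. l (edge_at D s) * defect k s)"
    unfolding form_sides'[OF finite_faces] defect_def ..
  moreover have "\<dots> = (\<Sum>s\<in>S. l (edge_at D (g s)) * defect k (g s))"
    by (rule sum_g[symmetric])
  moreover have "\<dots> = (\<Sum>s\<in>S. l (edge_at D s) * defect k (g s))"
    by (intro sum.cong refl) (simp add: edge_g)
  ultimately have "2 * form D k l = (\<Sum>s\<in>S. l (edge_at D s) * defect k s) + (\<Sum>s\<in>S. l (edge_at D s) * defect k (g s))"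
    by simp
  then show ?thesis by (simp add: sum.distrib distrib_left)
qed

text \<open>In a face the values at the opposite corner cancel, leaving the value at the start minus
  the value at the end; passing to \<open>g s\<close> exchanges the two. At an unglued side both
  ends lie in one orbit and the difference is zero.\<close>

lemma defect_spread:
  assumes "s \<in> S"
  shows "defect (spread a) s + defect (spread a) (g s) = 0"
proof -
  have "defect (spread a) s = a (orb s) - a (orb (g s))" if "s \<in> S" for s
    using that orb_nxt[OF that] by (simp add: defect_def spread_nxt S_simps)
  then show ?thesis using assms by (simp add: g_sides g_g)
qed

lemma form_spread: "form D (spread a) l = 0"
  using double_form[of "spread a" l] by (simp add: defect_spread)

end

section \<open>Solving for the radical corner by corner\<close>

locale glued_pattern_mod = glued_pattern D g for D :: "('f, 'e) pattern" and g +
  fixes N :: nat and \<omega> :: complex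
  assumes odd_N: "odd N" and root: "root_of_unity_of_order N \<omega>"
begin

sublocale L: alternating_lattice "balanced D" "form D" N \<omega> "exponents_mod D N" "residue_reps D N"
  by (rule balanced_lattice[OF finite_faces odd_N root])

lemma N_pos: "N > 0"
  using odd_N by (auto intro: odd_pos)

lemma spread_radical: "spread a \<in> L.radical"
  by (simp add: L.radical_def spread_balanced form_spread)

lemma radical_defect:
  assumes "k \<in> L.radical" "s \<in> S"
  shows "int N dvd defect k s + defect k (g s)"
proof -
  \<comment> \<open>Pairing with a single edge isolates its coefficient; the value 2 makes this
    exponent balanced.\<close>
  define l where "l x = (if x = edge_at D s then 2 else 0 :: int)" for x
  have "l \<in> balanced D"
    using edge_in[OF assms(2)] by (auto simp: l_def balanced_def)
  then have "int N dvd 2 * form D k l" using assms(1) by (simp add: L.radical_def)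
  also have "2 * form D k l = (\<Sum>t\<in>S. if t = s \<or> t = g s then 2 * (defect k s + defect k (g s)) else 0)"
    unfolding double_form
  proof (intro sum.cong refl)
    fix t assume t: "t \<in> S"
    then show "l (edge_at D t) * (defect k t + defect k (g t)) =
        (if t = s \<or> t = g s then 2 * (defect k s + defect k (g s)) else 0)"
      using edge_eq[OF assms(2) t] assms(2) g_g by (auto simp: l_def)
  qed
  also have "\<dots> = (\<Sum>t\<in>{s, g s}. 2 * (defect k s + defect k (g s)))"
    using finite_S assms(2) g_sides by (intro sum.mono_neutral_cong_right) auto
  \<comment> \<open>An unglued side contributes the factor 2 and a glued one the factor 4; both are
    invertible modulo \<open>N\<close>.\<close>
  also have "\<dots> = (if g s = s then 2 * (defect k s + defect k (g s)) else 2 * (2 * (defect k s + defect k (g s))))"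
    by simp
  finally show ?thesis
    by (cases "g s = s") (simp_all only: if_True if_False odd_dvd_double[OF odd_N] refl)
qed

text \<open>The equations \<open>k = spread a\<close> on the three sides of a face determine the
  values of \<open>a\<close> at its corners: twice the value at the start of \<open>s\<close> is
  \<open>k\<close> at \<open>s\<close> plus \<open>k\<close> at \<open>prv s\<close> minus
  \<open>k\<close> at \<open>nxt s\<close>.\<close>

definition orbit_residue :: "('e \<Rightarrow> int) \<Rightarrow> ('f \<times> nat) \<Rightarrow> int" where
  "orbit_residue k s = (int ((N + 1) div 2) *
     (k (edge_at D s) + k (edge_at D (prv s)) - k (edge_at D (nxt s)))) mod int N"

lemma orbit_residue_double:
  "int N dvd 2 * orbit_residue k s - (k (edge_at D s) + k (edge_at D (prv s)) - k (edge_at D (nxt s)))"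
proof -
  let ?x = "k (edge_at D s) + k (edge_at D (prv s)) - k (edge_at D (nxt s))"
  have "2 * orbit_residue k s - ?x = (2 * (int ((N + 1) div 2) * ?x) - ?x) -
      2 * (int ((N + 1) div 2) * ?x - orbit_residue k s)"
    by simp
  moreover have "int N dvd int ((N + 1) div 2) * ?x - orbit_residue k s"
    unfolding orbit_residue_def by (simp add: minus_mod_eq_mult_div)
  ultimately show ?thesis using odd_inverse_2[OF odd_N, of ?x] by (metis dvd_diff dvd_mult)
qed

lemma orbit_residue_range: "orbit_residue k s \<in> {0..<int N}"
  using N_pos by (simp add: orbit_residue_def)

lemma orbit_residue_eqI:
  assumes "int N dvd 2 * orbit_residue k s - 2 * b" "b \<in> {0..<int N}"
  shows "orbit_residue k s = b"
proof -
  have "int N dvd 2 * (orbit_residue k s - b)" using assms(1) by (simp add: algebra_simps)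
  then show ?thesis
    using odd_dvd_double[OF odd_N] orbit_residue_range assms(2) mod_eq_int_less by blast
qed

text \<open>The vanishing of the total defect along an edge says exactly that the solutions found in
  the two adjacent faces agree at its ends.\<close>

lemma orbit_residue_turn:
  assumes k: "k \<in> L.radical" and s: "s \<in> S"
  shows "orbit_residue k (nxt (g s)) = orbit_residue k s"
proof (rule orbit_residue_eqI[OF _ orbit_residue_range])
  let ?e = "edge_at D"
  have gs: "g s \<in> S" using s g_sides by simp
  have 1: "int N dvd 2 * orbit_residue k (nxt (g s)) - (k (?e s) + k (?e (nxt (g s))) - k (?e (prv (g s))))"
    using orbit_residue_double[of k "nxt (g s)"] gs
    by (simp add: prv_nxt nxt_nxt edge_g[OF s] algebra_simps)
  have 2: "int N dvd 2 * orbit_residue k s - (k (?e s) + k (?e (prv s)) - k (?e (nxt s)))"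
    by (rule orbit_residue_double)
  have 3: "int N dvd defect k s + defect k (g s)" by (rule radical_defect[OF k s])
  have "2 * orbit_residue k (nxt (g s)) - 2 * orbit_residue k s =
      (2 * orbit_residue k (nxt (g s)) - (k (?e s) + k (?e (nxt (g s))) - k (?e (prv (g s))))) -
      (2 * orbit_residue k s - (k (?e s) + k (?e (prv s)) - k (?e (nxt s)))) -
      (defect k s + defect k (g s))"
    by (simp add: defect_def)
  then show "int N dvd 2 * orbit_residue k (nxt (g s)) - 2 * orbit_residue k s"
    using 1 2 3 by (metis dvd_diff)
qed

lemma orbit_residue_orb:
  assumes "k \<in> L.radical" "s \<in> S" "t \<in> orb s"
  shows "orbit_residue k t = orbit_residue k s"
proof -
  have "t \<in> S \<and> orbit_residue k t = orbit_residue k s"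
    using assms(3)
  proof induction
    case base
    then show ?case using assms by (simp add: turn_def S_simps orbit_residue_turn)
  next
    case (step t)
    then show ?case using assms by (simp add: turn_def S_simps orbit_residue_turn)
  qed
  then show ?thesis by simp
qed

text \<open>The solution \<open>a\<close> of \<open>k = spread a\<close> modulo \<open>N\<close>.\<close>

definition coords :: "('e \<Rightarrow> int) \<Rightarrow> ('f \<times> nat) set \<Rightarrow> int" where
  "coords k C = orbit_residue k (SOME s. s \<in> C)"

lemma coords_orb:
  assumes "k \<in> L.radical" "s \<in> S"
  shows "coords k (orb s) = orbit_residue k s"
  unfolding coords_def using assms self_orb[of s]
  by (intro orbit_residue_orb someI[of "\<lambda>t. t \<in> orb s"])

lemma coords_range: "coords k C \<in> {0..<int N}"
  unfolding coords_def by (rule orbit_residue_range)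

lemma coords_spread:
  assumes k: "k \<in> L.radical"
  shows "k - spread (coords k) \<in> exponents_mod D N"
proof -
  have "k - spread (coords k) \<in> balanced D"
    using L.K_diff k L.radical_K spread_balanced by blast
  moreover have "int N dvd (k - spread (coords k)) x" for x
  proof (cases "x \<in> edges D")
    case True
    then obtain s where s: "s \<in> S" "x = edge_at D s" by (auto simp: edges_def)
    let ?e = "edge_at D" and ?r = "orbit_residue k"
    have eq: "spread (coords k) x = ?r s + ?r (nxt s)"
      using s by (simp add: spread_nxt coords_orb[OF k] S_simps)
    have 1: "int N dvd 2 * ?r s - (k (?e s) + k (?e (prv s)) - k (?e (nxt s)))"
      by (rule orbit_residue_double)
    have 2: "int N dvd 2 * ?r (nxt s) - (k (?e (nxt s)) + k (?e s) - k (?e (prv s)))"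
      using orbit_residue_double[of k "nxt s"] s by (simp add: prv_nxt nxt_nxt)
    \<comment> \<open>The corner equations at the two ends of the edge are added; the contributions
      of the other two sides cancel.\<close>
    have "2 * (k x - spread (coords k) x) =
        - ((2 * ?r s - (k (?e s) + k (?e (prv s)) - k (?e (nxt s)))) +
          (2 * ?r (nxt s) - (k (?e (nxt s)) + k (?e s) - k (?e (prv s)))))"
      unfolding eq unfolding s(2) by (simp add: algebra_simps)
    then have "int N dvd 2 * (k x - spread (coords k) x)"
      using 1 2 by (metis dvd_add dvd_minus_iff)
    then show ?thesis using odd_dvd_double[OF odd_N] unfolding minus_apply by blast
  next
    case False
    moreover have "k x = 0" using False L.radical_K[OF k] by (simp add: balanced_def)
    ultimately show ?thesis by (simp add: spread_outside)
  qed
  ultimately show ?thesis by (simp add: exponents_mod_def)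
qed

lemma coords_unique:
  assumes k: "k \<in> L.radical" "k - spread a \<in> exponents_mod D N" and C: "C \<in> orbs" "a C \<in> {0..<int N}"
  shows "coords k C = a C"
proof -
  obtain s where s: "s \<in> S" "C = orb s" using C by (auto simp: orbs_def)
  let ?e = "edge_at D" and ?d = "\<lambda>x. k x - spread a x"
  have d: "int N dvd ?d x" for x using k(2) by (simp add: exponents_mod_def)
  have "2 * orbit_residue k s - 2 * a (orb s) =
      2 * orbit_residue k s - (k (?e s) + k (?e (prv s)) - k (?e (nxt s))) +
      (?d (?e s) + ?d (?e (prv s)) - ?d (?e (nxt s)))"
    using s by (simp add: spread_nxt S_simps)
  then have "int N dvd 2 * orbit_residue k s - 2 * a (orb s)"
    using d orbit_residue_double by (metis dvd_add dvd_diff)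
  then have "orbit_residue k s = a (orb s)"
    using orbit_residue_eqI C s by blast
  then show ?thesis using coords_orb[OF k(1) s(1)] s by simp
qed

lemma card_radical: "card (residue_reps D N \<inter> L.radical) = N ^ card orbs"
proof -
  let ?X = "residue_reps D N \<inter> L.radical"
  have "bij_betw (\<lambda>r. restrict (coords r) orbs) ?X (orbs \<rightarrow>\<^sub>E {0..<int N})"
    unfolding bij_betw_def
  proof
    show "inj_on (\<lambda>r. restrict (coords r) orbs) ?X"
    proof (rule inj_onI)
      fix r r' assume r: "r \<in> ?X" "r' \<in> ?X" "restrict (coords r) orbs = restrict (coords r') orbs"
      have "spread (coords r) = spread (coords r')"
        using r(3) by (intro spread_cong) (metis restrict_apply')
      then have "r - spread (coords r') \<in> exponents_mod D N" "r' - spread (coords r') \<in> exponents_mod D N"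
        using coords_spread r by (metis Int_iff)+
      then have "r - spread (coords r') + - (r' - spread (coords r')) \<in> exponents_mod D N"
        using L.M_add L.M_minus by blast
      then have "r - r' \<in> exponents_mod D N" by simp
      moreover have "r - r \<in> exponents_mod D N" using L.M_0 by simp
      ultimately show "r = r'" using L.R(3)[of r] L.R(2) r by blast
    qed
    show "(\<lambda>r. restrict (coords r) orbs) ` ?X = orbs \<rightarrow>\<^sub>E {0..<int N}"
    proof (intro subset_antisym subsetI)
      fix a assume a: "a \<in> orbs \<rightarrow>\<^sub>E {0..<int N}"
      obtain r where r: "r \<in> residue_reps D N" "spread a - r \<in> exponents_mod D N"
        using L.R(3)[OF spread_balanced[of a]] by blast
      have "- (spread a - r) \<in> exponents_mod D N" using r L.M_minus by blast
      then have m: "r - spread a \<in> exponents_mod D N" by simp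
      have "r \<in> L.radical"
        unfolding L.radical_def
      proof (intro CollectI conjI ballI)
        show "r \<in> balanced D" using r L.R(2) by auto
        fix l assume l: "l \<in> balanced D"
        have "form D r l = form D (spread a + (r - spread a)) l" by simp
        also have "\<dots> = form D (r - spread a) l" unfolding form_add form_spread by simp
        finally show "int N dvd form D r l" using L.M_radical[OF m l] by simp
      qed
      moreover have "a = restrict (coords r) orbs"
      proof
        fix C show "a C = restrict (coords r) orbs C"
          using coords_unique[OF \<open>r \<in> L.radical\<close> m, of C] a
          by (cases "C \<in> orbs") (auto simp: PiE_def extensional_def Pi_iff)
      qed
      ultimately show "a \<in> (\<lambda>r. restrict (coords r) orbs) ` ?X" using r by blast
    qed (use coords_range in auto)
  qed
  from bij_betw_same_card[OF this] show ?thesis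
    using card_PiE[OF finite_orbs, of "\<lambda>_. {0..<int N}"] by simp
qed

end

context glued_pattern
begin

lemma card_image_cong:
  assumes "\<And>s t. s \<in> A \<Longrightarrow> t \<in> A \<Longrightarrow> f s = f t \<longleftrightarrow> h s = h t"
  shows "card (f ` A) = card (h ` A)"
proof -
  have "bij_betw (\<lambda>y. h (SOME s. s \<in> A \<and> f s = y)) (f ` A) (h ` A)"
  proof -
    have *: "h (SOME s. s \<in> A \<and> f s = f t) = h t" if "t \<in> A" for t
    proof -
      have "(SOME s. s \<in> A \<and> f s = f t) \<in> A \<and> f (SOME s. s \<in> A \<and> f s = f t) = f t"
        using that by (intro someI[of "\<lambda>s. s \<in> A \<and> f s = f t" t]) simp
      then show ?thesis using assms that by blast
    qed
    show ?thesis
      unfolding bij_betw_def inj_on_def image_image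
      using * assms by (auto simp: image_iff)
  qed
  then show ?thesis by (rule bij_betw_same_card)
qed

text \<open>\<open>turn\<close> is the gluing involution followed by a rotation of order 3. The
  rotation is even, so \<open>turn\<close> and the involution have the same sign; their numbers of
  cycles are those of orbits and of edges.\<close>

theorem even_edges_orbs: "even (card (edges D) + card orbs)"
proof -
  define g' where "g' s = (if s \<in> S then g s else s)" for s
  define n' where "n' s = (if s \<in> S then nxt s else s)" for s
  have g': "g' permutes S"
    by (rule bij_imp_permutes)
      (auto simp: g'_def g_sides g_g intro!: bij_betw_byWitness[where f' = g'])
  have n': "n' permutes S"
    by (rule bij_imp_permutes)
      (auto simp: n'_def S_simps intro!: bij_betw_byWitness[where f' = prv])
  have perm: "permutation g'" "permutation n'"
    using g' n' finite_S permutation_permutes by blast+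
  have "n' \<circ> (n' \<circ> n') = id"
    by (rule ext) (auto simp: n'_def S_simps)
  moreover have "evenperm (n' \<circ> (n' \<circ> n')) \<longleftrightarrow> evenperm n'"
    using perm by (simp add: evenperm_comp permutation_compose)
  ultimately have "evenperm n'" by (simp add: evenperm_id)
  moreover have "turn = n' \<circ> g'"
    by (rule ext) (simp add: turn_def n'_def g'_def g_sides)
  ultimately have "evenperm turn \<longleftrightarrow> evenperm g'"
    using perm by (simp add: evenperm_comp)
  moreover have "card (orbit g' ` S) = card (edges D)"
    unfolding edges_def
  proof (rule card_image_cong)
    fix s t assume st: "s \<in> S" "t \<in> S"
    have orb: "orbit g' s = {s, g s}" if "s \<in> S" for s
    proof -
      have "(g' ^^ 2) s = s" using that by (simp add: g'_def g_sides g_g numeral_2_eq_2)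
      then have "orbit g' s = {(g' ^^ m) s |m. m < 2}" by (rule orbit_altdef_bounded) simp
      also have "{(g' ^^ m) s |m. m < 2} = (\<lambda>m. (g' ^^ m) s) ` {..<2}" by auto
      also have "{..<2::nat} = {0, 1}" by auto
      finally have "orbit g' s = {s, g' s}" by simp
      moreover have "g' s = g s" using that by (simp add: g'_def)
      ultimately show ?thesis by simp
    qed
    show "orbit g' s = orbit g' t \<longleftrightarrow> edge_at D s = edge_at D t"
      using st g_g[OF st(1)] g_g[OF st(2)] unfolding orb[OF st(1)] orb[OF st(2)] edge_eq[OF st] doubleton_eq_iff
      by metis
  qed
  moreover have "evenperm turn \<longleftrightarrow> even (card S + card orbs)"
    unfolding orbs_def by (rule evenperm_iff_even_orbits[OF finite_S turn_permutes])
  moreover have "evenperm g' \<longleftrightarrow> even (card S + card (orbit g' ` S))"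
    by (rule evenperm_iff_even_orbits[OF finite_S g'])
  ultimately show ?thesis by auto
qed

end

section \<open>Eigenspaces of the central elements\<close>

text \<open>Division by the odd number \<open>N\<close> preserves parity. So the elements of
  \<open>M\<close> are exactly the exponents on which the classical shadow prescribes the
  scalar.\<close>

lemma exponents_mod_divide:
  assumes "m \<in> exponents_mod D N" "odd N"
  shows "\<exists>k\<in>balanced D. m = (\<lambda>x. int N * k x)"
proof -
  define k where "k x = m x div int N" for x
  have m: "m x = int N * k x" for x using assms(1) by (simp add: exponents_mod_def k_def)
  have Npos: "N > 0" using assms(2) by (auto intro: odd_pos)
  have "k \<in> balanced D"
    unfolding balanced_def
  proof (intro CollectI conjI allI impI ballI)
    fix x assume "x \<notin> edges D"
    then have "m x = 0" using assms(1) by (simp add: exponents_mod_def balanced_def)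
    then show "k x = 0" by (simp add: k_def)
  next
    fix T assume "T \<in> faces D"
    then have "even (m (edge_at D (T, 0)) + m (edge_at D (T, 1)) + m (edge_at D (T, 2)))"
      using assms(1) by (simp add: exponents_mod_def balanced_def)
    then have "even (int N * (k (edge_at D (T, 0)) + k (edge_at D (T, 1)) + k (edge_at D (T, 2))))"
      unfolding m by (simp only: distrib_left)
    then show "even (k (edge_at D (T, 0)) + k (edge_at D (T, 1)) + k (edge_at D (T, 2)))"
      using assms(2) by simp
  qed
  then show ?thesis using m by blast
qed

lemma multiple_balanced:
  assumes "k \<in> balanced D"
  shows "(\<lambda>x. c * k x) \<in> balanced D"
proof -
  have "even (c * a + c * b + c * d)" if "even (a + b + d)" for a b d :: int
    using that by (metis distrib_left dvd_mult)
  then show ?thesis using assms by (simp add: balanced_def)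
qed

lemma form_self: "form D k k = 0"
  using form_skew[of D k k] by simp

lemma form_multiple: "form D (\<lambda>x. c * k x) l = c * form D k l"
  by (simp add: form_def sum_distrib_left mult.assoc)

context glued_pattern
begin

text \<open>The exponent of \<open>H\<^sub>p\<close> or \<open>H\<^sub>\<partial>\<close> for the
  puncture or boundary component belonging to the orbit \<open>C\<close>; the identification is
  \<open>endpoint_element_loop\<close>.\<close>

definition loop_exponent :: "('f \<times> nat) set \<Rightarrow> 'e \<Rightarrow> int" where
  "loop_exponent C = spread (\<lambda>C'. of_bool (C' = C))"

lemma loop_balanced: "loop_exponent C \<in> balanced D"
  unfolding loop_exponent_def by (rule spread_balanced)

lemma spread_multiple: "spread (\<lambda>C'. if C' = C then c else 0) = (\<lambda>x. c * loop_exponent C x)"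
  unfolding loop_exponent_def by (rule ext) (simp add: spread_def)

text \<open>Every edge has two ends, so the product of all the loop elements is the element that
  defines the central charge.\<close>

lemma spread_1: "spread (\<lambda>_. 1) = (\<lambda>x. if x \<in> edges D then 2 else 0)"
  by (rule ext) (simp add: spread_def)

end

locale pattern_module = glued_pattern_mod D g N \<omega> +
  twisted_module "balanced D" "form D" N \<omega> "exponents_mod D N" "residue_reps D N" sv V T
  for D :: "('f, 'e) pattern" and g N \<omega>
    and sv :: "complex \<Rightarrow> 'v::ab_group_add \<Rightarrow> 'v" and V T
begin

lemma T_pow:
  assumes "k \<in> balanced D" "v \<in> V"
  shows "(T k ^^ n) v = T (\<lambda>x. int n * k x) v"
proof (induction n)
  case 0
  have "(\<lambda>x. int 0 * k x) = 0" by auto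
  then show ?case using T_0[OF assms(2)] by simp
next
  case (Suc n)
  have "form D k (\<lambda>x. int n * k x) = 0"
    using form_skew[of D k "\<lambda>x. int n * k x"] form_multiple[of D "int n" k k] form_self[of D k]
    by simp
  moreover have "k + (\<lambda>x. int n * k x) = (\<lambda>x. int (Suc n) * k x)"
    by (auto simp: distrib_right)
  ultimately show ?case
    using Suc T_T[OF assms(1) multiple_balanced[OF assms(1)] assms(2), of "int n"] by simp
qed

lemma loop_radical: "loop_exponent C \<in> L.radical"
  unfolding loop_exponent_def by (rule spread_radical)

definition eigen :: "(('f \<times> nat) set \<Rightarrow> complex) \<Rightarrow> 'v set" where
  "eigen h = {v\<in>V. \<forall>C\<in>orbs. T (loop_exponent C) v = sv (h C) v}"

definition eigen_on :: "('f \<times> nat) set set \<Rightarrow> (('f \<times> nat) set \<Rightarrow> complex) \<Rightarrow> 'v set" where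
  "eigen_on A h = {v\<in>V. \<forall>C\<in>A. T (loop_exponent C) v = sv (h C) v}"

lemma eigen_on_orbs: "eigen_on orbs h = eigen h"
  by (simp add: eigen_on_def eigen_def)

lemma eigen_on_invariant: "invariant (eigen_on A h)"
  unfolding invariant_def
proof (intro conjI ballI)
  show "subspace (eigen_on A h)"
    using V T_add[OF loop_balanced] T_scale[OF loop_balanced] T_zero[OF loop_balanced]
    by (auto simp: subspace_def eigen_on_def scale_right_distrib mult.commute)
  show "eigen_on A h \<subseteq> V" by (auto simp: eigen_on_def)
  fix k u assume k: "k \<in> balanced D" and u: "u \<in> eigen_on A h"
  then have "T (loop_exponent C) (T k u) = sv (h C) (T k u)" if "C \<in> A" for C
    using that T_radical_comm[OF loop_radical k, of u C] T_scale[OF k, of u]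
    by (simp add: eigen_on_def)
  then show "T k u \<in> eigen_on A h" using k u T_V by (auto simp: eigen_on_def)
qed

lemma eigen_invariant: "invariant (eigen h)"
  using eigen_on_invariant[of orbs h] by (simp add: eigen_on_orbs)

lemma T_spread_add:
  "v \<in> V \<Longrightarrow> T (spread (\<lambda>C. a C + b C)) v = T (spread a) (T (spread b) v)"
  using T_T[OF spread_balanced spread_balanced, of v a b] by (simp add: form_spread spread_add)

text \<open>The form vanishes on spread exponents, so loop elements multiply without a phase.
  Nonnegative \<open>a\<close> allows natural powers and is all that \<open>coords\<close>
  produces.\<close>

lemma eigen_spread:
  assumes v: "v \<in> eigen h" and a: "\<And>C. a C \<ge> 0"
  shows "T (spread a) v = sv (\<Prod>C\<in>orbs. h C ^ nat (a C)) v"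
proof -
  have vV: "v \<in> V" using v by (simp add: eigen_def)
  have "T (spread (\<lambda>C. if C \<in> A then a C else 0)) v = sv (\<Prod>C\<in>A. h C ^ nat (a C)) v"
    if "finite A" "A \<subseteq> orbs" for A
    using that
  proof (induction A rule: finite_induct)
    case empty
    have "spread (\<lambda>C. if C \<in> {} then a C else 0) = 0" by (rule ext) (simp add: spread_def)
    then show ?case using T_0[OF vV] by (simp only: prod.empty scale_one)
  next
    case (insert C A)
    have pow: "(T (loop_exponent C) ^^ n) v = sv (h C ^ n) v" for n
      using v insert.prems
      by (induction n) (auto simp: eigen_def T_scale[OF loop_balanced] mult.commute)
    have "spread (\<lambda>C'. if C' \<in> insert C A then a C' else 0) =
        spread (\<lambda>C'. (if C' = C then a C else 0) + (if C' \<in> A then a C' else 0))"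
      using insert.hyps by (intro arg_cong[of _ _ spread] ext) auto
    then have "T (spread (\<lambda>C'. if C' \<in> insert C A then a C' else 0)) v =
        T (spread (\<lambda>C'. if C' = C then a C else 0)) (T (spread (\<lambda>C'. if C' \<in> A then a C' else 0)) v)"
      using T_spread_add[OF vV] by simp
    also have "\<dots> = sv (\<Prod>C\<in>A. h C ^ nat (a C)) (T (spread (\<lambda>C'. if C' = C then a C else 0)) v)"
      using insert by (simp add: T_scale[OF spread_balanced vV])
    also have "T (spread (\<lambda>C'. if C' = C then a C else 0)) v = (T (loop_exponent C) ^^ nat (a C)) v"
      unfolding spread_multiple T_pow[OF loop_balanced vV] using a[of C] by simp
    finally show ?case
      using insert.hyps by (simp add: pow mult.commute)
  qed
  from this[OF finite_orbs] have "T (spread (\<lambda>C. if C \<in> orbs then a C else 0)) v = sv (\<Prod>C\<in>orbs. h C ^ nat (a C)) v"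
    by simp
  moreover have "spread (\<lambda>C. if C \<in> orbs then a C else 0) = spread a"
    by (rule spread_cong) simp
  ultimately show ?thesis by simp
qed

lemma eigen_central:
  assumes "v \<in> eigen h"
  shows "T (\<lambda>x. if x \<in> edges D then 2 else 0) v = sv (\<Prod>C\<in>orbs. h C) v"
  using eigen_spread[OF assms, of "\<lambda>_. 1"] by (simp add: spread_1)

text \<open>A radical exponent is a spread exponent plus \<open>N\<close> times a balanced one:
  shadow and loop eigenvalues together fix the scalars of the whole radical.\<close>

lemma eigen_radical:
  assumes v: "v \<in> eigen h" and c: "c \<in> L.radical"
    and \<rho>: "\<And>k v. k \<in> balanced D \<Longrightarrow> v \<in> V \<Longrightarrow> T (\<lambda>x. int N * k x) v = sv (\<rho> k) v"
    and k: "k \<in> balanced D" "c - spread (coords c) = (\<lambda>x. int N * k x)"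
  shows "T c v = sv (\<rho> k * (\<Prod>C\<in>orbs. h C ^ nat (coords c C))) v"
proof -
  have vV: "v \<in> V" using v by (simp add: eigen_def)
  have Nk: "(\<lambda>x. int N * k x) \<in> balanced D" using k multiple_balanced by blast
  have c_eq: "spread (coords c) + (\<lambda>x. int N * k x) = c" using k(2) by (metis add_diff_cancel_left' add_diff_eq)
  have "T (spread (coords c)) (T (\<lambda>x. int N * k x) v) = T c v"
    using T_T[OF spread_balanced Nk vV, of "coords c"] c_eq by (simp add: form_spread)
  then have "T c v = sv (\<rho> k) (T (spread (coords c)) v)"
    using \<rho>[OF k(1) vV] T_scale[OF spread_balanced vV] by simp
  then show ?thesis
    using eigen_spread[OF v, of "coords c"] coords_range[of c] by simp
qed

end

text \<open>\<open>\<rho>\<close> is the classical shadow.\<close>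

locale shadowed_module = pattern_module D g N \<omega> sv V T
  for D :: "('f, 'e) pattern" and g N \<omega>
    and sv :: "complex \<Rightarrow> 'v::ab_group_add \<Rightarrow> 'v" and V T +
  fixes \<rho> :: "('e \<Rightarrow> int) \<Rightarrow> complex"
  assumes shadow: "k \<in> balanced D \<Longrightarrow> v \<in> V \<Longrightarrow> T (\<lambda>x. int N * k x) v = sv (\<rho> k) v"
    and V_nontrivial: "V \<noteq> {0}"
begin

lemma M_scalar: "m \<in> exponents_mod D N \<Longrightarrow> \<exists>z. \<forall>v\<in>V. T m v = sv z v"
  using exponents_mod_divide[OF _ odd_N, of m D] shadow by fast

lemma \<rho>_nz:
  assumes "k \<in> balanced D"
  shows "\<rho> k \<noteq> 0"
proof
  assume z: "\<rho> k = 0"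
  obtain v where v: "v \<in> V" "v \<noteq> 0" using V_nontrivial V subspace_0 by blast
  have Nk: "(\<lambda>x. int N * k x) \<in> balanced D" by (rule multiple_balanced[OF assms])
  have "v = T (- (\<lambda>x. int N * k x)) (T (\<lambda>x. int N * k x) v)" using T_inv'[OF Nk v(1)] by simp
  also have "\<dots> = 0" using shadow[OF assms v(1)] z T_zero[OF L.K_minus[OF Nk]] by simp
  finally show False using v by simp
qed

definition shadow_roots :: "('f \<times> nat) set \<Rightarrow> complex set" where
  "shadow_roots C = {z. z ^ N = \<rho> (loop_exponent C)}"

lemma card_shadow_roots: "card (shadow_roots C) = N"
  unfolding shadow_roots_def by (rule card_nth_roots[OF \<rho>_nz[OF loop_balanced] N_pos])

lemma finite_shadow_roots: "finite (shadow_roots C)"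
  unfolding shadow_roots_def by (intro finite_nth_roots) (use N_pos in simp)

text \<open>The loop elements are diagonalised one after another: each preserves the joint
  eigenspaces of the previous ones, and its \<open>N\<close>-th power is a nonzero scalar given by
  the shadow.\<close>

lemma dim_eigen_sum:
  assumes fin: "finite b0" "V \<subseteq> span b0"
  shows "dim V = (\<Sum>h\<in>(\<Pi>\<^sub>E C\<in>orbs. shadow_roots C). dim (eigen h))"
proof -
  have "dim V = (\<Sum>h\<in>(\<Pi>\<^sub>E C\<in>A. shadow_roots C). dim (eigen_on A h))" if "finite A" for A
    using that
  proof (induction A rule: finite_induct)
    case empty
    show ?case by (simp add: eigen_on_def)
  next
    case (insert C A)
    have step: "dim (eigen_on A h) = (\<Sum>z\<in>shadow_roots C. dim (eigen_on (insert C A) (h(C := z))))" for h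
    proof -
      have inv: "subspace (eigen_on A h)" "eigen_on A h \<subseteq> V"
        "\<And>v. v \<in> eigen_on A h \<Longrightarrow> T (loop_exponent C) v \<in> eigen_on A h"
        using eigen_on_invariant[of A h] loop_balanced by (auto simp: invariant_def)
      interpret E: endomorphism_on sv "eigen_on A h" "T (loop_exponent C)"
        using inv linear_on_subset[OF T_linear[OF loop_balanced]]
        by unfold_locales auto
      have "(T (loop_exponent C) ^^ N) v = sv (\<rho> (loop_exponent C)) v" if "v \<in> eigen_on A h" for v
        using T_pow[OF loop_balanced] shadow[OF loop_balanced] that inv by auto
      then have "direct_sum (shadow_roots C) (\<lambda>z. {v \<in> eigen_on A h. T (loop_exponent C) v = sv z v}) (eigen_on A h)"
        unfolding shadow_roots_def
        by (intro E.root_eigenspaces N_pos \<rho>_nz loop_balanced)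
      then have "dim (eigen_on A h) = (\<Sum>z\<in>shadow_roots C. dim {v \<in> eigen_on A h. T (loop_exponent C) v = sv z v})"
        using inv(1) order_trans[OF inv(2) fin(2)] by (rule direct_sum_dim[OF _ _ fin(1)])
      moreover have "{v \<in> eigen_on A h. T (loop_exponent C) v = sv z v} = eigen_on (insert C A) (h(C := z))" for z
        using insert.hyps by (auto simp: eigen_on_def)
      ultimately show ?thesis by simp
    qed
    have "(\<Sum>h\<in>(\<Pi>\<^sub>E C\<in>insert C A. shadow_roots C). dim (eigen_on (insert C A) h)) =
        (\<Sum>(z, h)\<in>shadow_roots C \<times> (\<Pi>\<^sub>E C\<in>A. shadow_roots C). dim (eigen_on (insert C A) (h(C := z))))"
      unfolding PiE_insert_eq
      by (subst sum.reindex[OF inj_combinator[OF insert.hyps(2)]]) (simp add: case_prod_unfold)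
    also have "\<dots> = (\<Sum>z\<in>shadow_roots C. \<Sum>h\<in>(\<Pi>\<^sub>E C\<in>A. shadow_roots C). dim (eigen_on (insert C A) (h(C := z))))"
      by (rule sum.cartesian_product[symmetric])
    also have "\<dots> = (\<Sum>h\<in>(\<Pi>\<^sub>E C\<in>A. shadow_roots C). dim (eigen_on A h))"
      unfolding step by (rule sum.swap)
    finally show ?case using insert.IH by simp
  qed
  from this[OF finite_orbs] show ?thesis by (simp add: eigen_on_orbs)
qed

lemma simple_dim_eq:
  assumes "simple X"
  shows "(dim X)\<^sup>2 * N ^ card orbs = N ^ card (edges D)" "\<exists>b. finite b \<and> X \<subseteq> span b"
proof -
  have inv: "invariant X" using assms by (simp add: simple_def)
  interpret X: twisted_module "balanced D" "form D" N \<omega> "exponents_mod D N" "residue_reps D N" sv X T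
    by (rule invariant_module[OF inv])
  have "X.simple X" using simple_simple[OF inv] assms by simp
  then obtain b where b: "finite b" "independent b" "span b = X"
    "(card b)\<^sup>2 * card (residue_reps D N \<inter> L.radical) = card (residue_reps D N)"
    using X.simple_dimension by blast
  have "dim X = card b" using b(2,3) dim_span_eq_card_independent by blast
  then show "(dim X)\<^sup>2 * N ^ card orbs = N ^ card (edges D)"
    using b(4) by (simp add: card_radical card_residue_reps[OF finite_faces])
  show "\<exists>b. finite b \<and> X \<subseteq> span b" using b by blast
qed

lemma simple_eigen:
  assumes "simple X"
  shows "\<exists>h. X \<subseteq> eigen h"
proof -
  have inv: "invariant X" using assms by (simp add: simple_def)
  interpret X: twisted_module "balanced D" "form D" N \<omega> "exponents_mod D N" "residue_reps D N" sv X T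
    by (rule invariant_module[OF inv])
  have "X.simple X" using simple_simple[OF inv] assms by simp
  then have "\<forall>C. \<exists>z. \<forall>v\<in>X. T (loop_exponent C) v = sv z v"
    using X.simple_radical_scalar loop_radical by blast
  then obtain h where "\<And>C v. v \<in> X \<Longrightarrow> T (loop_exponent C) v = sv (h C) v" by metis
  then show ?thesis using inv by (auto simp: eigen_def invariant_def intro!: exI[of _ h])
qed

lemma eigen_cong: "(\<And>C. C \<in> orbs \<Longrightarrow> h C = h' C) \<Longrightarrow> eigen h = eigen h'"
  by (auto simp: eigen_def)

text \<open>Every simple summand lies in some joint eigenspace, so those inside
  \<open>eigen h\<close> already sum up to it; and all simple submodules have the same dimension by
  \<open>simple_dim_eq\<close>.\<close>

lemma multiplicity:
  assumes fin: "finite b0" "V \<subseteq> span b0"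
    and simple: "\<And>X. X \<in> Bs \<Longrightarrow> simple X" and ds: "direct_sum Bs (\<lambda>X. X) V"
    and X: "X \<in> Bs" "X \<subseteq> eigen h"
  shows "dim (eigen h) = card {Y\<in>Bs. Y \<subseteq> eigen h} * dim X"
proof -
  let ?B = "{Y\<in>Bs. Y \<subseteq> eigen h}"
  have Bs: "finite Bs" "\<And>X. X \<in> Bs \<Longrightarrow> subspace X" "\<And>X. X \<in> Bs \<Longrightarrow> X \<subseteq> V"
    using ds by (auto simp: direct_sum_def)
  have E: "subspace (eigen h)" "eigen h \<subseteq> V" using eigen_invariant by (auto simp: invariant_def)
  have "direct_sum ?B (\<lambda>X. X) (eigen h)"
  proof (rule direct_sumI)
    fix v assume v: "v \<in> eigen h"
    then have vV: "v \<in> V" using E by auto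
    obtain f where f: "\<And>X. X \<in> Bs \<Longrightarrow> f X \<in> X" "v = (\<Sum>X\<in>Bs. f X)"
      using direct_sum_expand[OF ds vV] by blast
    \<comment> \<open>A nonzero component in \<open>X\<close> would force the eigenvalues of
      \<open>X\<close> to coincide with \<open>h\<close> on every orbit.\<close>
    have "f X = 0" if X: "X \<in> Bs" "\<not> X \<subseteq> eigen h" for X
    proof (rule ccontr)
      assume nz: "f X \<noteq> 0"
      obtain h' where h': "X \<subseteq> eigen h'" using simple_eigen[OF simple[OF X(1)]] by blast
      have "h C = h' C" if C: "C \<in> orbs" for C
      proof -
        have fV: "f Y \<in> V" if "Y \<in> Bs" for Y using f Bs that by blast
        have "(\<Sum>X\<in>Bs. T (loop_exponent C) (f X)) = T (loop_exponent C) v"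
          unfolding f(2) using fV by (subst T_sum[OF loop_balanced]) auto
        also have "\<dots> = (\<Sum>X\<in>Bs. sv (h C) (f X))"
          using v C by (simp add: eigen_def f(2) scale_sum_right)
        finally have eq: "(\<Sum>X\<in>Bs. T (loop_exponent C) (f X)) = (\<Sum>X\<in>Bs. sv (h C) (f X))" .
        have "T (loop_exponent C) (f X) = sv (h C) (f X)"
        proof (rule direct_sum_unique[OF ds V _ _ eq X(1)])
          fix Y assume Y: "Y \<in> Bs"
          show "T (loop_exponent C) (f Y) \<in> Y"
            using simple[OF Y] f(1)[OF Y] loop_balanced by (simp add: simple_def invariant_def)
          show "sv (h C) (f Y) \<in> Y" using Bs(2)[OF Y] f(1)[OF Y] by (rule subspace_scale)
        qed
        moreover have "T (loop_exponent C) (f X) = sv (h' C) (f X)"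
          using h' f(1)[OF X(1)] C by (auto simp: eigen_def)
        ultimately show ?thesis using nz by simp
      qed
      then have "eigen h = eigen h'" by (rule eigen_cong)
      then show False using h' X by simp
    qed
    then have "v = (\<Sum>X\<in>?B. f X)"
      unfolding f(2) using Bs(1) by (intro sum.mono_neutral_right) auto
    then show "\<exists>f. (\<forall>X\<in>?B. f X \<in> X) \<and> v = (\<Sum>X\<in>?B. f X)"
      using f(1) by (intro exI[of _ f]) auto
  next
    fix f X assume f: "\<And>X. X \<in> ?B \<Longrightarrow> f X \<in> X" "(\<Sum>X\<in>?B. f X) = 0" "X \<in> ?B"
    define f' where "f' X = (if X \<in> ?B then f X else 0)" for X
    have "(\<Sum>X\<in>Bs. f' X) = (\<Sum>X\<in>?B. f' X)"
      using Bs(1) by (intro sum.mono_neutral_right) (auto simp: f'_def)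
    also have "\<dots> = (\<Sum>X\<in>?B. f X)" by (intro sum.cong) (auto simp: f'_def)
    finally have sum0: "(\<Sum>X\<in>Bs. f' X) = 0" using f(2) by simp
    have mem: "f' Y \<in> Y" if "Y \<in> Bs" for Y
      using that f(1) subspace_0[OF Bs(2)[OF that]] by (simp add: f'_def)
    have "X \<in> Bs" using f(3) by simp
    then have "f' X = 0"
      by (rule direct_sum_zero[OF ds V, where f = f', rotated 2]) (use mem sum0 in simp_all)
    then show "f X = 0" using f(3) by (simp add: f'_def)
  qed (use Bs in auto)
  then have "dim (eigen h) = (\<Sum>X\<in>?B. dim X)"
    using E(1) order_trans[OF E(2) fin(2)] by (rule direct_sum_dim[OF _ _ fin(1)])
  also have "\<dots> = (\<Sum>Y\<in>?B. dim X)"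
  proof (intro sum.cong refl)
    fix Y assume "Y \<in> ?B"
    then have "(dim Y)\<^sup>2 * N ^ card orbs = (dim X)\<^sup>2 * N ^ card orbs"
      using simple_dim_eq(1) simple X(1) by simp
    then have "(dim Y)\<^sup>2 = (dim X)\<^sup>2" using N_pos by simp
    then show "dim Y = dim X" by (simp add: power2_eq_iff_nonneg)
  qed
  finally show ?thesis by simp
qed

end

lemma (in complex_vector_space) dim_injective_image:
  assumes lin: "linear_on sv U sv f" and U: "subspace U" and inj: "inj_on f U"
    and fin: "finite b0" "U \<subseteq> span b0"
  shows "dim (f ` U) = dim U"
proof -
  interpret f: linear_map_on sv sv U f
    by unfold_locales (simp_all add: U lin)
  obtain b where b: "finite b" "b \<subseteq> U" "independent b" "U \<subseteq> span b" "card b = dim U"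
    using finite_basis_exists[OF fin] by blast
  have "independent (f ` b)"
  proof (rule independent_if_scalars_zero)
    show "finite (f ` b)" using b by simp
    fix a x assume z: "(\<Sum>x\<in>f ` b. sv (a x) x) = 0" and x: "x \<in> f ` b"
    have bU: "sv (a (f y)) y \<in> U" if "y \<in> b" for y using that b U subspace_scale by blast
    have "f (\<Sum>y\<in>b. sv (a (f y)) y) = (\<Sum>y\<in>b. sv (a (f y)) (f y))"
      using b bU by (subst f.map_sum) (auto simp: linear_on_scale[OF lin] subset_iff)
    also have "\<dots> = 0"
      using z by (subst (asm) sum.reindex) (use inj b inj_on_subset in auto)
    finally have "f (\<Sum>y\<in>b. sv (a (f y)) y) = f 0" using f.map_0 by simp
    then have "(\<Sum>y\<in>b. sv (a (f y)) y) = 0"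
      using inj bU U by (auto simp: inj_on_def subspace_0 subspace_sum)
    then show "a x = 0" using independentD[OF b(3) b(1) subset_refl] x by auto
  qed
  moreover have "f ` b \<subseteq> f ` U" using b by auto
  moreover have "f ` U \<subseteq> span (f ` b)"
  proof
    fix y assume "y \<in> f ` U"
    then obtain u where u: "u \<in> U" "y = f u" by auto
    have "u \<in> span b" using u b by auto
    then obtain a where a: "u = (\<Sum>x\<in>b. sv (a x) x)" using span_finite[OF b(1)] by auto
    have "sv (a x) x \<in> U" if "x \<in> b" for x using that b U subspace_scale by blast
    then have "y = (\<Sum>x\<in>b. sv (a x) (f x))"
      unfolding u(2) a using b by (subst f.map_sum) (auto simp: linear_on_scale[OF lin] subset_iff)
    then show "y \<in> span (f ` b)" by (simp add: span_sum span_scale span_base)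
  qed
  ultimately have "card (f ` b) = dim (f ` U)" using basis_card_eq_dim by blast
  moreover have "card (f ` b) = card b" using inj b by (intro card_image) (auto intro: inj_on_subset)
  ultimately show ?thesis using b by simp
qed

section \<open>The action of the split algebra on the eigenspaces\<close>

lemma split_faces [simp]: "faces (split_pattern D) = faces D"
  and split_edge_at [simp]: "edge_at (split_pattern D) = (\<lambda>s. s)"
  by (simp_all add: split_pattern_def)

lemma split_edges: "edges (split_pattern D) = sides (faces D)"
  by (simp add: edges_def)

lemma lift_add: "lift_exponent D (k + l) = lift_exponent D k + lift_exponent D l"
  by (rule ext) (simp add: lift_exponent_def)

lemma lift_0: "lift_exponent D 0 = 0"
  by (rule ext) (simp add: lift_exponent_def)

lemma lift_balanced: "k \<in> balanced D \<Longrightarrow> lift_exponent D k \<in> balanced (split_pattern D)"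
  unfolding balanced_sides by (simp add: lift_exponent_def split_edges nxt_sides prv_sides)

text \<open>Cutting along the edges changes no corner of any face, and the form is a sum over
  corners. This is what makes the splitting map multiplicative.\<close>

lemma form_lift:
  assumes "finite (faces D)"
  shows "form (split_pattern D) (lift_exponent D k) (lift_exponent D l) = form D k l"
  using assms by (simp add: form_sides lift_exponent_def nxt_sides)

text \<open>The powers with exponents below \<open>N\<close> are distinct, and the equation has only
  \<open>N\<close> solutions.\<close>

lemma roots_of_unity_powers:
  assumes "root_of_unity_of_order N \<omega>" "u ^ N = 1"
  shows "\<exists>j::int. u = \<omega> powi j"
proof -
  have N: "N > 0" "\<omega> ^ N = 1" using assms by (auto simp: root_of_unity_of_order_def)
  have nz: "\<omega> \<noteq> 0" using N by (auto simp: power_0_left split: if_splits)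
  let ?f = "\<lambda>j. \<omega> powi j"
  have "inj_on ?f {0..<int N}"
  proof (rule inj_onI)
    fix i j assume ij: "i \<in> {0..<int N}" "j \<in> {0..<int N}" "?f i = ?f j"
    have "\<omega> powi (i - j) = 1" using ij nz by (simp add: power_int_diff)
    then have "int N dvd i - j" using root_of_unity_powi_eq_1_iff[OF assms(1)] by simp
    then show "i = j" using mod_eq_int_less ij by blast
  qed
  then have "card (?f ` {0..<int N}) = N" by (simp add: card_image)
  moreover have "?f ` {0..<int N} \<subseteq> {z. z ^ N = 1}"
  proof
    fix z assume "z \<in> ?f ` {0..<int N}"
    then obtain j where "z = \<omega> powi j" by auto
    then have "z ^ N = (\<omega> powi int N) powi j"
      by (metis mult.commute power_int_mult power_int_of_nat)
    then show "z \<in> {z. z ^ N = 1}" using N by simp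
  qed
  moreover have "card {z::complex. z ^ N = 1} = N" using N by (intro card_nth_roots) auto
  moreover have "finite {z::complex. z ^ N = 1}" using N by (intro finite_nth_roots) auto
  ultimately have "?f ` {0..<int N} = {z. z ^ N = 1}" by (intro card_subset_eq) auto
  then show ?thesis using assms(2) by blast
qed

text \<open>\<open>T'\<close> is the action of the algebra of the disjoint faces on the same space.
  Its elements need not commute with the loop elements and so can move vectors between their
  eigenspaces. \<open>connected\<close> is the combinatorial form of connectedness of the
  surface.\<close>

locale split_module = shadowed_module D g N \<omega> sv V T \<rho> +
  SP: twisted_module "balanced (split_pattern D)" "form (split_pattern D)" N \<omega>
    "exponents_mod (split_pattern D) N" "residue_reps (split_pattern D) N" sv V T'
  for D :: "('f, 'e) pattern" and g N \<omega>
    and sv :: "complex \<Rightarrow> 'v::ab_group_add \<Rightarrow> 'v" and V T \<rho> T' +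
  fixes h\<^sub>C :: complex and b\<^sub>0 :: "'v set"
  assumes T_split: "k \<in> balanced D \<Longrightarrow> v \<in> V \<Longrightarrow> T k v = T' (lift_exponent D k) v"
    and connected: "A \<subseteq> S \<Longrightarrow> A \<noteq> {} \<Longrightarrow> (\<And>s. s \<in> A \<Longrightarrow> nxt s \<in> A \<and> g s \<in> A) \<Longrightarrow> A = S"
    and central: "v \<in> V \<Longrightarrow> T (\<lambda>x. if x \<in> edges D then 2 else 0) v = sv h\<^sub>C v"
    and faces_nonempty: "faces D \<noteq> {}"
    and finite_spanning: "finite b\<^sub>0" "V \<subseteq> span b\<^sub>0"
begin

text \<open>A monomial on one side of a cut face interacts only with the loops at the two ends of
  that side, with opposite signs.\<close>

lemma loop_pairing:
  assumes "s \<in> S"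
  shows "form (split_pattern D) (lift_exponent D (loop_exponent C)) (\<lambda>s'. if s' = s then c else 0) =
    c * (of_bool (orb s = C) - of_bool (orb (nxt s) = C))"
proof -
  let ?k = "lift_exponent D (loop_exponent C)"
  have k: "?k s = of_bool (orb s = C) + of_bool (orb (nxt s) = C)" if "s \<in> S" for s
    using that by (simp add: lift_exponent_def loop_exponent_def spread_nxt)
  have "form (split_pattern D) ?k (\<lambda>s'. if s' = s then c else 0) =
      (\<Sum>s'\<in>S. if s' = s then c * (?k (prv s) - ?k (nxt s)) else 0)"
    using finite_faces by (subst form_sides') (auto intro!: sum.cong)
  also have "\<dots> = c * (?k (prv s) - ?k (nxt s))" using finite_S assms by simp
  finally show ?thesis using assms by (simp add: k S_simps)
qed

lemma split_shift:
  assumes l: "l \<in> balanced (split_pattern D)" and v: "v \<in> eigen h"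
  shows "T' l v \<in> eigen (\<lambda>C. h C * \<omega> powi (2 * form (split_pattern D) (lift_exponent D (loop_exponent C)) l))"
  unfolding eigen_def
proof (intro CollectI conjI ballI)
  have vV: "v \<in> V" using v by (simp add: eigen_def)
  show lV: "T' l v \<in> V" by (rule SP.T_V[OF l vV])
  fix C assume C: "C \<in> orbs"
  let ?k = "lift_exponent D (loop_exponent C)"
  have k: "?k \<in> balanced (split_pattern D)" by (rule lift_balanced[OF loop_balanced])
  have "T (loop_exponent C) (T' l v) = T' ?k (T' l v)" by (rule T_split[OF loop_balanced lV])
  also have "\<dots> = sv (\<omega> powi (2 * form (split_pattern D) ?k l)) (T' l (T' ?k v))"
    by (rule SP.T_comm[OF k l vV])
  also have "T' ?k v = sv (h C) v"
    using T_split[OF loop_balanced vV, of C] v C by (simp add: eigen_def)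
  finally show "T (loop_exponent C) (T' l v) = sv (h C * \<omega> powi (2 * form (split_pattern D) ?k l)) (T' l v)"
    by (simp add: SP.T_scale[OF l vV] mult.commute)
qed

lemma split_shift_dim:
  assumes l: "l \<in> balanced (split_pattern D)"
    and h': "\<And>C. C \<in> orbs \<Longrightarrow>
      h' C = h C * \<omega> powi (2 * form (split_pattern D) (lift_exponent D (loop_exponent C)) l)"
  shows "dim (eigen h') = dim (eigen h)"
proof -
  have E: "subspace (eigen h)" "eigen h \<subseteq> V" "eigen h' \<subseteq> V"
    using eigen_invariant by (auto simp: invariant_def)
  have l': "- l \<in> balanced (split_pattern D)" by (rule SP.K_minus[OF l])
  have "T' l ` eigen h = eigen h'"
  proof (intro subset_antisym subsetI)
    fix w assume "w \<in> T' l ` eigen h"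
    then obtain v where v: "v \<in> eigen h" "w = T' l v" by auto
    have "eigen h' = eigen (\<lambda>C. h C * \<omega> powi (2 * form (split_pattern D) (lift_exponent D (loop_exponent C)) l))"
      by (rule eigen_cong) (rule h')
    then show "w \<in> eigen h'" unfolding v(2) using split_shift[OF l v(1)] by (simp only:)
  next
    fix w assume w: "w \<in> eigen h'"
    have "T' (- l) w \<in> eigen h"
    proof -
      have "h' C * \<omega> powi (2 * form (split_pattern D) (lift_exponent D (loop_exponent C)) (- l)) = h C"
        if "C \<in> orbs" for C
        unfolding h'[OF that] SP.B_minus_right[OF lift_balanced[OF loop_balanced] l]
        by (simp add: mult.assoc flip: SP.powi_add)
      then have "eigen (\<lambda>C. h' C * \<omega> powi (2 * form (split_pattern D)
          (lift_exponent D (loop_exponent C)) (- l))) = eigen h"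
        by (rule eigen_cong)
      then show ?thesis using split_shift[OF l' w] by (simp only:)
    qed
    moreover have "w = T' l (T' (- l) w)" using SP.T_inv[OF l] w E by auto
    ultimately show "w \<in> T' l ` eigen h" by blast
  qed
  moreover have "inj_on (T' l) (eigen h)"
    by (rule inj_on_inverseI[where g = "T' (- l)"]) (use SP.T_inv'[OF l] E in auto)
  moreover have "linear_on sv (eigen h) sv (T' l)"
    by (rule linear_on_subset[OF SP.T_linear[OF l] E(2)])
  ultimately show ?thesis
    using dim_injective_image[OF _ E(1) _ finite_spanning(1), of "T' l"] E finite_spanning by auto
qed

text \<open>The vectors \<open>z\<close>, read modulo \<open>N\<close>, such that some split
  monomial carries the eigenvalues \<open>h C\<close> to
  \<open>h C * \<omega> powi (2 * z C)\<close>.\<close>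

definition shifts :: "(('f \<times> nat) set \<Rightarrow> int) set" where
  "shifts = {z. \<exists>l\<in>balanced (split_pattern D). \<forall>C.
     int N dvd form (split_pattern D) (lift_exponent D (loop_exponent C)) l - z C}"

lemma shifts_add:
  assumes "y \<in> shifts" "z \<in> shifts"
  shows "(\<lambda>C. y C + z C) \<in> shifts"
proof -
  let ?f = "\<lambda>C. form (split_pattern D) (lift_exponent D (loop_exponent C))"
  obtain l m where l: "l \<in> balanced (split_pattern D)" "\<And>C. int N dvd ?f C l - y C"
    and m: "m \<in> balanced (split_pattern D)" "\<And>C. int N dvd ?f C m - z C"
    using assms by (auto simp: shifts_def)
  have "?f C (l + m) - (y C + z C) = (?f C l - y C) + (?f C m - z C)" for C
    using SP.B_add_right[OF lift_balanced[OF loop_balanced] l(1) m(1)] by simp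
  then have "int N dvd ?f C (l + m) - (y C + z C)" for C
    using dvd_add[OF l(2) m(2)] by metis
  then show ?thesis using SP.K_add[OF l(1) m(1)] by (auto simp: shifts_def)
qed

lemma shifts_0: "(\<lambda>C. 0) \<in> shifts"
  using SP.K_0 SP.B_skew[OF lift_balanced[OF loop_balanced] SP.K_0] SP.B_0[OF lift_balanced[OF loop_balanced]]
  by (auto simp: shifts_def intro!: bexI[of _ 0])

lemma shifts_side:
  assumes s: "s \<in> S"
  shows "(\<lambda>C. c * (of_bool (orb (nxt s) = C) - of_bool (orb s = C))) \<in> shifts"
proof -
  \<comment> \<open>The value is even, hence balanced, and congruent to \<open>- c\<close>; the sign
    compensates for \<open>loop_pairing\<close> counting the start of the side positively.\<close>
  define l where "l s' = (if s' = s then 2 * (int ((N + 1) div 2) * - c) else 0)" for s'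
  have "l \<in> balanced (split_pattern D)"
    using s by (auto simp: balanced_def split_edges l_def)
  moreover have "int N dvd form (split_pattern D) (lift_exponent D (loop_exponent C)) l -
      c * (of_bool (orb (nxt s) = C) - of_bool (orb s = C))" for C
  proof -
    have "form (split_pattern D) (lift_exponent D (loop_exponent C)) l -
        c * (of_bool (orb (nxt s) = C) - of_bool (orb s = C)) =
        (2 * (int ((N + 1) div 2) * - c) - (- c)) * (of_bool (orb s = C) - of_bool (orb (nxt s) = C))"
      unfolding l_def loop_pairing[OF s] by (simp add: algebra_simps)
    then show ?thesis using odd_inverse_2[OF odd_N, of "- c"] by (metis dvd_mult2)
  qed
  ultimately show ?thesis unfolding shifts_def by blast
qed

text \<open>Here connectedness enters: the sides whose orbit can be reached from that of
  \<open>s\<close> are closed under \<open>nxt\<close> by \<open>shifts_side\<close>, and under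
  \<open>g\<close> because \<open>g t\<close> and \<open>nxt t\<close> have the same orbit.\<close>

lemma shifts_sides:
  assumes s: "s \<in> S" and t: "t \<in> S"
  shows "(\<lambda>C. c * (of_bool (orb t = C) - of_bool (orb s = C))) \<in> shifts"
proof -
  define A where "A = {t\<in>S. \<forall>c. (\<lambda>C. c * (of_bool (orb t = C) - of_bool (orb s = C))) \<in> shifts}"
  have "A = S"
  proof (rule connected)
    show "A \<subseteq> S" by (auto simp: A_def)
    have "s \<in> A" using s shifts_0 by (simp add: A_def)
    then show "A \<noteq> {}" by auto
    fix t assume t: "t \<in> A"
    have "(\<lambda>C. c * (of_bool (orb (nxt t) = C) - of_bool (orb s = C))) \<in> shifts" for c
    proof -
      have "(\<lambda>C. c * (of_bool (orb t = C) - of_bool (orb s = C)) +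
          c * (of_bool (orb (nxt t) = C) - of_bool (orb t = C))) \<in> shifts"
        using t by (intro shifts_add shifts_side) (auto simp: A_def)
      then show ?thesis by (simp add: algebra_simps)
    qed
    moreover have "orb (g t) = orb (nxt t)" using t orb_nxt by (simp add: A_def)
    ultimately show "nxt t \<in> A \<and> g t \<in> A" using t by (simp add: A_def S_simps)
  qed
  then show ?thesis using t by (auto simp: A_def)
qed

lemma S_nonempty: "S \<noteq> {}"
proof -
  obtain T where "T \<in> faces D" using faces_nonempty by auto
  then have "(T, 0) \<in> S" by (simp add: in_sides)
  then show ?thesis by auto
qed

lemma orbs_nonempty: "orbs \<noteq> {}"
  using S_nonempty by (simp add: orbs_def)

text \<open>Vectors of total zero are generated by differences of unit vectors. All differences are
  taken against one base orbit, where the error is the total of \<open>z\<close>, divisible by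
  \<open>N\<close>.\<close>

lemma shifts_sum_zero:
  assumes "int N dvd (\<Sum>C\<in>orbs. z C)"
  shows "\<exists>y\<in>shifts. \<forall>C\<in>orbs. int N dvd y C - z C"
proof -
  obtain s where s: "s \<in> S" using S_nonempty by auto
  define y where "y A C = (\<Sum>C'\<in>A. z C' * (of_bool (C' = C) - of_bool (orb s = C)))" for A C
  have "y A \<in> shifts" if "finite A" "A \<subseteq> orbs" for A
    using that
  proof (induction A rule: finite_induct)
    case empty
    then show ?case using shifts_0 by (simp add: y_def)
  next
    case (insert C' A)
    obtain t where t: "t \<in> S" "C' = orb t" using insert.prems by (auto simp: orbs_def)
    have "y (insert C' A) = (\<lambda>C. z C' * (of_bool (orb t = C) - of_bool (orb s = C)) + y A C)"
      using insert.hyps by (intro ext) (simp add: y_def t(2))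
    then show ?case using insert shifts_add[OF shifts_sides[OF s t(1)]] by simp
  qed
  then have "y orbs \<in> shifts" using finite_orbs by simp
  moreover have "int N dvd y orbs C - z C" if C: "C \<in> orbs" for C
  proof -
    have "y orbs C = (\<Sum>C'\<in>orbs. z C' * of_bool (C' = C)) - (\<Sum>C'\<in>orbs. z C') * of_bool (orb s = C)"
      by (simp add: y_def right_diff_distrib sum_subtractf sum_distrib_right)
    also have "(\<Sum>C'\<in>orbs. z C' * of_bool (C' = C)) = (\<Sum>C'\<in>orbs. if C' = C then z C else 0)"
      by (intro sum.cong) auto
    also have "\<dots> = z C" using finite_orbs C by simp
    finally have "y orbs C - z C = - ((\<Sum>C'\<in>orbs. z C') * of_bool (orb s = C))" by simp
    then show ?thesis using assms by (metis dvd_minus_iff dvd_mult2)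
  qed
  ultimately show ?thesis by blast
qed

section \<open>Eigenvalue tuples with the prescribed product\<close>

definition tuples :: "(('f \<times> nat) set \<Rightarrow> complex) set" where
  "tuples = {h \<in> \<Pi>\<^sub>E C\<in>orbs. shadow_roots C. (\<Prod>C\<in>orbs. h C) = h\<^sub>C}"

lemma shadow_roots_nz: "z \<in> shadow_roots C \<Longrightarrow> z \<noteq> 0"
  using \<rho>_nz[OF loop_balanced, of C] N_pos by (auto simp: shadow_roots_def power_0_left)

text \<open>Two tuples differ by roots of unity with product 1, that is by
  \<open>\<omega> powi (2 * z C)\<close> with the sum of \<open>z\<close> divisible by
  \<open>N\<close>. A split monomial realises this shift, and it acts invertibly.\<close>

lemma tuples_dim_eq:
  assumes h: "h \<in> tuples" and h': "h' \<in> tuples"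
  shows "dim (eigen h') = dim (eigen h)"
proof -
  have roots: "h C \<in> shadow_roots C" "h' C \<in> shadow_roots C" if "C \<in> orbs" for C
    using h h' that by (auto simp: tuples_def)
  have "\<exists>z. h' C = h C * \<omega> powi (2 * z)" if C: "C \<in> orbs" for C
  proof -
    have "(h' C / h C) ^ N = 1"
      using roots[OF C] \<rho>_nz[OF loop_balanced, of C] by (simp add: shadow_roots_def power_divide)
    then obtain j where j: "h' C / h C = \<omega> powi j" using roots_of_unity_powers[OF root] by blast
    \<comment> \<open>Half of \<open>j\<close> modulo \<open>N\<close>, since shifts enter with the
      exponent doubled.\<close>
    let ?z = "int ((N + 1) div 2) * j"
    have "\<omega> powi (2 * ?z - j) = 1"
      using odd_inverse_2[OF odd_N] root_of_unity_powi_eq_1_iff[OF root] by blast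
    then have "\<omega> powi (2 * ?z) = \<omega> powi j"
      using L.powi_add[of "2 * ?z - j" j] by simp
    then have "h' C = h C * \<omega> powi (2 * ?z)"
      using j shadow_roots_nz roots[OF C] by (simp add: field_simps)
    then show ?thesis by blast
  qed
  then obtain z where z: "\<And>C. C \<in> orbs \<Longrightarrow> h' C = h C * \<omega> powi (2 * z C)" by metis
  have sum: "(\<Prod>C\<in>A. \<omega> powi (2 * z C)) = \<omega> powi (2 * (\<Sum>C\<in>A. z C))" if "finite A" for A
    using that by (induction A rule: finite_induct) (simp_all add: distrib_left L.powi_add)
  have "(\<Prod>C\<in>orbs. h' C) = (\<Prod>C\<in>orbs. h C) * (\<Prod>C\<in>orbs. \<omega> powi (2 * z C))"
    using z by (simp add: prod.distrib[symmetric])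
  moreover have "(\<Prod>C\<in>orbs. h' C) = (\<Prod>C\<in>orbs. h C)" using h h' by (simp add: tuples_def)
  moreover have "(\<Prod>C\<in>orbs. h C) \<noteq> 0"
    using finite_orbs roots shadow_roots_nz by auto
  ultimately have "\<omega> powi (2 * (\<Sum>C\<in>orbs. z C)) = 1"
    using sum[OF finite_orbs] by simp
  then have "int N dvd (\<Sum>C\<in>orbs. z C)" using L.powi_eq_1_iff by simp
  then obtain y where y: "y \<in> shifts" "\<And>C. C \<in> orbs \<Longrightarrow> int N dvd y C - z C"
    using shifts_sum_zero by blast
  let ?f = "\<lambda>C. form (split_pattern D) (lift_exponent D (loop_exponent C))"
  obtain l where l: "l \<in> balanced (split_pattern D)" "\<And>C. int N dvd ?f C l - y C"
    using y(1) by (auto simp: shifts_def)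
  show ?thesis
  proof (rule split_shift_dim[OF l(1)])
    fix C assume C: "C \<in> orbs"
    have "int N dvd (?f C l - y C) + (y C - z C)" using l(2) y(2)[OF C] by (intro dvd_add)
    then have "\<omega> powi (2 * (?f C l - z C)) = 1" unfolding L.powi_eq_1_iff by simp
    then have "\<omega> powi (2 * ?f C l) = \<omega> powi (2 * z C)"
      using L.powi_add[of "2 * (?f C l - z C)" "2 * z C"] by (simp add: algebra_simps)
    then show "h' C = h C * \<omega> powi (2 * ?f C l)" using z[OF C] by simp
  qed
qed

lemma eigen_not_tuple:
  assumes "h \<in> (\<Pi>\<^sub>E C\<in>orbs. shadow_roots C)" "h \<notin> tuples"
  shows "eigen h = {0}"
proof -
  have "v = 0" if v: "v \<in> eigen h" for v
  proof (rule ccontr)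
    assume "v \<noteq> 0"
    have "v \<in> V" using v by (simp add: eigen_def)
    then have "sv (\<Prod>C\<in>orbs. h C) v = sv h\<^sub>C v" using eigen_central[OF v] central by metis
    then show False using \<open>v \<noteq> 0\<close> assms by (simp add: tuples_def)
  qed
  moreover have "0 \<in> eigen h" using eigen_invariant[of h] subspace_0 by (auto simp: invariant_def)
  ultimately show ?thesis by auto
qed

lemma dim_zero_space: "dim {0} = 0"
  using dim_eq_card_independent[OF independent_empty] dim_span[of "{}"] by simp

lemma dim_sum_tuples: "dim V = (\<Sum>h\<in>tuples. dim (eigen h))"
proof -
  have "dim V = (\<Sum>h\<in>(\<Pi>\<^sub>E C\<in>orbs. shadow_roots C). dim (eigen h))"
    by (rule dim_eigen_sum[OF finite_spanning])
  also have "\<dots> = (\<Sum>h\<in>tuples. dim (eigen h))"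
    using finite_PiE[OF finite_orbs finite_shadow_roots] eigen_not_tuple
    by (intro sum.mono_neutral_right) (auto simp: tuples_def dim_zero_space)
  finally show ?thesis .
qed

lemma dim_V_pos: "dim V > 0"
proof -
  obtain b where b: "finite b" "b \<subseteq> V" "independent b" "V \<subseteq> span b" "card b = dim V"
    using finite_basis_exists[OF finite_spanning] by blast
  have "b \<noteq> {}" using b(4) V_nontrivial V subspace_0 by auto
  then show ?thesis using b by (metis card_gt_0_iff)
qed

lemma tuples_nonempty: "tuples \<noteq> {}"
  using dim_V_pos dim_sum_tuples by auto

text \<open>All eigenvalues but one can be chosen freely among \<open>N\<close> roots each; the last
  is determined by the product.\<close>

lemma card_tuples: "card tuples = N ^ (card orbs - 1)"
proof -
  obtain C0 where C0: "C0 \<in> orbs" using orbs_nonempty by auto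
  let ?O = "orbs - {C0}"
  obtain h0 where h0: "h0 \<in> tuples" using tuples_nonempty by auto
  \<comment> \<open>This compatibility of central charge and shadow is read off from an existing
    tuple; it makes the determined eigenvalue an \<open>N\<close>-th root of the right
    number.\<close>
  have hC: "h\<^sub>C ^ N = (\<Prod>C\<in>orbs. \<rho> (loop_exponent C))"
  proof -
    have "h\<^sub>C ^ N = (\<Prod>C\<in>orbs. h0 C ^ N)" using h0 by (simp add: tuples_def prod_power_distrib[symmetric])
    also have "\<dots> = (\<Prod>C\<in>orbs. \<rho> (loop_exponent C))"
      using h0 by (intro prod.cong) (auto simp: tuples_def shadow_roots_def)
    finally show ?thesis .
  qed
  have split: "(\<Prod>C\<in>orbs. h C) = h C0 * (\<Prod>C\<in>?O. h C)" for h :: "('f \<times> nat) set \<Rightarrow> complex"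
    by (rule prod.remove[OF finite_orbs C0])
  have nz: "(\<Prod>C\<in>?O. h C) \<noteq> 0" if "\<And>C. C \<in> ?O \<Longrightarrow> h C \<in> shadow_roots C" for h
    using that shadow_roots_nz finite_orbs by (subst prod_zero_iff) auto
  have "bij_betw (\<lambda>h. restrict h ?O) tuples (\<Pi>\<^sub>E C\<in>?O. shadow_roots C)"
  proof (rule bij_betw_byWitness[where f' = "\<lambda>h. h(C0 := h\<^sub>C / (\<Prod>C\<in>?O. h C))"])
    show "\<forall>h\<in>tuples. (restrict h ?O)(C0 := h\<^sub>C / (\<Prod>C\<in>?O. restrict h ?O C)) = h"
    proof
      fix h assume h: "h \<in> tuples"
      have "(\<Prod>C\<in>?O. restrict h ?O C) = (\<Prod>C\<in>?O. h C)" by (intro prod.cong) auto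
      moreover have "h C0 * (\<Prod>C\<in>?O. h C) = h\<^sub>C" using split h by (simp add: tuples_def)
      moreover have "(\<Prod>C\<in>?O. h C) \<noteq> 0" using h by (intro nz) (auto simp: tuples_def)
      ultimately have "h\<^sub>C / (\<Prod>C\<in>?O. restrict h ?O C) = h C0" by (simp add: field_simps)
      moreover have "h C = undefined" if "C \<notin> orbs" for C
        using h that by (auto simp: tuples_def PiE_def extensional_def)
      ultimately show "(restrict h ?O)(C0 := h\<^sub>C / (\<Prod>C\<in>?O. restrict h ?O C)) = h"
        by (intro ext) auto
    qed
    show "\<forall>h\<in>\<Pi>\<^sub>E C\<in>?O. shadow_roots C. restrict (h(C0 := h\<^sub>C / (\<Prod>C\<in>?O. h C))) ?O = h"
      by (auto simp: fun_eq_iff restrict_def PiE_def extensional_def)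
    show "(\<lambda>h. restrict h ?O) ` tuples \<subseteq> (\<Pi>\<^sub>E C\<in>?O. shadow_roots C)"
    proof
      fix k assume "k \<in> (\<lambda>h. restrict h ?O) ` tuples"
      then obtain h where h: "h \<in> tuples" "k = restrict h ?O" by auto
      then have "h C \<in> shadow_roots C" if "C \<in> orbs" for C using that by (auto simp: tuples_def)
      then show "k \<in> (\<Pi>\<^sub>E C\<in>?O. shadow_roots C)" unfolding h(2) by (intro restrict_PiE_iff[THEN iffD2]) simp
    qed
    show "(\<lambda>h. h(C0 := h\<^sub>C / (\<Prod>C\<in>?O. h C))) ` (\<Pi>\<^sub>E C\<in>?O. shadow_roots C) \<subseteq> tuples"
    proof clarify
      fix h assume h: "h \<in> (\<Pi>\<^sub>E C\<in>?O. shadow_roots C)"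
      let ?P = "\<Prod>C\<in>?O. h C"
      let ?h = "h(C0 := h\<^sub>C / ?P)"
      have P: "?P \<noteq> 0" using h by (intro nz) auto
      have "?P ^ N = (\<Prod>C\<in>?O. \<rho> (loop_exponent C))"
        unfolding prod_power_distrib using h
        by (intro prod.cong) (auto simp: shadow_roots_def)
      then have "h\<^sub>C ^ N = \<rho> (loop_exponent C0) * ?P ^ N"
        using hC prod.remove[OF finite_orbs C0, of "\<lambda>C. \<rho> (loop_exponent C)"] by simp
      then have "(h\<^sub>C / ?P) ^ N = \<rho> (loop_exponent C0)"
        using P by (simp add: power_divide)
      then have root0: "h\<^sub>C / ?P \<in> shadow_roots C0" by (simp add: shadow_roots_def)
      have "(\<Prod>C\<in>?O. ?h C) = ?P" by (intro prod.cong) auto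
      then have "(\<Prod>C\<in>orbs. ?h C) = h\<^sub>C" using split[of ?h] P by simp
      moreover have "?h \<in> (\<Pi>\<^sub>E C\<in>orbs. shadow_roots C)"
        using h root0 C0 by (auto simp: PiE_def extensional_def Pi_iff)
      ultimately show "?h \<in> tuples" by (simp add: tuples_def)
    qed
  qed
  from bij_betw_same_card[OF this] show ?thesis
    using card_PiE[of ?O shadow_roots] finite_orbs C0 by (simp add: card_shadow_roots)
qed

lemma dim_eigen_tuple:
  assumes "h \<in> tuples"
  shows "dim V = N ^ (card orbs - 1) * dim (eigen h)"
proof -
  have "dim V = (\<Sum>h'\<in>tuples. dim (eigen h))"
    unfolding dim_sum_tuples using tuples_dim_eq[OF assms] by (intro sum.cong) auto
  then show ?thesis by (simp add: card_tuples)
qed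

lemma eigen_tuple_nontrivial:
  assumes "h \<in> tuples"
  shows "\<exists>v\<in>eigen h. v \<noteq> 0"
proof (rule ccontr)
  assume "\<not> ?thesis"
  moreover have "0 \<in> eigen h" using eigen_invariant[of h] subspace_0 by (auto simp: invariant_def)
  ultimately have "eigen h = {0}" by auto
  then show False using dim_eigen_tuple[OF assms] dim_V_pos by (simp add: dim_zero_space)
qed

text \<open>Comparison of \<open>m d = dim W\<^sub>h = N\<^bsup>F + 1 - n\<^esup>\<close> with \<open>d\<^sup>2 = N\<^bsup>E - n\<^esup>\<close>.\<close>

lemma multiplicity_power:
  assumes dimV: "dim V = N ^ card (faces D)" and h: "h \<in> tuples" and N1: "N > 1"
    and d: "d\<^sup>2 * N ^ card orbs = N ^ card (edges D)" and m: "dim (eigen h) = m * d"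
  shows "\<exists>\<gamma>. 2 * card (faces D) + 2 = card (edges D) + card orbs + 2 * \<gamma> \<and> m = N ^ \<gamma>"
proof -
  let ?n = "card orbs" and ?E = "card (edges D)" and ?F = "card (faces D)"
  have n: "?n > 0" using orbs_nonempty finite_orbs by (simp add: card_gt_0_iff)
  have Nn: "N * N ^ (?n - 1) = N ^ ?n" using n by (metis Suc_diff_1 power_Suc)
  have "N ^ ?F * N = m * d * N ^ ?n"
    using dim_eigen_tuple[OF h] dimV m Nn by (simp add: mult_ac)
  then have "(N ^ ?F * N)\<^sup>2 = (m * d * N ^ ?n)\<^sup>2" by simp
  moreover have "N ^ (2 * ?F + 2) = (N ^ ?F * N)\<^sup>2"
    by (simp add: power2_eq_square power_add mult_2)
  moreover have "(m * d * N ^ ?n)\<^sup>2 = m\<^sup>2 * (d\<^sup>2 * N ^ ?n) * N ^ ?n"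
    by (simp add: power2_eq_square)
  ultimately have "N ^ (2 * ?F + 2) = m\<^sup>2 * (d\<^sup>2 * N ^ ?n) * N ^ ?n" by simp
  then have eq: "N ^ (2 * ?F + 2) = m\<^sup>2 * N ^ (?E + ?n)"
    unfolding d by (simp add: power_add mult_ac)
  \<comment> \<open>A nonzero multiplicity bounds the exponents, which is the nonnegativity of the
    genus.\<close>
  then have "m \<noteq> 0" using N1 by (metis mult_zero_left not_one_less_zero power_eq_0_iff power_zero_numeral)
  then have "N ^ (?E + ?n) \<le> N ^ (2 * ?F + 2)" unfolding eq by simp
  then have le: "?E + ?n \<le> 2 * ?F + 2" using N1 by (simp only: power_increasing_iff)
  have "even (2 * ?F + 2 - (?E + ?n))" using even_edges_orbs by (intro dvd_diff_nat) simp_all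
  then obtain \<gamma> where "2 * ?F + 2 - (?E + ?n) = 2 * \<gamma>" by (rule dvdE)
  then have g: "2 * ?F + 2 = ?E + ?n + 2 * \<gamma>" using le by simp
  have "N ^ (?E + ?n + 2 * \<gamma>) = (N ^ \<gamma>)\<^sup>2 * N ^ (?E + ?n)"
    by (simp add: power_add power_mult[symmetric] mult.commute)
  then have "m\<^sup>2 * N ^ (?E + ?n) = (N ^ \<gamma>)\<^sup>2 * N ^ (?E + ?n)"
    using eq unfolding g by (simp only:)
  then have "m\<^sup>2 = (N ^ \<gamma>)\<^sup>2" using N_pos by simp
  then have "m = N ^ \<gamma>" by (simp add: power2_eq_iff_nonneg)
  then show ?thesis using g by blast
qed

end

section \<open>Representations as twisted modules\<close>

lemma weyl_0: "weyl 0 = torus_one"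
  by (simp add: torus_one_def zero_fun_def)

lemma single_scale: "Poly_Mapping.single k c = torus_scale c (weyl k)"
  by (simp add: weyl_def torus_scale_single)

lemma poly_mapping_sum_single:
  "(\<Sum>k\<in>Poly_Mapping.keys x. Poly_Mapping.single k (Poly_Mapping.lookup x k)) = x"
proof (rule poly_mapping_eqI)
  fix l
  have "Poly_Mapping.lookup (\<Sum>k\<in>Poly_Mapping.keys x. Poly_Mapping.single k (Poly_Mapping.lookup x k)) l =
      (\<Sum>k\<in>Poly_Mapping.keys x. if k = l then Poly_Mapping.lookup x l else 0)"
    by (simp add: lookup_sum lookup_single when_def)
  also have "\<dots> = Poly_Mapping.lookup x l"
    by (simp add: in_keys_iff)
  finally show "Poly_Mapping.lookup (\<Sum>k\<in>Poly_Mapping.keys x. Poly_Mapping.single k (Poly_Mapping.lookup x k)) l =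
      Poly_Mapping.lookup x l" .
qed

lemma balanced_plus: "k \<in> balanced D \<Longrightarrow> l \<in> balanced D \<Longrightarrow> (\<lambda>e. k e + l e) \<in> balanced D"
  by (auto simp: balanced_sides)

lemma balanced_0: "(\<lambda>_. 0) \<in> balanced D"
  by (simp add: balanced_def)

text \<open>Products of balanced monomials are again balanced monomials up to scalars, so the
  generated algebra stays within their linear span.\<close>

lemma keys_balanced_algebra:
  "x \<in> balanced_algebra \<omega> D \<Longrightarrow> Poly_Mapping.keys x \<subseteq> balanced D"
proof (induction rule: balanced_algebra.induct)
  case (monomial k)
  then show ?case by (simp add: weyl_def)
next
  case one
  then show ?case by (simp add: torus_one_def weyl_def balanced_0)
next
  case (add x y)
  then show ?case using Poly_Mapping.keys_add[of x y] by blast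
next
  case (scale x c)
  have "Poly_Mapping.keys (torus_scale c x) \<subseteq> Poly_Mapping.keys x"
    by (auto simp: torus_scale_def in_keys_iff Poly_Mapping.map.rep_eq when_def)
  then show ?case using scale by blast
next
  case (mult x y)
  show ?case
    unfolding torus_mult_def
  proof
    fix m assume "m \<in> Poly_Mapping.keys (\<Sum>k\<in>Poly_Mapping.keys x. \<Sum>l\<in>Poly_Mapping.keys y.
        Poly_Mapping.single (\<lambda>e. k e + l e) (Poly_Mapping.lookup x k * Poly_Mapping.lookup y l * \<omega> powi form D k l))"
    then have "(\<Sum>k\<in>Poly_Mapping.keys x. \<Sum>l\<in>Poly_Mapping.keys y.
        Poly_Mapping.lookup (Poly_Mapping.single (\<lambda>e. k e + l e)
          (Poly_Mapping.lookup x k * Poly_Mapping.lookup y l * \<omega> powi form D k l)) m) \<noteq> 0"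
      by (simp add: in_keys_iff lookup_sum)
    then obtain k where k: "k \<in> Poly_Mapping.keys x" "(\<Sum>l\<in>Poly_Mapping.keys y.
        Poly_Mapping.lookup (Poly_Mapping.single (\<lambda>e. k e + l e)
          (Poly_Mapping.lookup x k * Poly_Mapping.lookup y l * \<omega> powi form D k l)) m) \<noteq> 0"
      by (meson sum.not_neutral_contains_not_neutral)
    then obtain l where l: "l \<in> Poly_Mapping.keys y" "Poly_Mapping.lookup (Poly_Mapping.single (\<lambda>e. k e + l e)
          (Poly_Mapping.lookup x k * Poly_Mapping.lookup y l * \<omega> powi form D k l)) m \<noteq> 0"
      by (meson sum.not_neutral_contains_not_neutral)
    have "m = (\<lambda>e. k e + l e)" using l(2) by (simp add: lookup_single when_def split: if_splits)
    then show "m \<in> balanced D" using mult k(1) l(1) balanced_plus by blast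
  qed
qed

lemma zero_balanced_algebra: "0 \<in> balanced_algebra \<omega> D"
proof -
  have "torus_scale 0 torus_one = (0 :: 'e torus)"
    by (simp add: torus_one_def weyl_def torus_scale_single)
  then show ?thesis using balanced_algebra.scale[OF balanced_algebra.one] by metis
qed

lemma sum_single_balanced_algebra:
  assumes "finite I" "\<And>i. i \<in> I \<Longrightarrow> \<kappa> i \<in> balanced D"
  shows "(\<Sum>i\<in>I. Poly_Mapping.single (\<kappa> i) (c i)) \<in> balanced_algebra \<omega> D"
  using assms
proof (induction I rule: finite_induct)
  case empty
  then show ?case by (simp add: zero_balanced_algebra)
next
  case (insert i I)
  then show ?case
    by (simp add: single_scale balanced_algebra.intros)
qed

lemma representation_sum_single:
  assumes rep: "representation \<omega> D sv V r" and vs: "vector_space sv" and v: "v \<in> V"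
    and I: "finite I" "\<And>i. i \<in> I \<Longrightarrow> \<kappa> i \<in> balanced D"
  shows "r (\<Sum>i\<in>I. Poly_Mapping.single (\<kappa> i) (c i)) v = (\<Sum>i\<in>I. sv (c i) (r (weyl (\<kappa> i)) v))"
  using I
proof (induction I rule: finite_induct)
  case empty
  interpret vector_space sv by (rule vs)
  have "r (torus_scale 0 torus_one) v = sv 0 (r torus_one v)"
    using rep v balanced_algebra.one unfolding Defs.representation_def by blast
  moreover have "torus_scale 0 torus_one = (0 :: 'b torus)"
    by (simp add: torus_one_def weyl_def torus_scale_single)
  ultimately show ?case by simp
next
  case (insert i I)
  have mon: "weyl (\<kappa> i) \<in> balanced_algebra \<omega> D" using insert.prems by (simp add: balanced_algebra.monomial)
  have "r (torus_scale (c i) (weyl (\<kappa> i)) + (\<Sum>i\<in>I. Poly_Mapping.single (\<kappa> i) (c i))) v =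
      r (torus_scale (c i) (weyl (\<kappa> i))) v + r (\<Sum>i\<in>I. Poly_Mapping.single (\<kappa> i) (c i)) v"
    using rep v balanced_algebra.scale[OF mon] sum_single_balanced_algebra[OF insert.hyps(1)] insert.prems
    unfolding Defs.representation_def by blast
  moreover have "r (torus_scale (c i) (weyl (\<kappa> i))) v = sv (c i) (r (weyl (\<kappa> i)) v)"
    using rep v mon unfolding Defs.representation_def by blast
  ultimately show ?case using insert by (simp add: single_scale)
qed

lemma representation_expand:
  assumes "representation \<omega> D sv V r" "vector_space sv" "v \<in> V" "x \<in> balanced_algebra \<omega> D"
  shows "r x v = (\<Sum>k\<in>Poly_Mapping.keys x. sv (Poly_Mapping.lookup x k) (r (weyl k) v))"
  using representation_sum_single[OF assms(1-3), of "Poly_Mapping.keys x" "\<lambda>k. k" "Poly_Mapping.lookup x"]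
    keys_balanced_algebra[OF assms(4)]
  by (simp add: poly_mapping_sum_single subset_iff)

context glued_pattern_mod
begin

abbreviation module_on where
  "module_on \<equiv> twisted_module (balanced D) (form D) N \<omega> (exponents_mod D N) (residue_reps D N)"

lemma representation_module:
  assumes vs: "vector_space sv" and rep: "representation \<omega> D sv V r"
  shows "module_on sv V (\<lambda>k. r (weyl k))"
proof -
  interpret vector_space sv by (rule vs)
  have mon: "weyl k \<in> balanced_algebra \<omega> D" if "k \<in> balanced D" for k
    using that by (rule balanced_algebra.monomial)
  show ?thesis
  proof unfold_locales
    show "subspace V" using rep by (simp add: Defs.representation_def)
    show "r (weyl k) v \<in> V" if "k \<in> balanced D" "v \<in> V" for k v
      using rep mon[OF that(1)] that(2) unfolding Defs.representation_def by blast
    show "linear_on sv V sv (r (weyl k))" if "k \<in> balanced D" for k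
      using rep mon[OF that] unfolding Defs.representation_def by blast
    show "r (weyl 0) v = v" if "v \<in> V" for v
      using rep that unfolding Defs.representation_def weyl_0 by blast
    fix k l v assume k: "k \<in> balanced D" and l: "l \<in> balanced D" and v: "v \<in> V"
    have "r (weyl k) (r (weyl l) v) = r (torus_mult \<omega> D (weyl k) (weyl l)) v"
      using rep mon[OF k] mon[OF l] v unfolding Defs.representation_def by metis
    also have "\<dots> = r (torus_scale (\<omega> powi form D k l) (weyl (k + l))) v"
      by (simp add: weyl_mult plus_fun_def)
    also have "\<dots> = sv (\<omega> powi form D k l) (r (weyl (k + l)) v)"
      using rep v mon[OF L.K_add[OF k l]] unfolding Defs.representation_def by blast
    finally show "r (weyl k) (r (weyl l) v) = sv (\<omega> powi form D k l) (r (weyl (k + l)) v)" .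
  qed
qed

text \<open>A twisted module extends linearly to the algebra; the cocycle in \<open>T_T\<close> is
  the one in \<open>torus_mult\<close>, which gives multiplicativity.\<close>

lemma module_representation:
  assumes mod: "module_on sv V T"
    and r: "\<And>x v. x \<in> balanced_algebra \<omega> D \<Longrightarrow> v \<in> V \<Longrightarrow>
      r x v = (\<Sum>k\<in>Poly_Mapping.keys x. sv (Poly_Mapping.lookup x k) (T k v))"
  shows "representation \<omega> D sv V r"
proof -
  interpret T: twisted_module "balanced D" "form D" N \<omega> "exponents_mod D N" "residue_reps D N" sv V T
    by (rule mod)
  define act where "act x v = (\<Sum>k\<in>Poly_Mapping.keys x. sv (Poly_Mapping.lookup x k) (T k v))" for x v
  have act_super: "act x v = (\<Sum>k\<in>A. sv (Poly_Mapping.lookup x k) (T k v))"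
    if "finite A" "Poly_Mapping.keys x \<subseteq> A" for x v A
    unfolding act_def using that by (intro sum.mono_neutral_left) (auto simp: in_keys_iff)
  have act_add: "act (x + y) v = act x v + act y v" for x y v
  proof -
    let ?A = "Poly_Mapping.keys x \<union> Poly_Mapping.keys y"
    show ?thesis
      using act_super[of ?A "x + y" v] act_super[of ?A x v] act_super[of ?A y v] Poly_Mapping.keys_add[of x y]
      by (simp add: lookup_add T.scale_left_distrib sum.distrib)
  qed
  have act_0: "act 0 v = 0" for v by (simp add: act_def)
  have act_sum: "act (\<Sum>i\<in>I. f i) v = (\<Sum>i\<in>I. act (f i) v)" for I :: "'x set" and f v
    by (induction I rule: infinite_finite_induct) (simp_all add: act_0 act_add)
  have act_scale: "act (torus_scale c x) v = sv c (act x v)" for c x v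
  proof -
    have "Poly_Mapping.keys (torus_scale c x) \<subseteq> Poly_Mapping.keys x"
      by (auto simp: torus_scale_def in_keys_iff Poly_Mapping.map.rep_eq when_def)
    moreover have "Poly_Mapping.lookup (torus_scale c x) k = c * Poly_Mapping.lookup x k" for k
      by (simp add: torus_scale_def Poly_Mapping.map.rep_eq when_def)
    ultimately show ?thesis
      using act_super[of "Poly_Mapping.keys x" "torus_scale c x" v]
      by (simp add: act_def T.scale_sum_right)
  qed
  have act_single: "act (Poly_Mapping.single k c) v = sv c (T k v)" for k c v
    by (cases "c = 0") (simp_all add: act_def)
  have keys: "k \<in> balanced D" if "x \<in> balanced_algebra \<omega> D" "k \<in> Poly_Mapping.keys x" for x k
    using keys_balanced_algebra that by blast
  have act_V: "act x v \<in> V" if "x \<in> balanced_algebra \<omega> D" "v \<in> V" for x v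
    unfolding act_def using that keys T.T_V T.V by (intro T.subspace_sum T.subspace_scale) auto
  have act_linear: "linear_on sv V sv (act x)" if x: "x \<in> balanced_algebra \<omega> D" for x
    unfolding linear_on_def
  proof (intro conjI ballI allI)
    fix v w assume vw: "v \<in> V" "w \<in> V"
    show "act x (v + w) = act x v + act x w"
      unfolding act_def sum.distrib[symmetric] T.scale_right_distrib[symmetric]
      by (intro sum.cong refl arg_cong2[of _ _ _ _ sv] T.T_add keys[OF x] vw)
  next
    fix c v assume v: "v \<in> V"
    show "act x (sv c v) = sv c (act x v)"
      unfolding act_def T.scale_sum_right using keys[OF x] v
      by (intro sum.cong refl) (simp add: T.T_scale mult.commute)
  qed
  have act_mult: "act (torus_mult \<omega> D x y) v = act x (act y v)"
    if x: "x \<in> balanced_algebra \<omega> D" and y: "y \<in> balanced_algebra \<omega> D" and v: "v \<in> V" for x y v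
  proof -
    have "act x (act y v) = (\<Sum>k\<in>Poly_Mapping.keys x. \<Sum>l\<in>Poly_Mapping.keys y.
        sv (Poly_Mapping.lookup x k) (sv (Poly_Mapping.lookup y l) (T k (T l v))))"
      unfolding act_def[of x]
    proof (intro sum.cong refl)
      fix k assume k: "k \<in> Poly_Mapping.keys x"
      have "T k (act y v) = (\<Sum>l\<in>Poly_Mapping.keys y. T k (sv (Poly_Mapping.lookup y l) (T l v)))"
        unfolding act_def using keys[OF x k] keys[OF y] T.T_V v T.V
        by (intro T.T_sum T.subspace_scale) auto
      also have "\<dots> = (\<Sum>l\<in>Poly_Mapping.keys y. sv (Poly_Mapping.lookup y l) (T k (T l v)))"
        using keys[OF x k] keys[OF y] T.T_V v by (intro sum.cong refl T.T_scale) auto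
      finally show "sv (Poly_Mapping.lookup x k) (T k (act y v)) = (\<Sum>l\<in>Poly_Mapping.keys y.
        sv (Poly_Mapping.lookup x k) (sv (Poly_Mapping.lookup y l) (T k (T l v))))"
        by (simp only: T.scale_sum_right)
    qed
    also have "\<dots> = (\<Sum>k\<in>Poly_Mapping.keys x. \<Sum>l\<in>Poly_Mapping.keys y.
        sv (Poly_Mapping.lookup x k * Poly_Mapping.lookup y l * \<omega> powi form D k l) (T (\<lambda>e. k e + l e) v))"
      using keys[OF x] keys[OF y] v
      by (intro sum.cong refl) (simp add: T.T_T plus_fun_def mult.assoc)
    also have "\<dots> = act (torus_mult \<omega> D x y) v"
      unfolding torus_mult_def by (simp only: act_sum act_single)
    finally show ?thesis ..
  qed
  have r_act: "r x v = act x v" if "x \<in> balanced_algebra \<omega> D" "v \<in> V" for x v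
    using r[OF that] by (simp add: act_def)
  have act_one: "act torus_one v = v" if "v \<in> V" for v
    using act_single[of 0 1 v] T.T_0[OF that] by (simp add: weyl_def flip: weyl_0)
  note B = balanced_algebra.add balanced_algebra.scale balanced_algebra.mult balanced_algebra.one
  have "r x \<in> V \<rightarrow> V \<and> linear_on sv V sv (r x)" if x: "x \<in> balanced_algebra \<omega> D" for x
  proof
    show "r x \<in> V \<rightarrow> V" using r_act[OF x] act_V[OF x] by simp
    show "linear_on sv V sv (r x)"
      using act_linear[OF x] r_act[OF x] T.subspace_add[OF T.V] T.subspace_scale[OF T.V]
      by (simp add: linear_on_def)
  qed
  then show ?thesis
    unfolding Defs.representation_def
  proof (intro conjI ballI allI)
    show "T.subspace V" by (rule T.V)
    fix v assume v: "v \<in> V"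
    show "r torus_one v = v" using r_act[OF balanced_algebra.one v] act_one[OF v] by simp
    fix x assume x: "x \<in> balanced_algebra \<omega> D"
    show "r (torus_scale c x) v = sv c (r x v)" for c
      using r_act[OF balanced_algebra.scale[OF x] v] r_act[OF x v] act_scale by simp
    fix y assume y: "y \<in> balanced_algebra \<omega> D"
    show "r (x + y) v = r x v + r y v"
      using r_act[OF balanced_algebra.add[OF x y] v] r_act[OF x v] r_act[OF y v] act_add by simp
    show "r (torus_mult \<omega> D x y) v = r x (r y v)"
      using r_act[OF balanced_algebra.mult[OF x y] v] r_act[OF y v] r_act[OF x act_V[OF y v]] act_mult[OF x y v]
      by simp
  qed blast+
qed

end

locale pattern_representation = glued_pattern_mod D g N \<omega>
  for D :: "('f, 'e) pattern" and g N \<omega> +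
  fixes sv :: "complex \<Rightarrow> 'v::ab_group_add \<Rightarrow> 'v" and V :: "'v set" and r
  assumes vs: "vector_space sv" and rep: "Defs.representation \<omega> D sv V r"
begin

sublocale pattern_module D g N \<omega> sv V "\<lambda>k. r (weyl k)"
  by (intro pattern_module.intro representation_module vs rep glued_pattern_mod_axioms)

lemma expand:
  "x \<in> balanced_algebra \<omega> D \<Longrightarrow> v \<in> V \<Longrightarrow>
    r x v = (\<Sum>k\<in>Poly_Mapping.keys x. sv (Poly_Mapping.lookup x k) (r (weyl k) v))"
  by (rule representation_expand[OF rep vs])

lemma submodule_iff: "submodule \<omega> D sv V r U \<longleftrightarrow> invariant U"
proof
  assume "submodule \<omega> D sv V r U"
  then show "invariant U"
    using balanced_algebra.monomial unfolding submodule_def invariant_def by blast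
next
  assume U: "invariant U"
  then have *: "subspace U" "U \<subseteq> V" "\<And>k u. k \<in> balanced D \<Longrightarrow> u \<in> U \<Longrightarrow> r (weyl k) u \<in> U"
    by (auto simp: invariant_def)
  have "r x u \<in> U" if x: "x \<in> balanced_algebra \<omega> D" and u: "u \<in> U" for x u
  proof -
    have "k \<in> balanced D" if "k \<in> Poly_Mapping.keys x" for k
      using keys_balanced_algebra[OF x] that by blast
    moreover have "u \<in> V" using u * by auto
    ultimately show ?thesis
      unfolding expand[OF x \<open>u \<in> V\<close>] using u * by (intro subspace_sum subspace_scale) auto
  qed
  then show "submodule \<omega> D sv V r U" using * by (auto simp: submodule_def)
qed

lemma representation_invariant:
  assumes "invariant U"
  shows "Defs.representation \<omega> D sv U r"
proof (rule module_representation)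
  show "module_on sv U (\<lambda>k. r (weyl k))" by (rule invariant_module[OF assms])
  show "r x v = (\<Sum>k\<in>Poly_Mapping.keys x. sv (Poly_Mapping.lookup x k) (r (weyl k) v))"
    if "x \<in> balanced_algebra \<omega> D" "v \<in> U" for x v
    using that assms by (intro expand) (auto simp: invariant_def)
qed

lemma irreducible_iff: "irreducible_rep \<omega> D sv V r \<longleftrightarrow> simple V"
  unfolding irreducible_rep_def simple_def submodule_iff
  using rep invariant_V by (auto simp: invariant_def)

lemma simple_submodule_iff: "simple_submodule \<omega> D sv V r X \<longleftrightarrow> simple X"
proof
  assume X: "simple_submodule \<omega> D sv V r X"
  then have inv: "invariant X" by (simp add: simple_submodule_def submodule_iff)
  interpret X: pattern_representation D g N \<omega> sv X r
    by (intro pattern_representation.intro pattern_representation_axioms.intro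
        representation_invariant inv vs glued_pattern_mod_axioms)
  have "X.simple X" using X X.irreducible_iff by (simp add: simple_submodule_def)
  then show "simple X" using simple_simple[OF inv] by simp
next
  assume X: "simple X"
  then have inv: "invariant X" by (simp add: simple_def)
  interpret X: pattern_representation D g N \<omega> sv X r
    by (intro pattern_representation.intro pattern_representation_axioms.intro
        representation_invariant inv vs glued_pattern_mod_axioms)
  have "X.simple X" using X simple_simple[OF inv] by simp
  then show "simple_submodule \<omega> D sv V r X"
    using X.irreducible_iff inv by (simp add: simple_submodule_def submodule_iff)
qed

lemma simple_decomposition_iff:
  "simple_decomposition \<omega> D sv V r Bs \<longleftrightarrow> (\<forall>X\<in>Bs. simple X) \<and> direct_sum Bs (\<lambda>X. X) V"
proof -
  have "subspace X" "X \<subseteq> V" if "simple X" for X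
    using that by (simp_all add: simple_def invariant_def)
  then show ?thesis
    unfolding simple_decomposition_def direct_sum_def simple_submodule_iff by meson
qed

end

section \<open>Isomorphisms and embeddings of representations\<close>

locale representation_pair =
  D: pattern_representation D g N \<omega> sv V r + C: pattern_representation D g N \<omega> sw W R
  for D :: "('f, 'e) pattern" and g N \<omega>
    and sv :: "complex \<Rightarrow> 'v::ab_group_add \<Rightarrow> 'v" and V r
    and sw :: "complex \<Rightarrow> 'w::ab_group_add \<Rightarrow> 'w" and W R
begin

sublocale twisted_module_pair "balanced D" "form D" N \<omega> "exponents_mod D N" "residue_reps D N"
    sv V "\<lambda>k. r (weyl k)" sw W "\<lambda>k. R (weyl k)" ..

lemma isomorphic_iff:
  "isomorphic_reps \<omega> D sv V r sw W R \<longleftrightarrow> (\<exists>\<phi>. intertwiner \<phi> \<and> bij_betw \<phi> V W)"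
proof
  assume "isomorphic_reps \<omega> D sv V r sw W R"
  then obtain \<phi> where \<phi>: "linear_on sv V sw \<phi>" "bij_betw \<phi> V W"
    "\<And>x v. x \<in> balanced_algebra \<omega> D \<Longrightarrow> v \<in> V \<Longrightarrow> \<phi> (r x v) = R x (\<phi> v)"
    unfolding isomorphic_reps_def by blast
  have "intertwiner \<phi>"
    unfolding intertwiner_def
  proof (intro conjI ballI)
    show "\<phi> \<in> V \<rightarrow> W" by (rule bij_betw_imp_funcset[OF \<phi>(2)])
    show "linear_on sv V sw \<phi>" by (rule \<phi>(1))
    fix k v assume "k \<in> balanced D" "v \<in> V"
    then show "\<phi> (r (weyl k) v) = R (weyl k) (\<phi> v)"
      by (rule \<phi>(3)[OF balanced_algebra.monomial])
  qed
  with \<phi>(2) show "\<exists>\<phi>. intertwiner \<phi> \<and> bij_betw \<phi> V W" by (intro exI conjI)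
next
  assume "\<exists>\<phi>. intertwiner \<phi> \<and> bij_betw \<phi> V W"
  then obtain \<phi> where \<phi>: "intertwiner \<phi>" "bij_betw \<phi> V W" by blast
  interpret \<phi>: linear_map_on sv sw V \<phi> by (rule intertwinerD(1)[OF \<phi>(1)])
  have "\<phi> (r x v) = R x (\<phi> v)" if x: "x \<in> balanced_algebra \<omega> D" and v: "v \<in> V" for x v
  proof -
    have k: "k \<in> balanced D" if "k \<in> Poly_Mapping.keys x" for k
      using keys_balanced_algebra[OF x] that by blast
    have "\<phi> (r x v) = (\<Sum>k\<in>Poly_Mapping.keys x. \<phi> (sv (Poly_Mapping.lookup x k) (r (weyl k) v)))"
      unfolding D.expand[OF x v] using k D.T_V v D.V by (intro \<phi>.map_sum D.subspace_scale) auto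
    also have "\<dots> = (\<Sum>k\<in>Poly_Mapping.keys x. sw (Poly_Mapping.lookup x k) (R (weyl k) (\<phi> v)))"
      using k D.T_V v intertwinerD(3)[OF \<phi>(1)]
      by (intro sum.cong refl) (simp add: linear_on_scale[OF \<phi>.linear])
    also have "\<dots> = R x (\<phi> v)"
      using C.expand[OF x] intertwinerD(2)[OF \<phi>(1) v] by simp
    finally show ?thesis .
  qed
  then show "isomorphic_reps \<omega> D sv V r sw W R"
    using \<phi> \<phi>.linear unfolding isomorphic_reps_def by blast
qed

text \<open>A coordinate functional of a basis of \<open>V\<close> times the vector \<open>w\<close>
  is a nonzero linear map, which suffices to produce a nonzero intertwiner; simplicity makes it
  injective.\<close>

lemma simple_embedding:
  assumes simple: "D.simple V" and scalars: "same_scalars D.L.radical" and w: "w \<in> W" "w \<noteq> 0"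
  shows "\<exists>\<phi>. intertwiner \<phi> \<and> inj_on \<phi> V"
proof -
  obtain b where b: "b \<subseteq> V" "D.independent b" "V \<subseteq> D.span b"
    using D.maximal_independent_subset by blast
  have "b \<noteq> {}" using b(3) simple D.V D.subspace_0 by (auto simp: D.simple_def)
  then obtain c where c: "c \<in> b" by auto
  define f where "f v = sw (D.representation b v c) w" for v
  have "f \<in> V \<rightarrow> W" using w C.V C.subspace_scale by (auto simp: f_def)
  moreover have "linear_on sv V sw f"
    using b D.representation_add[OF b(2)] D.representation_scale[OF b(2)]
    by (auto simp: linear_on_def f_def C.scale_left_distrib subset_iff)
  moreover have "f c \<noteq> 0"
    using w c D.representation_basis[OF b(2) c] by (simp add: f_def)
  moreover have "c \<in> V" using c b by auto
  ultimately obtain \<phi> v where "intertwiner \<phi>" "v \<in> V" "\<phi> v \<noteq> 0"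
    using exists_nonzero_intertwiner scalars by blast
  then show ?thesis using simple_intertwiner_inj simple by blast
qed

end

section \<open>The decomposition theorem in terms of a glued pattern\<close>

text \<open>\<open>\<rho>\<close>, \<open>h\<^sub>C\<close> and \<open>R'\<close> are the shadow, the central charge and the representation of the
  split algebra from which \<open>R\<close> is obtained.\<close>

locale local_representation_module = pattern_representation D g N \<omega> sv V R +
  split_module D g N \<omega> sv V "\<lambda>k. R (weyl k)" \<rho> "\<lambda>k. R' (weyl k)" h\<^sub>C b\<^sub>0
  for D :: "('f, 'e) pattern" and g N \<omega>
    and sv :: "complex \<Rightarrow> 'v::ab_group_add \<Rightarrow> 'v" and V R \<rho> R' h\<^sub>C b\<^sub>0 +
  assumes N_gt_1: "N > 1" and dim_V: "dim V = N ^ card (faces D)"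
begin

lemma tuple_of_simple:
  assumes "simple X"
  shows "\<exists>h\<in>tuples. X \<subseteq> eigen h"
proof -
  obtain h where h: "X \<subseteq> eigen h" using simple_eigen[OF assms] by blast
  have X: "invariant X" "X \<noteq> {0}" using assms by (auto simp: simple_def)
  then obtain v where v: "v \<in> X" "v \<noteq> 0" using subspace_0 unfolding invariant_def by blast
  then have vh: "v \<in> eigen h" and vV: "v \<in> V" using h X by (auto simp: invariant_def)
  \<comment> \<open>Members of \<open>tuples\<close> are undefined outside of the orbits, whereas
    \<open>eigen\<close> depends only on the values on orbits.\<close>
  let ?h = "restrict h orbs"
  have "h C ^ N = \<rho> (loop_exponent C)" if C: "C \<in> orbs" for C
  proof -
    have "(R (weyl (loop_exponent C)) ^^ n) v = sv (h C ^ n) v" for n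
      using vh C vV by (induction n) (auto simp: eigen_def T_scale[OF loop_balanced] mult.commute)
    then have "sv (h C ^ N) v = sv (\<rho> (loop_exponent C)) v"
      using T_pow[OF loop_balanced vV, of N C] shadow[OF loop_balanced vV] by simp
    then show ?thesis using v by simp
  qed
  then have "?h \<in> (\<Pi>\<^sub>E C\<in>orbs. shadow_roots C)" by (simp add: shadow_roots_def)
  moreover have eq: "eigen ?h = eigen h" by (rule eigen_cong) simp
  ultimately have "?h \<in> tuples" using eigen_not_tuple[of ?h] vh v by auto
  then show ?thesis using h eq by blast
qed

text \<open>For both modules \<open>eigen_radical\<close> gives the same formula in terms of the
  shadow, \<open>h\<close> and the coordinates of \<open>c\<close>.\<close>

lemma eigen_same_scalars:
  assumes rep: "Defs.representation \<omega> D sw U r" "vector_space sw"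
    and shadow': "\<And>k u. k \<in> balanced D \<Longrightarrow> u \<in> U \<Longrightarrow> r (weyl (\<lambda>x. int N * k x)) u = sw (\<rho> k) u"
    and h: "\<And>C u. C \<in> orbs \<Longrightarrow> u \<in> U \<Longrightarrow> r (weyl (loop_exponent C)) u = sw (h C) u"
    and c: "c \<in> L.radical"
  shows "\<exists>z. (\<forall>u\<in>U. r (weyl c) u = sw z u) \<and> (\<forall>w\<in>eigen h. R (weyl c) w = sv z w)"
proof -
  interpret U: pattern_representation D g N \<omega> sw U r
    by (intro pattern_representation.intro pattern_representation_axioms.intro rep glued_pattern_mod_axioms)
  obtain k where k: "k \<in> balanced D" "c - spread (coords c) = (\<lambda>x. int N * k x)"
    using exponents_mod_divide[OF coords_spread[OF c] odd_N] by blast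
  have "U.eigen h = U" using h by (auto simp: U.eigen_def)
  then have "r (weyl c) u = sw (\<rho> k * (\<Prod>C\<in>orbs. h C ^ nat (coords c C))) u" if "u \<in> U" for u
    using U.eigen_radical[OF _ c shadow' k] that by blast
  moreover have "R (weyl c) w = sv (\<rho> k * (\<Prod>C\<in>orbs. h C ^ nat (coords c C))) w" if "w \<in> eigen h" for w
    by (rule eigen_radical[OF that c shadow k])
  ultimately show ?thesis by blast
qed

text \<open>From right to left: the eigenspace of the given invariants is nonzero, since all tuples
  with product \<open>h\<^sub>C\<close> occur, and the radical acts on it by the same scalars as on
  \<open>U\<close>, so \<open>U\<close> embeds into it.\<close>

lemma embeds_iff:
  assumes rep: "irreducible_rep \<omega> D sw U r" "vector_space sw"
  shows "(\<exists>X. simple_submodule \<omega> D sv V R X \<and> isomorphic_reps \<omega> D sw U r sv X R) \<longleftrightarrow>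
    (\<forall>k\<in>balanced D. \<forall>u\<in>U. r (weyl (\<lambda>x. int N * k x)) u = sw (\<rho> k) u) \<and>
    (\<exists>h. (\<forall>C\<in>orbs. \<forall>u\<in>U. r (weyl (loop_exponent C)) u = sw (h C) u) \<and> (\<Prod>C\<in>orbs. h C) = h\<^sub>C)"
    (is "?L \<longleftrightarrow> ?R")
proof -
  have rep': "Defs.representation \<omega> D sw U r" using rep by (simp add: irreducible_rep_def)
  interpret U: pattern_representation D g N \<omega> sw U r
    by (intro pattern_representation.intro pattern_representation_axioms.intro rep rep' glued_pattern_mod_axioms)
  have simpleU: "U.simple U" using U.irreducible_iff rep by simp
  show ?thesis
  proof
    assume ?L
    then obtain X where X: "simple X" "isomorphic_reps \<omega> D sw U r sv X R"
      by (auto simp: simple_submodule_iff)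
    then have inv: "invariant X" by (simp add: simple_def)
    interpret X: pattern_representation D g N \<omega> sv X R
      by (intro pattern_representation.intro pattern_representation_axioms.intro
          representation_invariant inv vs glued_pattern_mod_axioms)
    interpret UX: representation_pair D g N \<omega> sw U r sv X R ..
    obtain \<phi> where \<phi>: "UX.intertwiner \<phi>" "bij_betw \<phi> U X" using X(2) UX.isomorphic_iff by blast
    note \<phi>D = UX.intertwinerD[OF \<phi>(1)]
    have transfer: "r (weyl k) u = sw z u"
      if "k \<in> balanced D" "u \<in> U" "R (weyl k) (\<phi> u) = sv z (\<phi> u)" for k u z
    proof -
      have "\<phi> (r (weyl k) u) = \<phi> (sw z u)"
        using \<phi>D(3)[OF that(1,2)] that linear_on_scale[OF linear_map_on.linear[OF \<phi>D(1)]] by simp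
      then show ?thesis
        using \<phi>(2) U.T_V[OF that(1,2)] U.subspace_scale[OF U.V that(2)]
        by (auto simp: bij_betw_def dest: inj_onD)
    qed
    have XV: "X \<subseteq> V" using inv by (simp add: invariant_def)
    obtain h where h: "h \<in> tuples" "X \<subseteq> eigen h" using tuple_of_simple[OF X(1)] by blast
    show ?R
    proof (intro conjI ballI exI[of _ h])
      fix k u assume "k \<in> balanced D" "u \<in> U"
      then show "r (weyl (\<lambda>x. int N * k x)) u = sw (\<rho> k) u"
        using shadow \<phi>D(2) XV by (intro transfer multiple_balanced) auto
    next
      fix C u assume "C \<in> orbs" "u \<in> U"
      then show "r (weyl (loop_exponent C)) u = sw (h C) u"
        using h(2) \<phi>D(2) by (intro transfer loop_balanced) (auto simp: eigen_def)
    next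
      show "(\<Prod>C\<in>orbs. h C) = h\<^sub>C" using h(1) by (simp add: tuples_def)
    qed
  next
    assume ?R
    then obtain h where shadow': "\<And>k u. k \<in> balanced D \<Longrightarrow> u \<in> U \<Longrightarrow> r (weyl (\<lambda>x. int N * k x)) u = sw (\<rho> k) u"
      and h: "\<And>C u. C \<in> orbs \<Longrightarrow> u \<in> U \<Longrightarrow> r (weyl (loop_exponent C)) u = sw (h C) u" "(\<Prod>C\<in>orbs. h C) = h\<^sub>C"
      by blast
    obtain u where u: "u \<in> U" "u \<noteq> 0" using simpleU U.V U.subspace_0 by (auto simp: U.simple_def)
    have "h C ^ N = \<rho> (loop_exponent C)" if C: "C \<in> orbs" for C
    proof -
      have "(r (weyl (loop_exponent C)) ^^ n) u = sw (h C ^ n) u" for n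
        using h(1)[OF C] u by (induction n) (auto simp: U.T_scale[OF loop_balanced] mult.commute)
      then have "sw (h C ^ N) u = sw (\<rho> (loop_exponent C)) u"
        using U.T_pow[OF loop_balanced u(1), of N C] shadow'[OF loop_balanced u(1)] by simp
      then show ?thesis using u by simp
    qed
    then have t: "restrict h orbs \<in> tuples"
      using h(2) by (simp add: tuples_def shadow_roots_def)
    have eq: "eigen (restrict h orbs) = eigen h" by (rule eigen_cong) simp
    obtain w where w: "w \<in> eigen h" "w \<noteq> 0" using eigen_tuple_nontrivial[OF t] eq by auto
    have inv: "invariant (eigen h)" by (rule eigen_invariant)
    interpret E: pattern_representation D g N \<omega> sv "eigen h" R
      by (intro pattern_representation.intro pattern_representation_axioms.intro
          representation_invariant inv vs glued_pattern_mod_axioms)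
    interpret UE: representation_pair D g N \<omega> sw U r sv "eigen h" R ..
    have "UE.same_scalars L.radical"
      unfolding UE.same_scalars_def using eigen_same_scalars[OF rep' rep(2) shadow' h(1)] by blast
    then obtain \<phi> where \<phi>: "UE.intertwiner \<phi>" "inj_on \<phi> U"
      using UE.simple_embedding[OF simpleU _ w] by blast
    let ?X = "\<phi> ` U"
    note \<phi>D = UE.intertwinerD[OF \<phi>(1)]
    have "\<phi> 0 = 0" by (rule linear_map_on.map_0[OF \<phi>D(1)])
    then have "\<phi> u \<noteq> 0" using inj_onD[OF \<phi>(2), of u 0] u U.subspace_0[OF U.V] by auto
    then have "E.simple ?X" by (rule UE.simple_image[OF \<phi>(1) simpleU u(1)])
    moreover have "?X \<subseteq> eigen h" using \<phi>D(2) by auto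
    ultimately have X: "simple ?X" using simple_simple[OF inv] by simp
    then have invX: "invariant ?X" by (simp add: simple_def)
    interpret X: pattern_representation D g N \<omega> sv ?X R
      by (intro pattern_representation.intro pattern_representation_axioms.intro
          representation_invariant invX vs glued_pattern_mod_axioms)
    interpret UX: representation_pair D g N \<omega> sw U r sv ?X R ..
    have "UX.intertwiner \<phi>"
      using \<phi>(1) by (auto simp: UX.intertwiner_def UE.intertwiner_def)
    then have "isomorphic_reps \<omega> D sw U r sv ?X R"
      using UX.isomorphic_iff \<phi>(2) by (auto simp: bij_betw_def)
    then show ?L using X by (auto simp: simple_submodule_iff)
  qed
qed

text \<open>Loop eigenvalues are preserved by isomorphisms; conversely, together with the common
  shadow they fix the scalars of the radical and hence the simple module.\<close>

lemma isomorphic_simple_iff: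
  assumes X: "simple X" "X \<subseteq> eigen h" and Y: "simple Y"
  shows "isomorphic_reps \<omega> D sv X R sv Y R \<longleftrightarrow> Y \<subseteq> eigen h"
proof -
  have inv: "invariant X" "invariant Y" using X Y by (auto simp: simple_def)
  interpret X: pattern_representation D g N \<omega> sv X R
    by (intro pattern_representation.intro pattern_representation_axioms.intro
        representation_invariant inv vs glued_pattern_mod_axioms)
  interpret Y: pattern_representation D g N \<omega> sv Y R
    by (intro pattern_representation.intro pattern_representation_axioms.intro
        representation_invariant inv vs glued_pattern_mod_axioms)
  interpret XY: representation_pair D g N \<omega> sv X R sv Y R ..
  have XV: "X \<subseteq> V" "Y \<subseteq> V" using inv by (auto simp: invariant_def)
  have simple: "X.simple X" "Y.simple Y" using simple_simple[OF inv(1)] simple_simple[OF inv(2)] X Y by auto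
  show ?thesis
  proof
    assume "isomorphic_reps \<omega> D sv X R sv Y R"
    then obtain \<phi> where \<phi>: "XY.intertwiner \<phi>" "bij_betw \<phi> X Y" using XY.isomorphic_iff by blast
    note \<phi>D = XY.intertwinerD[OF \<phi>(1)]
    show "Y \<subseteq> eigen h"
    proof
      fix y assume "y \<in> Y"
      then obtain x where x: "x \<in> X" "y = \<phi> x" using \<phi>(2) by (auto simp: bij_betw_def)
      have "R (weyl (loop_exponent C)) y = sv (h C) y" if "C \<in> orbs" for C
      proof -
        have "R (weyl (loop_exponent C)) x = sv (h C) x" using X(2) x(1) that by (auto simp: eigen_def)
        then show ?thesis
          using \<phi>D(3)[OF loop_balanced x(1), of C] linear_on_scale[OF linear_map_on.linear[OF \<phi>D(1)] x(1)]
          by (simp add: x(2))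
      qed
      then show "y \<in> eigen h" using \<open>y \<in> Y\<close> XV by (auto simp: eigen_def)
    qed
  next
    assume Yh: "Y \<subseteq> eigen h"
    have "XY.same_scalars L.radical"
      unfolding XY.same_scalars_def
    proof
      fix c assume c: "c \<in> L.radical"
      have "\<exists>z. (\<forall>u\<in>X. R (weyl c) u = sv z u) \<and> (\<forall>w\<in>eigen h. R (weyl c) w = sv z w)"
      proof (rule eigen_same_scalars[OF X.rep vs _ _ c])
        fix k u assume "k \<in> balanced D" "u \<in> X"
        then show "R (weyl (\<lambda>x. int N * k x)) u = sv (\<rho> k) u" using XV by (intro shadow) auto
      next
        fix C u assume "C \<in> orbs" "u \<in> X"
        then show "R (weyl (loop_exponent C)) u = sv (h C) u" using X(2) by (auto simp: eigen_def)
      qed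
      then show "\<exists>z. (\<forall>v\<in>X. R (weyl c) v = sv z v) \<and> (\<forall>w\<in>Y. R (weyl c) w = sv z w)"
        using Yh by blast
    qed
    moreover obtain w where w: "w \<in> Y" "w \<noteq> 0" using simple(2) Y.V subspace_0 by (auto simp: Y.simple_def)
    ultimately obtain \<phi> where \<phi>: "XY.intertwiner \<phi>" "inj_on \<phi> X"
      using XY.simple_embedding[OF simple(1)] by blast
    obtain u where u: "u \<in> X" "u \<noteq> 0" using simple(1) X.V subspace_0 by (auto simp: X.simple_def)
    have "\<phi> 0 = 0" by (rule linear_map_on.map_0[OF XY.intertwinerD(1)[OF \<phi>(1)]])
    then have "\<phi> u \<noteq> 0" using inj_onD[OF \<phi>(2), of u 0] u subspace_0[OF X.V] by auto
    then have "Y.simple (\<phi> ` X)" by (rule XY.simple_image[OF \<phi>(1) simple(1) u(1)])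
    then have "\<phi> ` X = Y" using simple(2) unfolding Y.simple_def Y.invariant_def by blast
    then have "bij_betw \<phi> X Y" using \<phi>(2) by (simp add: bij_betw_def)
    then show "isomorphic_reps \<omega> D sv X R sv Y R"
      using XY.isomorphic_iff \<phi>(1) by blast
  qed
qed

lemma decomposition_exists: "\<exists>Bs. simple_decomposition \<omega> D sv V R Bs"
  unfolding simple_decomposition_iff
  by (rule simple_direct_sum_exists[OF finite_spanning M_scalar])

lemma decomposition_multiplicity:
  assumes dec: "simple_decomposition \<omega> D sv V R Bs" and X: "X \<in> Bs"
  shows "\<exists>\<gamma>. 2 * card (faces D) + 2 = card (edges D) + card orbs + 2 * \<gamma> \<and>
    card {Y\<in>Bs. isomorphic_reps \<omega> D sv X R sv Y R} = N ^ \<gamma>"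
proof -
  have Bs: "\<And>X. X \<in> Bs \<Longrightarrow> simple X" "direct_sum Bs (\<lambda>X. X) V"
    using dec by (auto simp: simple_decomposition_iff)
  obtain h where h: "h \<in> tuples" "X \<subseteq> eigen h" using tuple_of_simple[OF Bs(1)[OF X]] by blast
  have "{Y\<in>Bs. isomorphic_reps \<omega> D sv X R sv Y R} = {Y\<in>Bs. Y \<subseteq> eigen h}"
    using isomorphic_simple_iff[OF Bs(1)[OF X] h(2)] Bs(1) by blast
  moreover have "dim (eigen h) = card {Y\<in>Bs. Y \<subseteq> eigen h} * dim X"
    by (rule multiplicity[OF finite_spanning Bs X h(2)])
  ultimately show ?thesis
    using multiplicity_power[OF dim_V h(1) N_gt_1 simple_dim_eq(1)[OF Bs(1)[OF X]]] by simp
qed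

end

section \<open>The topology of a glued surface\<close>

text \<open>By finiteness the complement of each piece is closed too, so the pieces are clopen and
  connected.\<close>

lemma connected_components_of_closed_partition:
  assumes fin: "finite \<A>" and cover: "\<Union>\<A> = topspace Y"
    and disj: "\<And>A B. A \<in> \<A> \<Longrightarrow> B \<in> \<A> \<Longrightarrow> A \<noteq> B \<Longrightarrow> A \<inter> B = {}"
    and closed: "\<And>A. A \<in> \<A> \<Longrightarrow> closedin Y A" and conn: "\<And>A. A \<in> \<A> \<Longrightarrow> connectedin Y A"
    and ne: "\<And>A. A \<in> \<A> \<Longrightarrow> A \<noteq> {}"
  shows "connected_components_of Y = \<A>"
proof -
  have comp: "connected_component_of_set Y a = A" if A: "A \<in> \<A>" and a: "a \<in> A" for A a
  proof (rule subset_antisym)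
    have "topspace Y - A = \<Union>(\<A> - {A})"
      using cover disj A by blast
    moreover have "closedin Y (\<Union>(\<A> - {A}))"
      using fin closed by (intro closedin_Union) auto
    moreover have "A \<subseteq> topspace Y" using cover A by blast
    ultimately have "openin Y A" using openin_closedin[of A Y] by simp
    moreover have "connectedin Y (connected_component_of_set Y a)"
      by (rule connectedin_connected_component_of)
    ultimately have "connected_component_of_set Y a \<subseteq> A \<or> disjnt (connected_component_of_set Y a) A"
      using connectedin_clopen_cases closed[OF A] by blast
    moreover have "a \<in> connected_component_of_set Y a"
      using a cover A by (auto simp: connected_component_of_refl)
    ultimately show "connected_component_of_set Y a \<subseteq> A" using a by (auto simp: disjnt_iff)
    show "A \<subseteq> connected_component_of_set Y a"
      by (rule connected_component_of_maximal[OF conn[OF A] a])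
  qed
  show ?thesis
    unfolding connected_components_of_def
  proof (intro subset_antisym subsetI)
    fix C assume "C \<in> connected_component_of_set Y ` topspace Y"
    then obtain a A where "C = connected_component_of_set Y a" "A \<in> \<A>" "a \<in> A"
      using cover by blast
    then show "C \<in> \<A>" using comp by simp
  next
    fix A assume A: "A \<in> \<A>"
    then obtain a where a: "a \<in> A" using ne by blast
    then have "a \<in> topspace Y" using cover A by blast
    then show "A \<in> connected_component_of_set Y ` topspace Y" using comp[OF A a] by blast
  qed
qed

lemma tri_vertex_simps: "tri_vertex 0 = 0" "tri_vertex (Suc 0) = 1" "tri_vertex 2 = \<i>" "tri_vertex 3 = 0"
  by (simp_all add: tri_vertex_def)

lemma tri_vertex_nxt: "tri_vertex (snd (nxt s)) = tri_vertex (snd s + 1)"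
  by (simp add: nxt_def tri_vertex_def)

lemma side_point_simps:
  "side_point 0 t = of_real t" "side_point (Suc 0) t = of_real (1 - t) + \<i> * of_real t"
  "side_point 2 t = \<i> * of_real (1 - t)"
  by (simp_all add: side_point_def linepath_def tri_vertex_simps scaleR_conv_of_real numeral_3_eq_3[symmetric]
      flip: numeral_2_eq_2)

lemma side_point_0: "side_point i 0 = tri_vertex i"
  and side_point_1: "side_point i 1 = tri_vertex (i + 1)"
  by (simp_all add: side_point_def linepath_def)

lemma side_point_eq_inner:
  assumes "side_point i t = side_point j u" "i < 3" "j < 3" "0 < t" "t < 1" "0 \<le> u" "u \<le> 1"
  shows "i = j \<and> t = u"
  using assms(1,4-) less_3_cases[OF assms(2)] less_3_cases[OF assms(3)]
  by (auto simp: side_point_simps complex_eq_iff)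

lemma side_point_eq_vertex:
  assumes "side_point j u = tri_vertex i" "i < 3" "j < 3" "0 \<le> u" "u \<le> 1"
  shows "u = 0 \<and> j = i \<or> u = 1 \<and> (j + 1) mod 3 = i"
  using assms(1,4-) less_3_cases[OF assms(2)] less_3_cases[OF assms(3)]
  by (auto simp: side_point_simps tri_vertex_simps complex_eq_iff)

lemma side_point_triangle:
  assumes "0 \<le> t" "t \<le> 1"
  shows "side_point i t \<in> model_triangle"
proof -
  have "tri_vertex j \<in> model_triangle" for j
  proof -
    have "tri_vertex j \<in> {tri_vertex 0, tri_vertex 1, tri_vertex 2}"
      by (auto simp: tri_vertex_def)
    then show ?thesis unfolding model_triangle_def by (rule hull_inc)
  qed
  moreover have "convex model_triangle" by (simp add: model_triangle_def)
  ultimately have "closed_segment (tri_vertex i) (tri_vertex (i + 1)) \<subseteq> model_triangle"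
    by (simp add: closed_segment_subset)
  moreover have "side_point i t \<in> closed_segment (tri_vertex i) (tri_vertex (i + 1))"
    using assms linepath_image_01[of "tri_vertex i" "tri_vertex (i + 1)"] by (auto simp: side_point_def)
  ultimately show ?thesis by blast
qed

lemma continuous_side_point: "continuous_on A (side_point i)"
  unfolding side_point_def by (rule continuous_on_linepath)

definition point :: "'f \<times> nat \<Rightarrow> real \<Rightarrow> 'f \<times> complex" where
  "point s t = (fst s, side_point (snd s) t)"

lemma point_mem: "s \<in> sides F \<Longrightarrow> t \<in> {0..1} \<Longrightarrow> point s t \<in> F \<times> model_triangle"
  by (simp add: point_def in_sides side_point_triangle)

lemma point_eq_inner:
  assumes "point s t = point s' u" "s \<in> sides F" "s' \<in> sides F" "t \<in> {0<..<1}" "u \<in> {0..1}"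
  shows "s' = s \<and> u = t"
  using assms side_point_eq_inner[of "snd s" t "snd s'" u] by (simp add: point_def in_sides prod_eq_iff)

lemma point_eq_vertex:
  assumes "point s t = point s' 0" "s \<in> sides F" "s' \<in> sides F" "t \<in> {0..1}"
  shows "t = 0 \<and> s = s' \<or> t = 1 \<and> nxt s = s'"
  using assms side_point_eq_vertex[of "snd s" t "snd s'"]
  by (auto simp: point_def in_sides prod_eq_iff nxt_def side_point_0)

lemma point_1: "point s 1 = point (nxt s) 0"
  by (simp add: point_def side_point_0 side_point_1 tri_vertex_nxt) (simp add: nxt_def)

lemma gluing_relation_point:
  "(x, y) \<in> gluing_relation F g \<longleftrightarrow>
    (\<exists>s t. s \<in> sides F \<and> g s \<noteq> s \<and> t \<in> {0..1} \<and> x = point s t \<and> y = point (g s) (1 - t))"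
proof
  assume "(x, y) \<in> gluing_relation F g"
  then obtain T i T' j t where "(T, i) \<in> sides F" "g (T, i) = (T', j)" "(T', j) \<noteq> (T, i)" "t \<in> {0..1}"
    "x = (T, side_point i t)" "y = (T', side_point j (1 - t))"
    unfolding gluing_relation_def by blast
  then show "\<exists>s t. s \<in> sides F \<and> g s \<noteq> s \<and> t \<in> {0..1} \<and> x = point s t \<and> y = point (g s) (1 - t)"
    by (intro exI[of _ "(T, i)"] exI[of _ t]) (simp add: point_def)
next
  assume "\<exists>s t. s \<in> sides F \<and> g s \<noteq> s \<and> t \<in> {0..1} \<and> x = point s t \<and> y = point (g s) (1 - t)"
  then obtain s t where *: "s \<in> sides F" "g s \<noteq> s" "t \<in> {0..1}" "x = point s t" "y = point (g s) (1 - t)"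
    by blast
  obtain T i where s: "s = (T, i)" by (cases s)
  obtain T' j where gs: "g s = (T', j)" by (cases "g s")
  show "(x, y) \<in> gluing_relation F g"
    unfolding gluing_relation_def using * s gs by (auto simp: point_def)
qed

locale triangulation =
  fixes X :: "'a topology" and P :: "'a set" and F :: "'f set" and q :: "'f \<times> complex \<Rightarrow> 'a"
    and g :: "'f \<times> nat \<Rightarrow> 'f \<times> nat"
  assumes finite_F: "finite F" and F_nonempty: "F \<noteq> {}"
    and quotient: "quotient_map (prod_topology (discrete_topology F) (top_of_set model_triangle)) X q"
    and g_in: "s \<in> sides F \<Longrightarrow> g s \<in> sides F" and g_inv: "s \<in> sides F \<Longrightarrow> g (g s) = s"
    and q_eq: "x \<in> F \<times> model_triangle \<Longrightarrow> y \<in> F \<times> model_triangle \<Longrightarrow>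
      q x = q y \<longleftrightarrow> (x, y) \<in> (gluing_relation F g)\<^sup>*"
    and P_eq: "P = q ` (F \<times> {tri_vertex 0, tri_vertex 1, tri_vertex 2})"
begin

abbreviation "D \<equiv> pattern_of F q"

lemma faces_D: "faces D = F"
  by (simp add: pattern_of_def)

lemma edge_D: "edge_at D s = (\<lambda>t. q (point s t)) ` {0..1}"
  by (cases s) (auto simp: pattern_of_def point_def)

lemma q_glued:
  assumes *: "s \<in> sides F" "g s \<noteq> s" "t \<in> {0..1}"
  shows "q (point s t) = q (point (g s) (1 - t))"
proof -
  have "(point s t, point (g s) (1 - t)) \<in> gluing_relation F g"
    unfolding gluing_relation_point using * by blast
  moreover have "point s t \<in> F \<times> model_triangle" "point (g s) (1 - t) \<in> F \<times> model_triangle"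
    using * g_in[OF *(1)] by (simp_all add: point_mem)
  ultimately show ?thesis by (simp add: q_eq r_into_rtrancl)
qed

text \<open>An inner point of a side lies on no other side of its face, so gluing steps only go back
  and forth across one edge. At an unglued side the second point is the mirror image, which
  \<open>boundary_class\<close> excludes later.\<close>

lemma inner_class:
  assumes s: "s \<in> sides F" and t: "t \<in> {0<..<1}" and x: "x \<in> F \<times> model_triangle" "q (point s t) = q x"
  shows "x \<in> {point s t, point (g s) (1 - t)}"
proof -
  have "point s t \<in> F \<times> model_triangle" using point_mem[OF s] t by simp
  then have "(point s t, x) \<in> (gluing_relation F g)\<^sup>*"
    using q_eq[THEN iffD1, OF _ x(1) x(2)] by simp
  then show ?thesis
  proof (induction rule: rtrancl_induct)
    case (step y z)
    then obtain s1 t1 where 1: "s1 \<in> sides F" "t1 \<in> {0..1}" "y = point s1 t1" "z = point (g s1) (1 - t1)"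
      by (auto simp: gluing_relation_point)
    from step.IH consider "point s t = point s1 t1" | "point (g s) (1 - t) = point s1 t1"
      using 1 by auto
    then show ?case
    proof cases
      case 1
      then show ?thesis using point_eq_inner[OF 1 s] \<open>s1 \<in> _\<close> \<open>t1 \<in> _\<close> t \<open>z = _\<close> by simp
    next
      case 2
      then have "s1 = g s \<and> t1 = 1 - t"
        using t \<open>s1 \<in> _\<close> \<open>t1 \<in> _\<close> by (intro point_eq_inner[OF 2 g_in[OF s]]) auto
      then show ?thesis using \<open>z = _\<close> g_inv[OF s] by simp
    qed
  qed simp
qed

lemma inner_eq:
  assumes s: "s \<in> sides F" "s' \<in> sides F" and t: "t \<in> {0<..<1}" "u \<in> {0..1}"
    and eq: "q (point s t) = q (point s' u)"
  shows "(s' = s \<and> u = t) \<or> (s' = g s \<and> u = 1 - t)"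
proof -
  have "point s' u \<in> {point s t, point (g s) (1 - t)}"
    using inner_class[OF s(1) t(1) point_mem[OF s(2) t(2)] eq] .
  then consider "point s t = point s' u" | "point (g s) (1 - t) = point s' u" by auto
  then show ?thesis
  proof cases
    case 1
    then show ?thesis using point_eq_inner[OF 1 s t] by simp
  next
    case 2
    then show ?thesis using t by (intro disjI2 point_eq_inner[OF 2 g_in[OF s(1)] s(2)]) auto
  qed
qed

sublocale glued_pattern D g
proof
  show "finite (faces D)" by (simp add: faces_D finite_F)
  fix s assume "s \<in> sides (faces D)"
  then have s: "s \<in> sides F" by (simp add: faces_D)
  show "g s \<in> sides (faces D)" using g_in[OF s] by (simp add: faces_D)
  show "g (g s) = s" by (rule g_inv[OF s])
  fix s' assume "s' \<in> sides (faces D)"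
  then have s': "s' \<in> sides F" by (simp add: faces_D)
  show "edge_at D s = edge_at D s' \<longleftrightarrow> s' = s \<or> s' = g s"
  proof
    assume eq: "edge_at D s = edge_at D s'"
    \<comment> \<open>The midpoint of a side, being an inner point, determines the edge on which it
      lies.\<close>
    have "q (point s (1/2)) \<in> edge_at D s" by (auto simp: edge_D)
    then have "q (point s (1/2)) \<in> (\<lambda>t. q (point s' t)) ` {0..1}" unfolding eq edge_D[of s'] .
    then obtain u where u: "u \<in> {0..1}" "q (point s (1/2)) = q (point s' u)" by blast
    then show "s' = s \<or> s' = g s" using inner_eq[OF s s' _ u(1), of "1/2"] by auto
  next
    assume "s' = s \<or> s' = g s"
    moreover have "edge_at D s = edge_at D (g s)"
    proof (cases "g s = s")
      case False
      have "(\<lambda>t. q (point s t)) ` {0..1} = (\<lambda>t. q (point (g s) (1 - t))) ` {0..1}"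
        using q_glued[OF s False] by (intro image_cong) auto
      also have "\<dots> = (\<lambda>t. q (point (g s) t)) ` (\<lambda>t. 1 - t) ` {0..1::real}"
        by (simp only: image_image)
      also have "(\<lambda>t. 1 - t) ` {0..1::real} = {0..1}" by (simp add: image_diff_atLeastAtMost)
      finally show ?thesis by (simp only: edge_D)
    qed simp
    ultimately show "edge_at D s = edge_at D s'" by auto
  qed
qed

lemma S_eq: "S = sides F"
  by (simp add: faces_D)

lemma topspace_product:
  "topspace (prod_topology (discrete_topology F) (top_of_set model_triangle)) = F \<times> model_triangle"
  by simp

text \<open>A set of faces closed under gluing is saturated for \<open>q\<close>, and its preimage
  is open because the set of faces is discrete.\<close>

lemma saturated_open:
  assumes F0: "F0 \<subseteq> F" and sat: "\<And>s. s \<in> sides F \<Longrightarrow> fst s \<in> F0 \<longleftrightarrow> fst (g s) \<in> F0"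
  shows "openin X (q ` (F0 \<times> model_triangle))"
    and "q ` (F0 \<times> model_triangle) \<inter> q ` ((F - F0) \<times> model_triangle) = {}"
proof -
  have inv: "fst x \<in> F0 \<longleftrightarrow> fst y \<in> F0" if "(x, y) \<in> (gluing_relation F g)\<^sup>*" for x y
    using that
  proof (induction rule: rtrancl_induct)
    case (step y z)
    then show ?case using sat by (auto simp: gluing_relation_point point_def)
  qed simp
  have sat': "fst y \<in> F0" if "x \<in> F0 \<times> model_triangle" "y \<in> F \<times> model_triangle" "q x = q y" for x y
    using that inv[of x y] q_eq[of x y] F0 by auto
  show "q ` (F0 \<times> model_triangle) \<inter> q ` ((F - F0) \<times> model_triangle) = {}"
  proof (rule ccontr)
    assume "\<not> ?thesis"
    then obtain x y where "x \<in> F0 \<times> model_triangle" "y \<in> (F - F0) \<times> model_triangle" "q x = q y"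
      by auto
    then show False using sat'[of x y] by auto
  qed
  let ?U = "q ` (F0 \<times> model_triangle)" and ?Y = "prod_topology (discrete_topology F) (top_of_set model_triangle)"
  have pre: "{x \<in> topspace ?Y. q x \<in> ?U} = F0 \<times> model_triangle"
    using sat' F0 unfolding topspace_product by fastforce
  have op: "openin ?Y (F0 \<times> model_triangle)"
    using F0 openin_topspace[of "top_of_set model_triangle"] by (subst openin_prod_Times_iff) auto
  have "?U \<subseteq> topspace X"
    using quotient F0 unfolding quotient_map_def topspace_product by blast
  then have "openin ?Y {x \<in> topspace ?Y. q x \<in> ?U} \<longleftrightarrow> openin X ?U"
    using quotient unfolding quotient_map_def by blast
  then show "openin X ?U" using op unfolding pre by blast
qed

text \<open>Closure under \<open>nxt\<close> makes \<open>A\<close> consist of all sides of certain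
  faces, closure under \<open>g\<close> makes these faces saturated. They and the remaining faces
  would separate the surface.\<close>

lemma connected_sides:
  assumes conn: "connected_space X" and A: "A \<subseteq> S" "A \<noteq> {}" "\<And>s. s \<in> A \<Longrightarrow> nxt s \<in> A \<and> g s \<in> A"
  shows "A = S"
proof -
  define F0 where "F0 = fst ` A"
  have A_S: "s \<in> sides F" if "s \<in> A" for s using A(1) that by (auto simp: faces_D)
  have A_eq: "s \<in> A" if s: "s \<in> sides F" "fst s \<in> F0" for s
  proof -
    obtain s' where s': "s' \<in> A" "fst s' = fst s" using s(2) by (auto simp: F0_def)
    then have "nxt s' \<in> A" "nxt (nxt s') \<in> A" using A(3) by auto
    moreover have "s = s' \<or> s = nxt s' \<or> s = nxt (nxt s')"
    proof -
      obtain T i where s1: "s = (T, i)" "i < 3" using s(1) by (cases s) (auto simp: in_sides)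
      moreover obtain j where "s' = (T, j)" "j < 3"
        using A_S[OF s'(1)] s'(2) s1 by (cases s') (auto simp: in_sides)
      ultimately show ?thesis
        using less_3_cases[of i] less_3_cases[of j] by (auto simp: nxt_simps)
    qed
    ultimately show ?thesis using s' by auto
  qed
  have F0: "F0 \<subseteq> F" using A_S by (auto simp: F0_def in_sides)
  have sat: "fst s \<in> F0 \<longleftrightarrow> fst (g s) \<in> F0" if s: "s \<in> sides F" for s
  proof
    assume "fst s \<in> F0"
    then have "g s \<in> A" using A_eq[OF s] A(3) by blast
    then show "fst (g s) \<in> F0" by (simp add: F0_def)
  next
    assume "fst (g s) \<in> F0"
    then have "g (g s) \<in> A" using A_eq[OF g_in[OF s]] A(3) by blast
    then show "fst s \<in> F0" using g_inv[OF s] by (simp add: F0_def)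
  qed
  let ?U = "q ` (F0 \<times> model_triangle)" and ?V = "q ` ((F - F0) \<times> model_triangle)"
  have U: "openin X ?U" "?U \<inter> ?V = {}" using saturated_open[OF F0 sat] by auto
  have V: "openin X ?V"
  proof (rule saturated_open(1))
    show "fst s \<in> F - F0 \<longleftrightarrow> fst (g s) \<in> F - F0" if "s \<in> sides F" for s
      using sat[OF that] that g_in[OF that] by (auto simp: in_sides)
  qed auto
  have "topspace X = q ` (F \<times> model_triangle)"
    using quotient unfolding quotient_map_def topspace_product by simp
  then have "topspace X \<subseteq> ?U \<union> ?V" using F0 by auto
  then have "?U = {} \<or> ?V = {}"
    using conn U V unfolding connected_space_def by blast
  moreover have tri: "model_triangle \<noteq> {}" using side_point_triangle[of 0 0] by auto
  moreover have "F0 \<noteq> {}" using A(2) by (simp add: F0_def)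
  ultimately have "F - F0 = {}" by auto
  then have "S \<subseteq> A" using A_eq by (auto simp: faces_D in_sides)
  then show ?thesis using A(1) by blast
qed

subsection \<open>Vertices and boundary\<close>

definition start :: "'f \<times> nat \<Rightarrow> 'a" where
  "start s = q (point s 0)"

definition bd :: "('f \<times> nat) set" where
  "bd = {s \<in> S. g s = s}"

text \<open>Only the rotations across glued sides. Unlike \<open>turn\<close>, these do not continue
  along the boundary and so never leave the puncture at which the side starts.\<close>

definition turn_steps :: "(('f \<times> nat) \<times> ('f \<times> nat)) set" where
  "turn_steps = {(s, s'). s \<in> S \<and> s \<notin> bd \<and> s' = turn s}"

lemma turn_steps_iff: "(s, s') \<in> turn_steps \<longleftrightarrow> s \<in> S \<and> s \<notin> bd \<and> s' = turn s"
  by (simp add: turn_steps_def)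

lemma turn_S: "s \<in> S \<Longrightarrow> turn s \<in> S"
  by (simp add: turn_def S_simps)

lemma start_turn:
  assumes "s \<in> S" "s \<notin> bd"
  shows "start (turn s) = start s"
proof -
  have "s \<in> sides F" "g s \<noteq> s" using assms by (auto simp: bd_def faces_D)
  then have "q (point s 0) = q (point (g s) 1)" using q_glued[of s 0] by simp
  then show ?thesis using assms by (simp add: start_def turn_def point_1)
qed

lemma start_steps: "(s, s') \<in> turn_steps\<^sup>* \<Longrightarrow> start s' = start s"
  by (induction rule: rtrancl_induct) (simp_all add: turn_steps_iff start_turn)

lemma orb_steps: "(s, s') \<in> turn_steps\<^sup>* \<Longrightarrow> orb s' = orb s"
proof (induction rule: rtrancl_induct)
  case (step y z)
  then show ?case
    using permutation_orbit_step[OF turn_permutation] by (simp add: turn_steps_iff)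
qed simp

lemma turn_inj: "turn s = turn s' \<Longrightarrow> s = s'"
  using permutes_inj[OF turn_permutes] by (rule injD)

text \<open>At a vertex each gluing step is a rotation step or the inverse of one. As rotation is
  deterministic and injective, a zigzag of such steps collapses to a chain in one direction.\<close>

lemma start_eq_steps:
  assumes "s \<in> S" "s' \<in> S" "start s = start s'"
  shows "(s, s') \<in> turn_steps\<^sup>* \<or> (s', s) \<in> turn_steps\<^sup>*"
proof -
  have "\<exists>s'\<in>S. y = point s' 0 \<and> ((s, s') \<in> turn_steps\<^sup>* \<or> (s', s) \<in> turn_steps\<^sup>*)"
    if "(point s 0, y) \<in> (gluing_relation F g)\<^sup>*" for y
    using that
  proof (induction rule: rtrancl_induct)
    case base
    then show ?case using assms by blast
  next
    case (step y z)
    then obtain a where a: "a \<in> S" "y = point a 0" "(s, a) \<in> turn_steps\<^sup>* \<or> (a, s) \<in> turn_steps\<^sup>*"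
      by blast
    obtain s1 t where s1: "s1 \<in> sides F" "g s1 \<noteq> s1" "t \<in> {0..1}" "y = point s1 t" "z = point (g s1) (1 - t)"
      using step(2) by (auto simp: gluing_relation_point)
    have s1S: "s1 \<in> S" "s1 \<notin> bd" using s1 by (auto simp: faces_D bd_def)
    have aF: "a \<in> sides F" using a(1) by (simp add: faces_D)
    have "point s1 t = point a 0" using s1(4) a(2) by simp
    from point_eq_vertex[OF this s1(1) aF s1(3)]
    show ?case
    proof
      assume *: "t = 0 \<and> s1 = a"
      then have z: "z = point (turn a) 0" using s1(5) a(1) by (simp add: turn_def point_1)
      have st: "(a, turn a) \<in> turn_steps" using s1S * by (simp add: turn_steps_iff)
      have "(s, turn a) \<in> turn_steps\<^sup>* \<or> (turn a, s) \<in> turn_steps\<^sup>*"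
        using a(3)
      proof
        assume "(a, s) \<in> turn_steps\<^sup>*"
        then show ?thesis
        proof (cases rule: converse_rtranclE)
          case base
          then show ?thesis using st by auto
        next
          case (step y)
          then show ?thesis by (simp add: turn_steps_iff)
        qed
      qed (use st in auto)
      then show ?case using z turn_S[OF a(1)] by blast
    next
      assume *: "t = 1 \<and> nxt s1 = a"
      let ?b = "g s1"
      have b: "?b \<in> S" "?b \<notin> bd" using s1S s1 g_in g_inv by (auto simp: bd_def faces_D)
      have tb: "turn ?b = a" using b(1) * s1(1) g_inv by (simp add: turn_def)
      have z: "z = point ?b 0" using s1(5) * by simp
      have st: "(?b, a) \<in> turn_steps" using b tb by (simp add: turn_steps_iff)
      have "(s, ?b) \<in> turn_steps\<^sup>* \<or> (?b, s) \<in> turn_steps\<^sup>*"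
        using a(3)
      proof
        assume "(s, a) \<in> turn_steps\<^sup>*"
        then show ?thesis
        proof (cases rule: rtranclE)
          case base
          then show ?thesis using st by auto
        next
          case (step y)
          then have "turn y = turn ?b" using tb by (simp add: turn_steps_iff)
          then have "y = ?b" by (rule turn_inj)
          then show ?thesis using step by auto
        qed
      next
        assume "(a, s) \<in> turn_steps\<^sup>*"
        then show ?thesis using st by (meson converse_rtrancl_into_rtrancl)
      qed
      then show ?case using z b by blast
    qed
  qed
  moreover have "(point s 0, point s' 0) \<in> (gluing_relation F g)\<^sup>*"
    using assms point_mem[of _ F 0] q_eq by (simp add: start_def faces_D)
  ultimately obtain a where a: "a \<in> S" "point s' 0 = point a 0" "(s, a) \<in> turn_steps\<^sup>* \<or> (a, s) \<in> turn_steps\<^sup>*"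
    by blast
  have "a = s'"
    using point_eq_vertex[OF a(2), of F] assms(2) a(1) by (simp add: faces_D)
  then show ?thesis using a by blast
qed

lemma start_eq_orb: "s \<in> S \<Longrightarrow> s' \<in> S \<Longrightarrow> start s = start s' \<Longrightarrow> orb s = orb s'"
  using start_eq_steps orb_steps by metis

text \<open>No rotation step leaves an unglued side, so a chain between two of them is trivial: a
  boundary puncture is the start of only one unglued side.\<close>

lemma start_eq_bd:
  assumes "b \<in> bd" "b' \<in> bd" "start b = start b'"
  shows "b = b'"
proof -
  have *: "s = s'" if "s \<in> bd" "(s, s') \<in> turn_steps\<^sup>*" for s s'
    using that(2,1) by (cases rule: converse_rtranclE) (simp_all add: turn_steps_iff)
  have "b \<in> S" "b' \<in> S" using assms by (simp_all add: bd_def)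
  then show ?thesis using start_eq_steps[OF _ _ assms(3)] *[OF assms(1), of b'] *[OF assms(2), of b] by blast
qed

text \<open>Iterating \<open>turn\<close> up to the first unglued side uses only rotations across
  glued sides.\<close>

lemma steps_to_bd:
  assumes "s \<in> S" "orb s \<inter> bd \<noteq> {}"
  shows "\<exists>b\<in>bd. (s, b) \<in> turn_steps\<^sup>*"
proof -
  have "\<exists>b\<in>bd. (s, b) \<in> turn_steps\<^sup>*" if "(turn ^^ n) s \<in> bd" "s \<in> S" for n s
    using that
  proof (induction n arbitrary: s)
    case 0
    then show ?case by auto
  next
    case (Suc n)
    show ?case
    proof (cases "s \<in> bd")
      case False
      have "(turn ^^ n) (turn s) \<in> bd" using Suc.prems by (simp add: funpow_swap1)
      then obtain b where "b \<in> bd" "(turn s, b) \<in> turn_steps\<^sup>*"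
        using Suc.IH turn_S Suc.prems by blast
      moreover have "(s, turn s) \<in> turn_steps" using False Suc.prems by (simp add: turn_steps_iff)
      ultimately show ?thesis by (meson converse_rtrancl_into_rtrancl)
    qed auto
  qed
  moreover obtain b where "b \<in> orb s" "b \<in> bd" using assms by auto
  moreover obtain n where "b = (turn ^^ n) s"
    using \<open>b \<in> orb s\<close> orbit_altdef_permutation[OF turn_permutation, of s] by auto
  ultimately show ?thesis using assms by blast
qed

lemma steps_without_bd:
  assumes s: "s \<in> S" and "orb s \<inter> bd = {}" "s' \<in> orb s"
  shows "start s' = start s"
proof -
  have "(turn ^^ n) s \<in> S \<and> start ((turn ^^ n) s) = start s" for n
  proof (induction n)
    case (Suc n)
    have "(turn ^^ n) s \<in> orb s" by (rule funpow_in_orbit[OF self_orb])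
    then have "(turn ^^ n) s \<notin> bd" using assms by auto
    then show ?case using Suc start_turn turn_S by simp
  qed (use s in simp)
  then show ?thesis using assms(3) orbit_altdef_permutation[OF turn_permutation, of s] by auto
qed

text \<open>For an orbit that meets \<open>bd\<close> this is a connected component of the boundary,
  by \<open>boundary_components_arcs\<close>.\<close>

definition arcs :: "('f \<times> nat) set \<Rightarrow> 'a set" where
  "arcs C = \<Union>(edge_at D ` (bd \<inter> C))"

lemma boundary_arcs_bd: "boundary_arcs F q = edge_at D ` bd"
proof -
  have "s \<in> sides F \<and> edge_at D s = edge_at D t \<longleftrightarrow> s \<in> {t, g t}" if "t \<in> sides F" for s t
    using edge_eq[of t s] that g_in[OF that] edge_g[of t] by (auto simp only: faces_D insert_iff empty_iff)
  then have "{s \<in> sides F. edge_at D s = edge_at D t} = {t, g t}" if "t \<in> sides F" for t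
    using that by blast
  then have *: "card {s \<in> sides F. edge_at D s = edge_at D t} = 1 \<longleftrightarrow> g t = t" if "t \<in> sides F" for t
    using that by (auto simp: card_insert_if)
  have "edges D = edge_at D ` sides F" by (simp add: edges_def faces_D)
  then show ?thesis unfolding boundary_arcs_def bd_def S_eq using * by auto
qed

lemma surface_boundary_bd: "surface_boundary F q = \<Union>(edge_at D ` bd)"
  by (simp add: surface_boundary_def boundary_arcs_bd)

lemma bd_S: "b \<in> bd \<Longrightarrow> b \<in> S" and bd_g: "b \<in> bd \<Longrightarrow> g b = b"
  by (auto simp: bd_def)

lemma orb_nxt_bd: "b \<in> bd \<Longrightarrow> orb (nxt b) = orb b"
  using orb_nxt[of b] by (simp add: bd_def)

text \<open>The points of the surface lying on a boundary arc: interior points of the arc are not glued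
  to anything, and the vertices of the arc belong to its orbit.\<close>

lemma boundary_class:
  assumes b: "b \<in> bd" and t: "t \<in> {0..1}" and x: "x \<in> F \<times> model_triangle" "q (point b t) = q x"
  shows "x = point b t \<or> (\<exists>s\<in>S. orb s = orb b \<and> x = point s 0)"
proof -
  have bF: "b \<in> sides F" using b by (auto simp: bd_def faces_D)
  have vertex: "\<exists>s\<in>S. orb s = orb a \<and> x = point s 0" if a: "a \<in> S" and eq: "q (point a 0) = q x" for a
  proof -
    have "(point a 0, x) \<in> (gluing_relation F g)\<^sup>*"
      using q_eq[THEN iffD1, OF _ x(1) eq] point_mem[of a F 0] a by (simp add: faces_D)
    then show ?thesis
    proof (induction rule: rtrancl_induct)
      case base
      then show ?case using a by blast
    next
      case (step y z)
      then obtain s where s: "s \<in> S" "orb s = orb a" "y = point s 0" by blast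
      obtain s1 u where s1: "s1 \<in> sides F" "g s1 \<noteq> s1" "u \<in> {0..1}" "y = point s1 u" "z = point (g s1) (1 - u)"
        using step(2) by (auto simp: gluing_relation_point)
      have s1S: "s1 \<in> S" "s \<in> sides F" using s1 s(1) by (auto simp: faces_D)
      have "point s1 u = point s 0" using s1(4) s(3) by simp
      from point_eq_vertex[OF this s1(1) s1S(2) s1(3)]
      show ?case
      proof
        assume "u = 0 \<and> s1 = s"
        then have "z = point (nxt (g s)) 0" using s1(5) by (simp add: point_1)
        then show ?case using s S_simps orb_turn[OF s(1)] by metis
      next
        assume *: "u = 1 \<and> nxt s1 = s"
        then have "z = point (g s1) 0" using s1(5) by simp
        moreover have "orb (g s1) = orb s" using orb_nxt[OF s1S(1)] * by simp
        ultimately show ?case using s s1S(1) S_simps by metis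
      qed
    qed
  qed
  consider "t \<in> {0<..<1}" | "t = 0" | "t = 1" using t by fastforce
  then show ?thesis
  proof cases
    case 1
    then have "x \<in> {point b t, point (g b) (1 - t)}" by (rule inner_class[OF bF _ x])
    moreover have "x = point b t \<or> x = point b (1 - t)" using calculation bd_g[OF b] by simp
    \<comment> \<open>\<open>inner_class\<close> leaves the mirror image on the same side open; but
      an inner point of an unglued side has no gluing partner at all, so its class is a
      singleton.\<close>
    moreover have "x = point b t" if "x = point b (1 - t)"
    proof -
      have "(point b t, x) \<in> (gluing_relation F g)\<^sup>*"
        using q_eq[THEN iffD1, OF point_mem[OF bF t] x] .
      then show ?thesis
      proof (cases rule: converse_rtranclE)
        case base
        then show ?thesis by simp
      next
        case (step y)
        then obtain s1 t1 where s1: "s1 \<in> sides F" "g s1 \<noteq> s1" "t1 \<in> {0..1}" "point b t = point s1 t1"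
          by (auto simp: gluing_relation_point)
        then have "s1 = b" using point_eq_inner[OF s1(4) bF s1(1) 1 s1(3)] by simp
        then show ?thesis using s1 bd_g[OF b] by simp
      qed
    qed
    ultimately show ?thesis by blast
  next
    case 2
    then show ?thesis using vertex[OF bd_S[OF b]] x by auto
  next
    case 3
    have "nxt b \<in> S" using bd_S[OF b] S_simps by blast
    then show ?thesis using vertex[of "nxt b"] x 3 orb_nxt_bd[OF b] by (simp add: point_1)
  qed
qed

lemma start_edge_orb:
  assumes s: "s \<in> S" and b: "b \<in> bd" and "start s \<in> edge_at D b"
  shows "orb s = orb b"
proof -
  obtain t where t: "t \<in> {0..1}" "q (point b t) = q (point s 0)"
    using assms(3) by (auto simp: edge_D start_def)
  have sF: "s \<in> sides F" "b \<in> sides F" using s b by (auto simp: faces_D bd_def)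
  from boundary_class[OF b t(1) point_mem[OF sF(1)] t(2)]
  have "point s 0 = point b t \<or> (\<exists>s'\<in>S. orb s' = orb b \<and> point s 0 = point s' 0)" by simp
  then show ?thesis
  proof
    assume "point s 0 = point b t"
    then have "t = 0 \<and> b = s \<or> t = 1 \<and> nxt b = s"
      using point_eq_vertex[of b t s F] sF t(1) by simp
    then show ?thesis using orb_nxt_bd[OF b] by auto
  next
    assume "\<exists>s'\<in>S. orb s' = orb b \<and> point s 0 = point s' 0"
    then obtain s' where s': "s' \<in> S" "orb s' = orb b" "point s 0 = point s' 0" by blast
    then have "s = s'" using point_eq_vertex[of s 0 s' F] sF by (simp add: faces_D)
    then show ?thesis using s' by simp
  qed
qed

lemma start_in_edge: "start b \<in> edge_at D b"
  by (auto simp: edge_D start_def)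

lemma start_nxt_in_edge: "start (nxt b) \<in> edge_at D b"
  unfolding edge_D start_def point_1[symmetric] by (rule imageI) simp

text \<open>Membership of a vertex in a boundary component is thus a matter of orbits: rotating at
  the vertex leads to an unglued side of the same orbit.\<close>

lemma start_in_arcs:
  assumes C: "C \<in> orbs" "C \<inter> bd \<noteq> {}" and s: "s \<in> S"
  shows "start s \<in> arcs C \<longleftrightarrow> orb s = C"
proof
  assume "start s \<in> arcs C"
  then obtain b where "b \<in> bd" "b \<in> C" "start s \<in> edge_at D b" by (auto simp: arcs_def)
  then show "orb s = C" using start_edge_orb[OF s] orbs_mem[OF C(1)] by metis
next
  assume o: "orb s = C"
  then obtain b where b: "b \<in> bd" "(s, b) \<in> turn_steps\<^sup>*" using steps_to_bd[OF s] C by blast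
  then have "b \<in> C" using orb_steps[OF b(2)] o orbs_mem[OF C(1)] bd_S by metis
  moreover have "start s \<in> edge_at D b" using start_steps[OF b(2)] start_in_edge[of b] by simp
  ultimately show "start s \<in> arcs C" using b by (auto simp: arcs_def)
qed

lemma start_in_boundary:
  assumes s: "s \<in> S"
  shows "start s \<in> surface_boundary F q \<longleftrightarrow> orb s \<inter> bd \<noteq> {}"
proof
  assume "start s \<in> surface_boundary F q"
  then obtain b where b: "b \<in> bd" "start s \<in> edge_at D b" by (auto simp: surface_boundary_bd)
  then have "b \<in> orb s" using start_edge_orb[OF s b] self_orb[of b] by simp
  then show "orb s \<inter> bd \<noteq> {}" using b by blast
next
  assume "orb s \<inter> bd \<noteq> {}"
  then have "start s \<in> arcs (orb s)" using start_in_arcs[OF orb_in[OF s] _ s] by simp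
  then show "start s \<in> surface_boundary F q" by (auto simp: arcs_def surface_boundary_bd)
qed

lemma continuous_q: "continuous_map (prod_topology (discrete_topology F) (top_of_set model_triangle)) X q"
  by (rule quotient_imp_continuous_map[OF quotient])

lemma edge_connected:
  assumes "s \<in> S"
  shows "connectedin X (edge_at D s)"
proof -
  let ?Y = "prod_topology (discrete_topology F) (top_of_set model_triangle)"
  have s: "s \<in> sides F" using assms by (simp add: faces_D)
  have "continuous_map (top_of_set {0..1}) ?Y (point s)"
    unfolding point_def
    by (rule continuous_map_pairedI)
      (use s in \<open>auto simp: in_sides continuous_side_point side_point_triangle\<close>)
  then have "continuous_map (top_of_set {0..1}) X (q \<circ> point s)"
    using continuous_q by (rule continuous_map_compose)
  moreover have "connectedin (top_of_set {0..1::real}) {0..1}"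
    by (simp add: connectedin_subtopology)
  ultimately have "connectedin X ((q \<circ> point s) ` {0..1})"
    by (rule connectedin_continuous_map_image)
  then show ?thesis by (simp add: edge_D image_comp)
qed

text \<open>Along the orbit, \<open>turn\<close> either stays at the same puncture or traverses one
  boundary arc, so every arc is joined to the first by a chain of arcs.\<close>

lemma arcs_connected:
  assumes C: "C \<in> orbs"
  shows "connectedin X (arcs C)"
proof (cases "C \<inter> bd = {}")
  case True
  then have "arcs C = {}" by (auto simp: arcs_def)
  then show ?thesis by simp
next
  case False
  then obtain b0 where b0: "b0 \<in> bd" "b0 \<in> C" by auto
  have C_orb: "C = orb b0" using orbs_mem[OF C] b0 by metis
  have edge_arcs: "edge_at D b \<subseteq> arcs C" if "b \<in> bd" "b \<in> C" for b using that by (auto simp: arcs_def)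
  have walk: "\<exists>K. connectedin X K \<and> K \<subseteq> arcs C \<and> start b0 \<in> K \<and> start ((turn ^^ n) b0) \<in> K" for n
  proof (induction n)
    case 0
    then show ?case
      using edge_connected[OF bd_S[OF b0(1)]] edge_arcs[OF b0] start_in_edge[of b0]
      by (intro exI[of _ "edge_at D b0"]) simp
  next
    case (Suc n)
    let ?s = "(turn ^^ n) b0"
    have sC: "?s \<in> C" unfolding C_orb by (rule funpow_in_orbit[OF self_orb])
    then have sS: "?s \<in> S" using orbs_mem[OF C] by blast
    from Suc obtain K where K: "connectedin X K" "K \<subseteq> arcs C" "start b0 \<in> K" "start ?s \<in> K" by blast
    show ?case
    proof (cases "?s \<in> bd")
      case False
      then show ?thesis using K start_turn[OF sS] by auto
    next
      case True
      have "turn ?s = nxt ?s" using sS bd_g[OF True] by (simp add: turn_def)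
      then have "start (turn ?s) \<in> edge_at D ?s" using start_nxt_in_edge by simp
      moreover have "connectedin X (K \<union> edge_at D ?s)"
        using K edge_connected[OF sS] start_in_edge[of ?s] by (intro connectedin_Un) auto
      ultimately show ?thesis
        using K edge_arcs[OF True sC] by (intro exI[of _ "K \<union> edge_at D ?s"]) auto
    qed
  qed
  define \<K> where "\<K> = {K. connectedin X K \<and> K \<subseteq> arcs C \<and> start b0 \<in> K}"
  have "connectedin X (\<Union>\<K>)"
    by (rule connectedin_Union) (auto simp: \<K>_def)
  moreover have "\<Union>\<K> = arcs C"
  proof (intro subset_antisym subsetI)
    fix x assume "x \<in> arcs C"
    then obtain b where b: "b \<in> bd" "b \<in> C" "x \<in> edge_at D b" by (auto simp: arcs_def)
    then obtain n where "b = (turn ^^ n) b0"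
      using C_orb orbit_altdef_permutation[OF turn_permutation, of b0] by auto
    then obtain K where K: "connectedin X K" "K \<subseteq> arcs C" "start b0 \<in> K" "start b \<in> K"
      using walk by blast
    have "connectedin X (K \<union> edge_at D b)"
      using K edge_connected[OF bd_S[OF b(1)]] start_in_edge[of b] by (intro connectedin_Un) auto
    then have "K \<union> edge_at D b \<in> \<K>" using K edge_arcs[OF b(1,2)] by (auto simp: \<K>_def)
    then show "x \<in> \<Union>\<K>" using b(3) by blast
  qed (auto simp: \<K>_def)
  ultimately show ?thesis by simp
qed

text \<open>By the quotient topology it suffices that the preimage is closed; it consists of
  finitely many segments and finitely many corners.\<close>

lemma arcs_closed:
  assumes C: "C \<in> orbs" "C \<inter> bd \<noteq> {}"
  shows "closedin X (arcs C)"
proof -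
  let ?Y = "prod_topology (discrete_topology F) (top_of_set model_triangle)"
  let ?seg = "\<lambda>s. {fst s} \<times> side_point (snd s) ` {0..1}"
  let ?pre = "\<Union>(?seg ` (bd \<inter> C)) \<union> (\<lambda>s. point s 0) ` C"
  have CS: "C \<subseteq> S" using orbs_mem[OF C(1)] by blast
  have pre: "{x \<in> topspace ?Y. q x \<in> arcs C} = ?pre"
  proof (intro subset_antisym subsetI)
    fix x assume "x \<in> {x \<in> topspace ?Y. q x \<in> arcs C}"
    then have x: "x \<in> F \<times> model_triangle" "q x \<in> arcs C" by (auto simp: topspace_product)
    then obtain b t where b: "b \<in> bd" "b \<in> C" "t \<in> {0..1}" "q (point b t) = q x"
      by (auto simp: arcs_def edge_D)
    from boundary_class[OF b(1,3) x(1) b(4)] show "x \<in> ?pre"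
    proof
      assume "x = point b t"
      then have "x \<in> ?seg b" using b(3) by (auto simp: point_def)
      then show ?thesis using b by blast
    next
      assume "\<exists>s\<in>S. orb s = orb b \<and> x = point s 0"
      then obtain s where s: "s \<in> S" "orb s = orb b" "x = point s 0" by blast
      have "orb b = C" using orbs_mem[OF C(1), of b] b(2) by simp
      then have "s \<in> C" using orbs_mem[OF C(1), of s] s(1,2) by simp
      then show ?thesis using s(3) by blast
    qed
  next
    fix x assume "x \<in> ?pre"
    then consider b where "b \<in> bd" "b \<in> C" "x \<in> ?seg b" | s where "s \<in> C" "x = point s 0" by blast
    then show "x \<in> {x \<in> topspace ?Y. q x \<in> arcs C}"
    proof cases
      case 1
      then obtain t where t: "t \<in> {0..1}" "x = point b t" by (cases x) (auto simp: point_def)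
      have "x \<in> F \<times> model_triangle" unfolding t(2) using bd_S[OF 1(1)] t(1) by (intro point_mem) (simp_all add: faces_D)
      moreover have "q x \<in> edge_at D b" using t by (auto simp: edge_D)
      ultimately show ?thesis using 1 by (auto simp: topspace_product arcs_def)
    next
      case 2
      then have s: "s \<in> S" "orb s = C" using orbs_mem[OF C(1)] by blast+
      have "x \<in> F \<times> model_triangle" unfolding 2(2) using s(1) by (intro point_mem) (simp_all add: faces_D)
      moreover have "q x \<in> arcs C" using start_in_arcs[OF C s(1)] s(2) 2(2) by (simp add: start_def)
      ultimately show ?thesis by (simp add: topspace_product)
    qed
  qed
  have cl: "closedin ?Y ?pre"
  proof (intro closedin_Un closedin_Union)
    have "finite C" using CS finite_S finite_subset by blast
    then show "finite (?seg ` (bd \<inter> C))" by simp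
    fix A assume "A \<in> ?seg ` (bd \<inter> C)"
    then obtain s where s: "s \<in> sides F" "A = ?seg s" using bd_S by (auto simp: faces_D)
    have "compact (side_point (snd s) ` {0..1})"
      by (intro compact_continuous_image continuous_side_point compact_Icc)
    then have "closedin (top_of_set model_triangle) (side_point (snd s) ` {0..1})"
      using side_point_triangle by (intro closed_subset compact_imp_closed) auto
    then show "closedin ?Y A" using s by (simp add: closedin_prod_Times_iff in_sides)
  next
    have "closedin ?Y (\<Union>s\<in>C. {point s 0})"
    proof (intro closedin_Union)
      show "finite ((\<lambda>s. {point s 0}) ` C)" using CS finite_S finite_subset by blast
      fix A assume "A \<in> (\<lambda>s. {point s 0}) ` C"
      then obtain s where s: "s \<in> sides F" "A = {point s 0}" using CS by (auto simp: faces_D)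
      have A: "A = {fst s} \<times> {side_point (snd s) 0}" by (auto simp: s(2) point_def)
      have "closedin (top_of_set model_triangle) {side_point (snd s) 0}"
        using side_point_triangle[of 0] by (intro closed_subset) auto
      moreover have "closedin (discrete_topology F) {fst s}" using s by (simp add: in_sides)
      ultimately show "closedin ?Y A" unfolding A closedin_prod_Times_iff by blast
    qed
    moreover have "(\<Union>s\<in>C. {point s 0}) = (\<lambda>s. point s 0) ` C" by blast
    ultimately show "closedin ?Y ((\<lambda>s. point s 0) ` C)" by simp
  qed
  have "arcs C \<subseteq> topspace X"
    using connectedin_subset_topspace[OF arcs_connected[OF C(1)]] .
  then have "closedin ?Y {x \<in> topspace ?Y. q x \<in> arcs C} \<longleftrightarrow> closedin X (arcs C)"
    using quotient unfolding quotient_map_closedin by blast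
  then show ?thesis using cl unfolding pre by blast
qed

end

section \<open>Boundary components, inner punctures and the Euler characteristic\<close>

context triangulation
begin

definition outer_orbs :: "('f \<times> nat) set set" where
  "outer_orbs = {C \<in> orbs. C \<inter> bd \<noteq> {}}"

definition inner_orbs :: "('f \<times> nat) set set" where
  "inner_orbs = {C \<in> orbs. C \<inter> bd = {}}"

lemma orbs_split: "orbs = outer_orbs \<union> inner_orbs" "outer_orbs \<inter> inner_orbs = {}"
  by (auto simp: outer_orbs_def inner_orbs_def)

text \<open>A common point is either an inner point of a single arc or a vertex, and the orbit of a
  vertex on the boundary is determined by \<open>start_in_arcs\<close>.\<close>

lemma arcs_disjoint:
  assumes C: "C \<in> orbs" "C \<inter> bd \<noteq> {}" and C': "C' \<in> orbs" "C' \<inter> bd \<noteq> {}" and ne: "arcs C \<inter> arcs C' \<noteq> {}"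
  shows "C = C'"
proof -
  obtain y where y: "y \<in> arcs C" "y \<in> arcs C'" using ne by auto
  obtain b t where b: "b \<in> bd" "b \<in> C" "t \<in> {0..1}" "y = q (point b t)"
    using y(1) by (auto simp: arcs_def edge_D)
  obtain b' u where b': "b' \<in> bd" "b' \<in> C'" "u \<in> {0..1}" "y = q (point b' u)"
    using y(2) by (auto simp: arcs_def edge_D)
  have F: "b \<in> sides F" "b' \<in> sides F" using b(1) b'(1) by (simp_all add: bd_def faces_D)
  have orb: "orb b = C" "orb b' = C'" using orbs_mem C(1) C'(1) b(2) b'(2) by metis+
  have "q (point b t) = q (point b' u)" using b b' by simp
  from boundary_class[OF b(1,3) point_mem[OF F(2) b'(3)] this]
  show "C = C'"
  proof
    assume eq: "point b' u = point b t"
    consider "u \<in> {0<..<1}" | "u = 0" | "u = 1" using b'(3) by fastforce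
    then show ?thesis
    proof cases
      case 1
      then show ?thesis using point_eq_inner[OF eq F(2,1) _ b(3)] orb by simp
    next
      case 2
      then have "y = start b'" using b'(4) by (simp add: start_def)
      then show ?thesis using start_in_arcs[OF C bd_S[OF b'(1)]] y(1) orb by simp
    next
      case 3
      then have "y = start (nxt b')" using b'(4) by (simp add: start_def point_1)
      moreover have "nxt b' \<in> S" using bd_S[OF b'(1)] S_simps by blast
      ultimately show ?thesis using start_in_arcs[OF C] y(1) orb orb_nxt_bd[OF b'(1)] by metis
    qed
  next
    assume "\<exists>s\<in>S. orb s = orb b \<and> point b' u = point s 0"
    then obtain s where s: "s \<in> S" "orb s = orb b" "point b' u = point s 0" by blast
    have "start s \<in> arcs C'" using y(2) b'(4) s(3) by (simp add: start_def)
    then show ?thesis using start_in_arcs[OF C' s(1)] s(2) orb by simp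
  qed
qed

lemma arcs_nonempty: "C \<inter> bd \<noteq> {} \<Longrightarrow> arcs C \<noteq> {}"
  using start_in_edge by (fastforce simp: arcs_def)

lemma arcs_inj: "inj_on arcs outer_orbs"
proof (rule inj_onI)
  fix C C' assume C: "C \<in> outer_orbs" "C' \<in> outer_orbs" "arcs C = arcs C'"
  then have "arcs C \<inter> arcs C' \<noteq> {}" using arcs_nonempty by (auto simp: outer_orbs_def)
  then show "C = C'" using arcs_disjoint C by (auto simp: outer_orbs_def)
qed

lemma bd_outer: "b \<in> bd \<Longrightarrow> orb b \<in> outer_orbs"
  using self_orb[of b] bd_S orb_in by (auto simp: outer_orbs_def)

lemma surface_boundary_arcs: "surface_boundary F q = \<Union>(arcs ` outer_orbs)"
proof (intro subset_antisym subsetI)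
  fix x assume "x \<in> surface_boundary F q"
  then obtain b where b: "b \<in> bd" "x \<in> edge_at D b" by (auto simp: surface_boundary_bd)
  then have "x \<in> arcs (orb b)" using self_orb[of b] unfolding arcs_def by blast
  then show "x \<in> \<Union>(arcs ` outer_orbs)" using bd_outer[OF b(1)] by blast
qed (auto simp: arcs_def surface_boundary_bd)

lemma boundary_components_arcs: "boundary_components X F q = arcs ` outer_orbs"
  unfolding boundary_components_def
proof (rule connected_components_of_closed_partition)
  let ?Y = "subtopology X (surface_boundary F q)"
  have sub: "arcs C \<subseteq> topspace X" if "C \<in> orbs" for C
    using connectedin_subset_topspace[OF arcs_connected[OF that]] .
  have SB: "surface_boundary F q \<subseteq> topspace X"
    using sub by (auto simp: surface_boundary_arcs outer_orbs_def)
  show "finite (arcs ` outer_orbs)" using finite_orbs by (simp add: outer_orbs_def)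
  show "\<Union>(arcs ` outer_orbs) = topspace ?Y"
    using SB by (auto simp: surface_boundary_arcs[symmetric])
  fix A assume "A \<in> arcs ` outer_orbs"
  then obtain C where C: "C \<in> orbs" "C \<inter> bd \<noteq> {}" "A = arcs C" by (auto simp: outer_orbs_def)
  have A_SB: "A \<subseteq> surface_boundary F q" using C by (auto simp: surface_boundary_arcs outer_orbs_def)
  show "closedin ?Y A" using closedin_subset_topspace[OF arcs_closed[OF C(1,2)]] A_SB C(3) by simp
  show "connectedin ?Y A" using arcs_connected[OF C(1)] A_SB C(3) by (simp add: connectedin_subtopology)
  show "A \<noteq> {}" using arcs_nonempty C by simp
  fix B assume "B \<in> arcs ` outer_orbs" "A \<noteq> B"
  then show "A \<inter> B = {}" using arcs_disjoint C by (auto simp: outer_orbs_def)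
qed

lemma P_start: "P = start ` S"
proof -
  have "(\<lambda>s. point s 0) ` sides F = F \<times> {tri_vertex 0, tri_vertex 1, tri_vertex 2}"
  proof (intro subset_antisym subsetI)
    fix x assume "x \<in> F \<times> {tri_vertex 0, tri_vertex 1, tri_vertex 2}"
    then obtain T z where Tz: "x = (T, z)" "T \<in> F" "z \<in> {tri_vertex 0, tri_vertex 1, tri_vertex 2}"
      by blast
    have "\<exists>i<3. z = tri_vertex i"
      using Tz(3) by (elim insertE) (rule exI[of _ 0], simp, rule exI[of _ 1], simp, rule exI[of _ 2], simp, simp)
    then obtain i where "T \<in> F" "i < 3" "x = (T, tri_vertex i)" using Tz by blast
    then have "(T, i) \<in> sides F" "x = point (T, i) 0" by (simp_all add: in_sides point_def side_point_0)
    then show "x \<in> (\<lambda>s. point s 0) ` sides F" by blast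
  next
    fix x assume "x \<in> (\<lambda>s. point s 0) ` sides F"
    then obtain s where s: "s \<in> sides F" "x = point s 0" by blast
    then show "x \<in> F \<times> {tri_vertex 0, tri_vertex 1, tri_vertex 2}"
      using less_3_cases[of "snd s"] by (auto simp: in_sides point_def side_point_0)
  qed
  then have "P = q ` (\<lambda>s. point s 0) ` sides F" by (simp only: P_eq)
  then show ?thesis by (simp add: image_image start_def faces_D)
qed

definition vertex :: "('f \<times> nat) set \<Rightarrow> 'a" where
  "vertex C = start (SOME s. s \<in> C)"

lemma vertex_eq:
  assumes "C \<in> inner_orbs" "s \<in> C"
  shows "vertex C = start s"
proof -
  have C: "C \<in> orbs" "C \<inter> bd = {}" using assms by (auto simp: inner_orbs_def)
  have s: "s \<in> S" "orb s = C" using orbs_mem[OF C(1)] assms(2) by blast+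
  have "(SOME s. s \<in> C) \<in> orb s" using someI[of "\<lambda>s. s \<in> C"] assms(2) s(2) by simp
  then show ?thesis using steps_without_bd[OF s(1)] s(2) C(2) by (simp add: vertex_def)
qed

lemma start_eq_vertex:
  assumes C: "C \<in> inner_orbs" and s: "s \<in> S"
  shows "start s = vertex C \<longleftrightarrow> orb s = C"
proof -
  have C': "C \<in> orbs" using C by (simp add: inner_orbs_def)
  then obtain t where t: "t \<in> S" "orb t = C" by (auto simp: orbs_def)
  have v: "vertex C = start t" using vertex_eq[OF C] orbs_mem[OF C', of t] t by simp
  show ?thesis
  proof
    assume "start s = vertex C"
    then show "orb s = C" using start_eq_orb[OF s t(1)] v t(2) by simp
  next
    assume "orb s = C"
    then show "start s = vertex C" using vertex_eq[OF C, of s] orbs_mem[OF C', of s] s by simp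
  qed
qed

lemma vertex_inj: "inj_on vertex inner_orbs"
proof (rule inj_onI)
  fix C C' assume C: "C \<in> inner_orbs" "C' \<in> inner_orbs" "vertex C = vertex C'"
  then obtain s where s: "s \<in> S" "orb s = C" by (auto simp: inner_orbs_def orbs_def)
  then have "start s = vertex C'" using start_eq_vertex[OF C(1)] C(3) by simp
  then show "C = C'" using start_eq_vertex[OF C(2) s(1)] s(2) by simp
qed

lemma inner_punctures_vertex: "inner_punctures P F q = vertex ` inner_orbs"
proof (intro subset_antisym subsetI)
  fix p assume "p \<in> inner_punctures P F q"
  then obtain s where s: "s \<in> S" "p = start s" "start s \<notin> surface_boundary F q"
    by (auto simp: inner_punctures_def P_start)
  then have "orb s \<in> inner_orbs" using start_in_boundary[OF s(1)] orb_in by (auto simp: inner_orbs_def)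
  then show "p \<in> vertex ` inner_orbs" using start_eq_vertex[OF _ s(1)] s(2) by blast
next
  fix p assume "p \<in> vertex ` inner_orbs"
  then obtain C where C: "C \<in> inner_orbs" "p = vertex C" by blast
  then obtain s where s: "s \<in> S" "orb s = C" by (auto simp: inner_orbs_def orbs_def)
  then have "p = start s" using start_eq_vertex[OF C(1) s(1)] C(2) by simp
  moreover have "start s \<notin> surface_boundary F q"
    using start_in_boundary[OF s(1)] s(2) C(1) by (simp add: inner_orbs_def)
  ultimately show "p \<in> inner_punctures P F q" using s(1) by (auto simp: inner_punctures_def P_start)
qed

text \<open>The ends of a side are its start and the start of the next side, so counting ends in
  \<open>Q\<close> is spreading the indicator function of the orbit.\<close>

lemma endpoint_element_loop:
  assumes C: "\<And>s. s \<in> S \<Longrightarrow> start s \<in> Q \<longleftrightarrow> orb s = C"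
  shows "endpoint_element F q Q = weyl (loop_exponent C)"
proof -
  have "(if e \<in> edges D then int (endpoints_in F q Q e) else 0) = loop_exponent C e" for e
  proof (cases "e \<in> edges D")
    case True
    define s where "s = (SOME s. s \<in> sides F \<and> edge_at D s = e)"
    have "\<exists>s. s \<in> sides F \<and> edge_at D s = e" using True by (auto simp: edges_def faces_D)
    then have s: "s \<in> sides F" "edge_at D s = e"
      unfolding s_def by (metis (mono_tags, lifting) someI_ex)+
    then have sS: "s \<in> S" "nxt s \<in> S" by (simp_all add: faces_D nxt_sides)
    have "endpoints_in F q Q e = of_bool (start s \<in> Q) + of_bool (start (nxt s) \<in> Q)"
      unfolding endpoints_in_def s_def[symmetric] start_def point_1[symmetric]
      by (simp add: case_prod_unfold point_def side_point_0 side_point_1)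
    also have "int \<dots> = loop_exponent C e"
      using C[OF sS(1)] C[OF sS(2)] s(2) spread_nxt[OF sS(1), of "\<lambda>C'. of_bool (C' = C)"]
      by (simp add: loop_exponent_def)
    finally show ?thesis using True by simp
  qed (simp add: loop_exponent_def spread_outside)
  then show ?thesis by (simp add: endpoint_element_def)
qed

lemma puncture_element: "C \<in> inner_orbs \<Longrightarrow> endpoint_element F q {vertex C} = weyl (loop_exponent C)"
  by (rule endpoint_element_loop) (simp add: start_eq_vertex)

lemma boundary_element: "C \<in> outer_orbs \<Longrightarrow> endpoint_element F q (arcs C) = weyl (loop_exponent C)"
  by (rule endpoint_element_loop) (simp add: start_in_arcs outer_orbs_def)

text \<open>Since \<open>arcs\<close> and \<open>vertex\<close> are injective, scalars indexed by
  boundary components and by inner punctures amount to one family indexed by orbits.\<close>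

lemma invariants_product_iff:
  "invariants_product X P F q sv V r h \<longleftrightarrow>
    (\<exists>f. (\<forall>C\<in>orbs. \<forall>v\<in>V. r (weyl (loop_exponent C)) v = sv (f C) v) \<and> (\<Prod>C\<in>orbs. f C) = h)"
proof
  assume "invariants_product X P F q sv V r h"
  then obtain hp hb where
    hp: "\<And>C. C \<in> inner_orbs \<Longrightarrow> acts_by_scalar sv V r (endpoint_element F q {vertex C}) (hp (vertex C))"
    and hb: "\<And>C. C \<in> outer_orbs \<Longrightarrow> acts_by_scalar sv V r (endpoint_element F q (arcs C)) (hb (arcs C))"
    and h: "(\<Prod>d\<in>arcs ` outer_orbs. hb d) * (\<Prod>p\<in>vertex ` inner_orbs. hp p) = h"
    unfolding invariants_product_def boundary_components_arcs inner_punctures_vertex by blast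
  define f where "f C = (if C \<in> outer_orbs then hb (arcs C) else hp (vertex C))" for C
  have "(\<Prod>C\<in>orbs. f C) = (\<Prod>C\<in>outer_orbs. f C) * (\<Prod>C\<in>inner_orbs. f C)"
    using orbs_split finite_orbs by (simp add: prod.union_disjoint)
  also have "(\<Prod>C\<in>outer_orbs. f C) = (\<Prod>d\<in>arcs ` outer_orbs. hb d)"
    by (simp add: f_def prod.reindex[OF arcs_inj])
  also have "(\<Prod>C\<in>inner_orbs. f C) = (\<Prod>p\<in>vertex ` inner_orbs. hp p)"
    unfolding prod.reindex[OF vertex_inj] o_def using orbs_split(2)
    by (intro prod.cong) (auto simp: f_def)
  finally have "(\<Prod>C\<in>orbs. f C) = h" using h by simp
  moreover have "r (weyl (loop_exponent C)) v = sv (f C) v" if "C \<in> orbs" "v \<in> V" for C v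
  proof (cases "C \<in> outer_orbs")
    case True
    then show ?thesis using hb[OF True] that(2) by (simp add: f_def acts_by_scalar_def boundary_element)
  next
    case False
    then have "C \<in> inner_orbs" using that(1) orbs_split(1) by blast
    then show ?thesis using hp that(2) False by (simp add: f_def acts_by_scalar_def puncture_element)
  qed
  ultimately show "\<exists>f. (\<forall>C\<in>orbs. \<forall>v\<in>V. r (weyl (loop_exponent C)) v = sv (f C) v) \<and> (\<Prod>C\<in>orbs. f C) = h"
    by blast
next
  assume "\<exists>f. (\<forall>C\<in>orbs. \<forall>v\<in>V. r (weyl (loop_exponent C)) v = sv (f C) v) \<and> (\<Prod>C\<in>orbs. f C) = h"
  then obtain f where f: "\<And>C v. C \<in> orbs \<Longrightarrow> v \<in> V \<Longrightarrow> r (weyl (loop_exponent C)) v = sv (f C) v"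
    and h: "(\<Prod>C\<in>orbs. f C) = h" by blast
  define hb where "hb d = f (the_inv_into outer_orbs arcs d)" for d
  define hp where "hp p = f (the_inv_into inner_orbs vertex p)" for p
  have hb: "hb (arcs C) = f C" if "C \<in> outer_orbs" for C
    using the_inv_into_f_f[OF arcs_inj that] by (simp add: hb_def)
  have hp: "hp (vertex C) = f C" if "C \<in> inner_orbs" for C
    using the_inv_into_f_f[OF vertex_inj that] by (simp add: hp_def)
  have "(\<Prod>d\<in>arcs ` outer_orbs. hb d) * (\<Prod>p\<in>vertex ` inner_orbs. hp p) =
      (\<Prod>C\<in>outer_orbs. f C) * (\<Prod>C\<in>inner_orbs. f C)"
    by (simp add: prod.reindex[OF arcs_inj] prod.reindex[OF vertex_inj] hb hp)
  also have "\<dots> = (\<Prod>C\<in>outer_orbs \<union> inner_orbs. f C)"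
    using orbs_split(2) finite_orbs by (intro prod.union_disjoint[symmetric]) (auto simp: outer_orbs_def inner_orbs_def)
  finally have "(\<Prod>d\<in>arcs ` outer_orbs. hb d) * (\<Prod>p\<in>vertex ` inner_orbs. hp p) = h"
    using h orbs_split(1) by simp
  moreover have "acts_by_scalar sv V r (endpoint_element F q {vertex C}) (hp (vertex C))" if "C \<in> inner_orbs" for C
    using f that orbs_split(1) by (simp add: acts_by_scalar_def puncture_element hp)
  moreover have "acts_by_scalar sv V r (endpoint_element F q (arcs C)) (hb (arcs C))" if "C \<in> outer_orbs" for C
    using f that orbs_split(1) by (simp add: acts_by_scalar_def boundary_element hb)
  ultimately show "invariants_product X P F q sv V r h"
    unfolding invariants_product_def boundary_components_arcs inner_punctures_vertex by blast
qed

text \<open>Punctures on the boundary correspond to unglued sides by their starts, the other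
  punctures to the orbits without unglued side.\<close>

lemma card_P: "card P = card inner_orbs + card bd"
proof -
  have split: "P = vertex ` inner_orbs \<union> start ` bd"
  proof (intro subset_antisym subsetI)
    fix p assume "p \<in> P"
    then obtain s where s: "s \<in> S" "p = start s" by (auto simp: P_start)
    show "p \<in> vertex ` inner_orbs \<union> start ` bd"
    proof (cases "orb s \<inter> bd = {}")
      case True
      then have "orb s \<in> inner_orbs" using orb_in[OF s(1)] by (simp add: inner_orbs_def)
      then show ?thesis using start_eq_vertex[OF _ s(1)] s(2) by blast
    next
      case False
      then obtain b where "b \<in> bd" "(s, b) \<in> turn_steps\<^sup>*" using steps_to_bd[OF s(1)] by blast
      then show ?thesis using start_steps s(2) by (metis UnI2 imageI)
    qed
  next
    fix p assume "p \<in> vertex ` inner_orbs \<union> start ` bd"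
    then show "p \<in> P"
      using inner_punctures_vertex bd_S by (auto simp: inner_punctures_def P_start)
  qed
  have "vertex ` inner_orbs \<inter> start ` bd = {}"
  proof (rule ccontr)
    assume "vertex ` inner_orbs \<inter> start ` bd \<noteq> {}"
    then obtain C b where "C \<in> inner_orbs" "b \<in> bd" "vertex C = start b" by auto
    moreover from this have "orb b = C" using start_eq_vertex[OF _ bd_S, of C b] by simp
    ultimately show False using self_orb[of b] by (auto simp: inner_orbs_def)
  qed
  moreover have "inj_on start bd" by (rule inj_onI) (rule start_eq_bd)
  moreover have "finite bd" "finite inner_orbs"
    using finite_S finite_orbs by (simp_all add: bd_def inner_orbs_def)
  ultimately show ?thesis
    unfolding split by (simp add: card_Un_disjoint card_image vertex_inj)
qed

text \<open>Double counting of the sides: two for each inner edge and one for each boundary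
  arc.\<close>

lemma card_edges: "3 * card F + card bd = 2 * card (edges D)"
proof -
  have fib: "card {s \<in> S. edge_at D s = e} = (if e \<in> edge_at D ` bd then 1 else 2)" if "e \<in> edges D" for e
  proof -
    have "e \<in> edge_at D ` S" using that by (simp only: edges_def)
    then obtain t where t: "t \<in> S" "e = edge_at D t" by blast
    have "s \<in> S \<and> edge_at D s = e \<longleftrightarrow> s \<in> {t, g t}" for s
      using edge_eq[OF t(1), of s] t edge_g[OF t(1)] g_sides[OF t(1)] by auto
    then have "{s \<in> S. edge_at D s = e} = {t, g t}" by blast
    moreover have "e \<in> edge_at D ` bd \<longleftrightarrow> g t = t"
    proof
      assume "e \<in> edge_at D ` bd"
      then obtain b where b: "b \<in> bd" "edge_at D b = edge_at D t" using t(2) by auto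
      then have "t = b \<or> t = g b" using edge_eq[OF bd_S[OF b(1)] t(1)] by simp
      then show "g t = t" using bd_g[OF b(1)] by auto
    next
      assume "g t = t"
      then show "e \<in> edge_at D ` bd" using t by (auto simp: bd_def)
    qed
    ultimately show ?thesis by auto
  qed
  have inj: "inj_on (edge_at D) bd"
  proof (rule inj_onI)
    fix b b' assume b: "b \<in> bd" "b' \<in> bd" "edge_at D b = edge_at D b'"
    then show "b = b'" using edge_eq[OF bd_S[OF b(1)] bd_S[OF b(2)]] bd_g[OF b(1)] by auto
  qed
  have sub: "edge_at D ` bd \<subseteq> edges D" using bd_S edge_in by auto
  have "card S = (\<Sum>e\<in>edges D. card {s \<in> S. edge_at D s = e})"
    using sum.image_gen[OF finite_S, of "\<lambda>_. 1::nat" "edge_at D"] by (simp add: edges_def)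
  also have "\<dots> = (\<Sum>e\<in>edges D. if e \<in> edge_at D ` bd then 1 else 2)"
    by (intro sum.cong refl fib)
  finally have S: "card S = (\<Sum>e\<in>edges D. if e \<in> edge_at D ` bd then 1 else 2)" .
  have bd: "card bd = (\<Sum>e\<in>edges D. if e \<in> edge_at D ` bd then 1 else 0)"
    using sub finite_edges card_image[OF inj] by (simp add: sum.If_cases Int_absorb1)
  have "card S + card bd = (\<Sum>e\<in>edges D. if e \<in> edge_at D ` bd then 1 else 2) +
      (\<Sum>e\<in>edges D. if e \<in> edge_at D ` bd then 1 else 0)"
    by (simp only: S[symmetric] bd[symmetric])
  also have "\<dots> = (\<Sum>e\<in>edges D. 2)"
    unfolding sum.distrib[symmetric] by (intro sum.cong) auto
  finally have "card S + card bd = 2 * card (edges D)" by simp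
  then show ?thesis by (simp add: faces_D card_sides)
qed

text \<open>By \<open>card_P\<close> and \<open>card_edges\<close> the Euler characteristic equals
  the number of inner orbits plus edges minus twice the faces, which turns the hypothesis into the
  defining equation of the genus.\<close>

lemma genus_eqI:
  assumes "2 * card F + 2 = card (edges D) + card orbs + 2 * \<gamma>"
  shows "genus X P F q = \<gamma>"
proof -
  have n: "card orbs = card outer_orbs + card inner_orbs"
    using orbs_split finite_orbs by (simp add: card_Un_disjoint)
  have b: "card (boundary_components X F q) = card outer_orbs"
    by (simp add: boundary_components_arcs card_image arcs_inj)
  have "euler_characteristic P F q = 2 - 2 * int \<gamma> - int (card (boundary_components X F q))"
    unfolding euler_characteristic_def b using card_P card_edges n assms by linarith
  then show ?thesis
    unfolding genus_def by (intro the_equality) auto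
qed

end

lemma triangulated_surface_triangulation:
  assumes "triangulated_surface X P F q"
  obtains g where "triangulation X P F q g"
proof -
  obtain g where "\<forall>s\<in>sides F. g s \<in> sides F \<and> g (g s) = s"
    "\<forall>x\<in>F \<times> model_triangle. \<forall>y\<in>F \<times> model_triangle. q x = q y \<longleftrightarrow> (x, y) \<in> (gluing_relation F g)\<^sup>*"
    using assms unfolding triangulated_surface_def by blast
  then have "triangulation X P F q g"
    using assms unfolding triangulated_surface_def by unfold_locales auto
  then show ?thesis using that by blast
qed

section \<open>Local representations\<close>

lemma triangle_faces [simp]: "faces (triangle T) = {T}"
  and triangle_edge_at [simp]: "edge_at (triangle T) = (\<lambda>s. s)"
  by (simp_all add: triangle_def)

lemma unglued_pattern:
  assumes "finite (faces D)" "edge_at D = (\<lambda>s. s)" "odd N" "root_of_unity_of_order N \<omega>"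
  shows "glued_pattern_mod D (\<lambda>s. s) N \<omega>"
  using assms by unfold_locales auto

text \<open>With nothing glued, \<open>turn\<close> runs once around the triangle, so there is a
  single orbit, the boundary circle; three edges then give a dimension with square
  \<open>N ^ (3 - 1)\<close>.\<close>

lemma irreducible_triangle_dimension:
  assumes root: "root_of_unity_of_order N \<omega>" and N: "odd N" and vs: "vector_space sv"
    and irr: "irreducible_rep \<omega> (triangle T) sv W r"
  shows "\<exists>b. finite b \<and> \<not> module.dependent sv b \<and> module.span sv b = W \<and> card b = N"
proof -
  interpret vector_space sv by (rule vs)
  interpret G: glued_pattern_mod "triangle T" "\<lambda>s. s" N \<omega>
    by (rule unglued_pattern[OF _ _ N root]) simp_all
  interpret G: pattern_representation "triangle T" "\<lambda>s. s" N \<omega> sv W r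
    using irr vs by unfold_locales (simp_all add: irreducible_rep_def)
  obtain b where b: "finite b" "independent b" "span b = W"
    "(card b)\<^sup>2 * card (residue_reps (triangle T) N \<inter> G.L.radical) = card (residue_reps (triangle T) N)"
    using G.simple_dimension G.irreducible_iff irr by blast
  have S: "sides {T} = {(T, 0), (T, Suc 0), (T, 2)}"
    by (auto simp: in_sides prod_eq_iff dest!: less_3_cases)
  have "G.orb (T, Suc 0) = G.orb (T, 0)" "G.orb (T, 2) = G.orb (T, Suc 0)"
    using G.orb_nxt[of "(T, 0)"] G.orb_nxt[of "(T, Suc 0)"] S by (simp_all add: nxt_simps)
  then have "G.orbs = {G.orb (T, 0)}" by (simp add: G.orbs_def S)
  then have "card (residue_reps (triangle T) N \<inter> G.L.radical) = N"
    using G.card_radical by simp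
  moreover have "card (residue_reps (triangle T) N) = N ^ 3"
    using card_residue_reps[of "triangle T" N] by (simp add: edges_def card_sides)
  ultimately have "(card b)\<^sup>2 * N = N\<^sup>2 * N" using b(4) by (simp add: power3_eq_cube power2_eq_square)
  then have "(card b)\<^sup>2 = N\<^sup>2" using G.N_pos by simp
  then have "card b = N" by (simp add: power2_eq_iff_nonneg)
  then show ?thesis using b by blast
qed

text \<open>The definition of the tensor product speaks about arbitrary bases of the factors, so it
  may be applied to bases of size \<open>N\<close>.\<close>

lemma tensor_product_dimension:
  assumes vsT: "vector_space sv" and vsW: "vector_space sw"
    and tp: "tensor_product F sv W sw V \<tau>" and F: "finite F"
    and bases: "\<And>T. T \<in> F \<Longrightarrow> \<exists>b. finite b \<and> \<not> module.dependent sv b \<and> module.span sv b = W T \<and> card b = N"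
  shows "\<exists>b. finite b \<and> \<not> module.dependent sw b \<and> module.span sw b = V \<and> card b = N ^ card F"
proof -
  obtain B where B: "\<And>T. T \<in> F \<Longrightarrow> finite (B T)" "\<And>T. T \<in> F \<Longrightarrow> \<not> module.dependent sv (B T)"
    "\<And>T. T \<in> F \<Longrightarrow> module.span sv (B T) = W T" "\<And>T. T \<in> F \<Longrightarrow> card (B T) = N"
    using bases by metis
  have "\<forall>B. (\<forall>T\<in>F. \<not> module.dependent sv (B T) \<and> module.span sv (B T) = W T) \<longrightarrow>
      inj_on \<tau> (\<Pi>\<^sub>E T\<in>F. B T) \<and> \<not> module.dependent sw (\<tau> ` (\<Pi>\<^sub>E T\<in>F. B T)) \<and>
      module.span sw (\<tau> ` (\<Pi>\<^sub>E T\<in>F. B T)) = V"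
    using tp unfolding tensor_product_def by (elim conjE)
  from this[rule_format, of B] B(2,3)
  have t: "inj_on \<tau> (\<Pi>\<^sub>E T\<in>F. B T)" "\<not> module.dependent sw (\<tau> ` (\<Pi>\<^sub>E T\<in>F. B T))"
    "module.span sw (\<tau> ` (\<Pi>\<^sub>E T\<in>F. B T)) = V"
    by simp_all
  have "card (\<tau> ` (\<Pi>\<^sub>E T\<in>F. B T)) = N ^ card F"
    using card_image[OF t(1)] card_PiE[OF F, of B] B(4) by simp
  moreover have "finite (\<tau> ` (\<Pi>\<^sub>E T\<in>F. B T))"
    using finite_PiE[OF F B(1)] by simp
  ultimately show ?thesis using t by blast
qed

lemma splitting_weyl: "splitting D (weyl k) = weyl (lift_exponent D k)"
  by (simp add: splitting_def weyl_def)

text \<open>Pullback along the splitting map: lifting exponents is additive and preserves the form,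
  hence the cocycle.\<close>

lemma (in glued_pattern_mod) split_representation:
  assumes vs: "vector_space sw" and rep: "representation \<omega> (split_pattern D) sw V R'"
    and R: "\<And>x v. x \<in> balanced_algebra \<omega> D \<Longrightarrow> v \<in> V \<Longrightarrow> R x v = R' (splitting D x) v"
  shows "representation \<omega> D sw V R"
proof (rule module_representation)
  interpret SP: glued_pattern_mod "split_pattern D" "\<lambda>s. s" N \<omega>
    by (rule unglued_pattern[OF _ _ odd_N root]) (simp_all add: finite_faces)
  interpret SP: pattern_representation "split_pattern D" "\<lambda>s. s" N \<omega> sw V R'
    by (intro pattern_representation.intro pattern_representation_axioms.intro vs rep
        SP.glued_pattern_mod_axioms)
  show "module_on sw V (\<lambda>k. R' (weyl (lift_exponent D k)))"
  proof unfold_locales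
    show "SP.subspace V" by (rule SP.V)
    fix k assume k: "k \<in> balanced D"
    note k' = lift_balanced[OF k]
    show "R' (weyl (lift_exponent D k)) v \<in> V" if "v \<in> V" for v by (rule SP.T_V[OF k' that])
    show "linear_on sw V sw (R' (weyl (lift_exponent D k)))" by (rule SP.T_linear[OF k'])
    fix l v assume l: "l \<in> balanced D" and v: "v \<in> V"
    show "R' (weyl (lift_exponent D k)) (R' (weyl (lift_exponent D l)) v) =
        sw (\<omega> powi form D k l) (R' (weyl (lift_exponent D (k + l))) v)"
      using SP.T_T[OF k' lift_balanced[OF l] v] by (simp add: form_lift[OF finite_faces] lift_add)
  qed (simp add: lift_0 SP.T_0)
  fix x v assume x: "x \<in> balanced_algebra \<omega> D" and v: "v \<in> V"
  have "k \<in> balanced D" if "k \<in> Poly_Mapping.keys x" for k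
    using keys_balanced_algebra[OF x] that by blast
  then show "R x v = (\<Sum>k\<in>Poly_Mapping.keys x. sw (Poly_Mapping.lookup x k) (R' (weyl (lift_exponent D k)) v))"
    unfolding R[OF x v] splitting_def
    using lift_balanced by (intro representation_sum_single[OF rep vs v]) auto
qed

theorem corollary1p3:
  fixes \<omega> :: complex and N :: nat
    and \<Sigma> :: "'a topology" and P :: "'a set"
    and F :: "'f set" and q :: "'f \<times> complex \<Rightarrow> 'a"
    and scaleT :: "complex \<Rightarrow> 'v::ab_group_add \<Rightarrow> 'v"
    and W\<^sub>T :: "'f \<Rightarrow> 'v::ab_group_add set" and r\<^sub>T :: "'f \<Rightarrow> ('f \<times> nat) torus \<Rightarrow> 'v \<Rightarrow> 'v"
    and \<tau> :: "('f \<Rightarrow> 'v) \<Rightarrow> 'w::ab_group_add"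
    and scaleW :: "complex \<Rightarrow> 'w::ab_group_add \<Rightarrow> 'w"
    and W :: "'w set" and R :: "'a set torus \<Rightarrow> 'w \<Rightarrow> 'w"
    and \<rho> :: "('a set \<Rightarrow> int) \<Rightarrow> complex" and h\<^sub>C :: complex
    and scaleU :: "complex \<Rightarrow> 'u::ab_group_add \<Rightarrow> 'u"
  defines "\<Delta> \<equiv> pattern_of F q"
  assumes "root_of_unity_of_order N \<omega>" and "odd N" and "N > 1"
    and "triangulated_surface \<Sigma> P F q" and "connected_space \<Sigma>"
    and "vector_space scaleT" and "vector_space scaleW" and "vector_space scaleU"
    and "local_representation \<omega> \<Delta> scaleT W\<^sub>T r\<^sub>T \<tau> scaleW W R"
    and "classical_shadow \<Delta> N scaleW W R \<rho>"
    and "acts_by_scalar scaleW W R (central_element \<Delta>) h\<^sub>C"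
  shows "(\<forall>U r. irreducible_rep \<omega> \<Delta> scaleU U r \<longrightarrow>
            ((\<exists>S. simple_submodule \<omega> \<Delta> scaleW W R S \<and> isomorphic_reps \<omega> \<Delta> scaleU U r scaleW S R)
             \<longleftrightarrow> classical_shadow \<Delta> N scaleU U r \<rho> \<and> invariants_product \<Sigma> P F q scaleU U r h\<^sub>C)) \<and>
         (\<exists>B. simple_decomposition \<omega> \<Delta> scaleW W R B) \<and>
         (\<forall>B S. simple_decomposition \<omega> \<Delta> scaleW W R B \<and> S \<in> B \<longrightarrow>
            card {S' \<in> B. isomorphic_reps \<omega> \<Delta> scaleW S R scaleW S' R} = N ^ genus \<Sigma> P F q)"
proof -
  obtain g where "triangulation \<Sigma> P F q g"
    using triangulated_surface_triangulation assms(5) by blast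
  then interpret TR: triangulation \<Sigma> P F q g .
  have \<Delta>: "\<Delta> = TR.D" by (simp add: \<Delta>_def)
  have faces_\<Delta>: "faces \<Delta> = F" by (simp add: \<Delta> TR.faces_D)
  interpret GP: glued_pattern_mod \<Delta> g N \<omega>
    unfolding \<Delta> using assms(2,3) by unfold_locales
  note local_rep = assms(10)[unfolded local_representation_def faces_\<Delta>]
  note irr = local_rep[THEN conjunct1, rule_format] and tp = local_rep[THEN conjunct2, THEN conjunct1]
  obtain R' where TR': "tensor_representation \<omega> \<Delta> W\<^sub>T r\<^sub>T \<tau> scaleW W R'"
    and R: "\<And>x v. x \<in> balanced_algebra \<omega> \<Delta> \<Longrightarrow> v \<in> W \<Longrightarrow> R x v = R' (splitting \<Delta> x) v"
    using local_rep[THEN conjunct2, THEN conjunct2] by auto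
  have R': "representation \<omega> (split_pattern \<Delta>) scaleW W R'"
    using TR' unfolding tensor_representation_def by (elim conjE)
  interpret vsW: vector_space scaleW by fact
  obtain b\<^sub>0 where b0: "finite b\<^sub>0" "vsW.independent b\<^sub>0" "vsW.span b\<^sub>0 = W" "card b\<^sub>0 = N ^ card F"
    using tensor_product_dimension[OF assms(7,8) tp TR.finite_F
        irreducible_triangle_dimension[OF assms(2,3,7) irr]] by blast
  interpret SP: glued_pattern_mod "split_pattern \<Delta>" "\<lambda>s. s" N \<omega>
    by (rule unglued_pattern[OF _ _ assms(3,2)]) (simp_all add: GP.finite_faces)
  interpret SP: pattern_representation "split_pattern \<Delta>" "\<lambda>s. s" N \<omega> scaleW W R'
    using assms(8) R' by unfold_locales
  interpret WR: pattern_representation \<Delta> g N \<omega> scaleW W R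
    using assms(8) GP.split_representation[OF assms(8) R' R] by unfold_locales
  have "b\<^sub>0 \<noteq> {}" using b0(4) assms(4) by auto
  interpret LR: local_representation_module \<Delta> g N \<omega> scaleW W R \<rho> R' h\<^sub>C b\<^sub>0
  proof unfold_locales
    show "R (weyl (\<lambda>x. int N * k x)) v = scaleW (\<rho> k) v" if "k \<in> balanced \<Delta>" "v \<in> W" for k v
      using assms(11) that by (simp add: classical_shadow_def acts_by_scalar_def)
    show "W \<noteq> {0}"
    proof
      assume "W = {0}"
      then have "b\<^sub>0 \<subseteq> {0}" using b0(3) vsW.span_superset by metis
      then have "0 \<in> b\<^sub>0" using \<open>b\<^sub>0 \<noteq> {}\<close> by auto
      then show False using b0(2) vsW.dependent_zero by blast
    qed
    show "R (weyl k) v = R' (weyl (lift_exponent \<Delta> k)) v" if "k \<in> balanced \<Delta>" "v \<in> W" for k v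
      using R[OF balanced_algebra.monomial[OF that(1)] that(2)] by (simp add: splitting_weyl)
    \<comment> \<open>The connectedness of the surface is used only here, in its combinatorial
      form.\<close>
    show "A = sides (faces \<Delta>)" if "A \<subseteq> sides (faces \<Delta>)" "A \<noteq> {}" "\<And>s. s \<in> A \<Longrightarrow> nxt s \<in> A \<and> g s \<in> A" for A
      using TR.connected_sides[OF assms(6)] that by (simp add: \<Delta>)
    show "R (weyl (\<lambda>x. if x \<in> edges \<Delta> then 2 else 0)) v = scaleW h\<^sub>C v" if "v \<in> W" for v
      using assms(12) that by (simp add: acts_by_scalar_def central_element_def)
    show "faces \<Delta> \<noteq> {}" using TR.F_nonempty by (simp add: faces_\<Delta>)
    show "finite b\<^sub>0" "W \<subseteq> vsW.span b\<^sub>0" using b0 by auto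
    show "1 < N" by fact
    show "vsW.dim W = N ^ card (faces \<Delta>)"
      using vsW.dim_span_eq_card_independent[OF b0(2)] b0(3,4) by (simp add: faces_\<Delta>)
  qed
  show ?thesis
  proof (intro conjI allI impI)
    fix U r assume U: "irreducible_rep \<omega> \<Delta> scaleU U r"
    show "(\<exists>S. simple_submodule \<omega> \<Delta> scaleW W R S \<and> isomorphic_reps \<omega> \<Delta> scaleU U r scaleW S R) \<longleftrightarrow>
        classical_shadow \<Delta> N scaleU U r \<rho> \<and> invariants_product \<Sigma> P F q scaleU U r h\<^sub>C"
      unfolding LR.embeds_iff[OF U assms(9)] TR.invariants_product_iff classical_shadow_def acts_by_scalar_def
      unfolding \<Delta> ..
  next
    show "\<exists>B. simple_decomposition \<omega> \<Delta> scaleW W R B" by (rule LR.decomposition_exists)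
  next
    fix B S assume "simple_decomposition \<omega> \<Delta> scaleW W R B \<and> S \<in> B"
    then obtain \<gamma> where \<gamma>: "2 * card (faces \<Delta>) + 2 = card (edges \<Delta>) + card GP.orbs + 2 * \<gamma>"
      "card {S' \<in> B. isomorphic_reps \<omega> \<Delta> scaleW S R scaleW S' R} = N ^ \<gamma>"
      using LR.decomposition_multiplicity by blast
    \<comment> \<open>The genus is a definite description; \<open>genus_eqI\<close> identifies it
      from the equation that came with the multiplicity.\<close>
    have "genus \<Sigma> P F q = \<gamma>"
      by (rule TR.genus_eqI) (use \<gamma>(1) in \<open>simp add: faces_\<Delta> \<Delta>[symmetric]\<close>)
    then show "card {S' \<in> B. isomorphic_reps \<omega> \<Delta> scaleW S R scaleW S' R} = N ^ genus \<Sigma> P F q"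
      using \<gamma>(2) by simp
  qed
qed

end
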